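(* Let $G$ be a finite Coxeter group with Coxeter matrix $M=(m_{i,j})_{n\times n}$ and simple reflections $s_1,\dots,s_n$, realized as a reflection group through its geometric representation, let $R$ be its set of reflections, and let $\Upsilon=\{\mu_s,\tau_s\}_{s\in R}$ be numbers with $\mu_s=\mu_{s'}$, $\tau_s=\tau_{s'}$ whenever $s,s'$ lie in the same conjugacy class. Then $B_G(\Upsilon)$ has the following presentation. Generators: $s_1,\dots,s_n,e_1,\dots,e_n$. Relations: (1) $s_i^2=1$ for any $i$; (2) $[s_is_j\cdots]_{m_{i,j}}=[s_js_i\cdots]_{m_{i,j}}$ for all $i,j$; (3) $s_ie_i=e_i=e_is_i$ for any $i$; (4) $e_i^2=\tau_ie_i$, where $\tau_i=\tau_{s_i}$; (5) $s_ie_j=e_js_i$ and $e_ie_j=e_je_i$ if $m_{i,j}=2$; (6) $e_i[s_js_i\cdots]_{2l-1}e_i=\mu_{s_\epsilon}e_i$ for $1\le l\le k$ if $m_{i,j}=2k+1$, where $\epsilon=i$ if $l$ is odd and $\epsilon=j$ if $l$ is even; (7) $[s_is_j\cdots]_{2k}e_i=e_j[s_is_j\cdots]_{2k}$ if $m_{i,j}=2k+1$; (8) $e_iwe_j=0$ for any word $w$ composed from $\{s_i,s_j\}$ if $m_{i,j}=2k$; (9) $e_i[s_js_i\cdots]_{2l-1}e_i=(\mu_s+\mu_{s'}c_{i,j})e_i$ for $1\le l\le k$ if $m_{i,j}=2k$, where $c_{i,j}=[s_is_j\cdots]_{2k}$, $s=[s_js_i\cdots]_{2l-1}$ and $s'=c_{i,j}^{-1}s$;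 (10) $[s_is_j\cdots]_{2k-1}e_j=e_j[s_is_j\cdots]_{2k-1}$ if $m_{i,j}=2k$.
   Context: $[xy\cdots]_k$ denotes the alternating word $xyxy\cdots$ of length $k$. The Coxeter group is $G=\langle s_1,\dots,s_n\mid s_i^2=1,\ [s_is_j\cdots]_{m_{i,j}}=[s_js_i\cdots]_{m_{i,j}}\ (i\neq j)\rangle$ with $m_{i,i}=1$, $m_{i,j}=m_{j,i}\ge2$ for $i\ne j$; its reflections $R$ are the conjugates of the $s_i$. For $s\in R$ let $H_s$ be its fixed hyperplane in the (complexified) geometric representation; $s\mapsto H_s$ is a bijection from $R$ to the set of reflection hyperplanes, and $w(H_s)=H_{wsw^{-1}}$. For $s,t\in R$ put $R(s,t)=\{r\in R: rtr=s\}$. $B_G(\Upsilon)$ is the unital associative $\mathbb{C}$-algebra generated by $\{\bar w\}_{w\in G}\cup\{e_s\}_{s\in R}$ with relations: (0) $\bar w_1\bar w_2=\bar w_3$ if $w_1w_2=w_3$ in $G$ (and $\bar1$ is the unit); (1) $\bar se_s=e_s\bar s=e_s$; (2) $e_s^2=\tau_se_s$; (3) $\bar we_t=e_s\bar w$ if $wtw^{-1}=s$; and for $s\ne t$: (4) $e_se_t=e_te_s$ if $\{r\in R:H_r\supset H_s\cap H_t\}=\{s,t\}$; (5) $e_se_t=\big(\sum_{r\in R(s,t)}\mu_r\bar r\big)e_t$ if $\{r\in R:H_r\supset H_s\cap H_t\}\neq\{s,t\}$ and $R(s,t)\ne\emptyset$; (6) $e_se_t=0$ if $\{r\in R:H_r\supset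 H_s\cap H_t\}\ne\{s,t\}$ and $R(s,t)=\emptyset$. In the presentation of the theorem the generator $s_i$ corresponds to $\bar s_i$ and $e_i$ to $e_{s_i}$.
   Formalization: Relation (8) is imposed only for m_{i,j}=2k with k≥2, since for m_{i,j}=2 it would force e_ie_j=0, false for A_1×A_1; relation (9) is imposed only for 1≤l≤k-1, since for l=k one has e_ise_i=τ_ic_{i,j}e_i and the printed relation fails, e.g. for B_2 with τ=1, μ=0. *)

theory Defs
  imports "HOL-Analysis.Analysis" "HOL-Algebra.QuotRing" "HOL-Algebra.Module"
    "HOL-Library.Poly_Mapping"
begin

section \<open>Coxeter groups\<close>

definition coxeter_matrix :: "('i \<Rightarrow> 'i \<Rightarrow> nat) \<Rightarrow> bool" where
  "coxeter_matrix m \<longleftrightarrow>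
     (\<forall>i. m i i = 1) \<and> (\<forall>i j. m i j = m j i) \<and> (\<forall>i j. i \<noteq> j \<longrightarrow> m i j \<ge> 2)"

text \<open>The alternating word \<open>xyxy\<dots>\<close> of length \<open>k\<close>, beginning with \<open>x\<close>.\<close>

fun alt :: "nat \<Rightarrow> 'a \<Rightarrow> 'a \<Rightarrow> 'a list" where
  "alt 0 x y = []"
| "alt (Suc k) x y = x # alt k y x"

text \<open>
  The group presented by \<open>m\<close> is the quotient of the free monoid on the index type by the congruence
  generated by the defining relations; as every generator is an involution modulo the relations,
  formal inverses are not needed. The relations require all entries of \<open>m\<close> to be finite, which
  is automatic for finite Coxeter groups.
\<close>

inductive cox_eq :: "('i \<Rightarrow> 'i \<Rightarrow> nat) \<Rightarrow> 'i list \<Rightarrow> 'i list \<Rightarrow> bool"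
  for m :: "'i \<Rightarrow> 'i \<Rightarrow> nat" where
  refl: "cox_eq m u u"
| sym: "cox_eq m u v \<Longrightarrow> cox_eq m v u"
| trans: "cox_eq m u v \<Longrightarrow> cox_eq m v w \<Longrightarrow> cox_eq m u w"
| append: "cox_eq m u u' \<Longrightarrow> cox_eq m v v' \<Longrightarrow> cox_eq m (u @ v) (u' @ v')"
| square: "cox_eq m [i, i] []"
| braid: "i \<noteq> j \<Longrightarrow> cox_eq m (alt (m i j) i j) (alt (m i j) j i)"

definition cox_class :: "('i \<Rightarrow> 'i \<Rightarrow> nat) \<Rightarrow> 'i list \<Rightarrow> 'i list set" where
  "cox_class m w = {v. cox_eq m w v}"

definition coxeter_group :: "('i \<Rightarrow> 'i \<Rightarrow> nat) \<Rightarrow> 'i list set monoid" where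
  "coxeter_group m =
     \<lparr>carrier = range (cox_class m),
      mult = (\<lambda>A B. \<Union>u\<in>A. \<Union>v\<in>B. cox_class m (u @ v)),
      one = cox_class m []\<rparr>"

abbreviation simple :: "('i \<Rightarrow> 'i \<Rightarrow> nat) \<Rightarrow> 'i \<Rightarrow> 'i list set" where
  "simple m i \<equiv> cox_class m [i]"

definition conj_by :: "('g, 'b) monoid_scheme \<Rightarrow> 'g \<Rightarrow> 'g \<Rightarrow> 'g" where
  "conj_by G w x = w \<otimes>\<^bsub>G\<^esub> x \<otimes>\<^bsub>G\<^esub> inv\<^bsub>G\<^esub> w"

definition reflections :: "('i \<Rightarrow> 'i \<Rightarrow> nat) \<Rightarrow> 'i list set set" where
  "reflections m =
     {conj_by (coxeter_group m) w (simple m i) | w i. w \<in> carrier (coxeter_group m)}"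

section \<open>The complexified geometric representation\<close>

text \<open>
  The basis vector \<open>axis i 1\<close> is the simple root of \<open>i\<close>. The form is extended to the
  complexification bilinearly (not sesquilinearly).
\<close>

definition cox_form :: "('i::finite \<Rightarrow> 'i \<Rightarrow> nat) \<Rightarrow> complex ^ 'i \<Rightarrow> complex ^ 'i \<Rightarrow> complex" where
  "cox_form m x y =
     (\<Sum>i\<in>UNIV. \<Sum>j\<in>UNIV. x $ i * complex_of_real (- cos (pi / real (m i j))) * y $ j)"

definition simple_reflection ::
  "('i::finite \<Rightarrow> 'i \<Rightarrow> nat) \<Rightarrow> 'i \<Rightarrow> complex ^ 'i \<Rightarrow> complex ^ 'i" where
  "simple_reflection m i v = v - (2 * cox_form m (axis i 1) v) *s axis i 1"

text \<open>The action of a group element; it does not depend on the word chosen in its class.\<close>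

definition geometric_rep ::
  "('i::finite \<Rightarrow> 'i \<Rightarrow> nat) \<Rightarrow> 'i list set \<Rightarrow> complex ^ 'i \<Rightarrow> complex ^ 'i" where
  "geometric_rep m g v = foldr (simple_reflection m) (SOME w. w \<in> g) v"

definition hyperplane :: "('i::finite \<Rightarrow> 'i \<Rightarrow> nat) \<Rightarrow> 'i list set \<Rightarrow> (complex ^ 'i) set" where
  "hyperplane m s = {v. geometric_rep m s v = v}"

definition reflections_through ::
  "('i::finite \<Rightarrow> 'i \<Rightarrow> nat) \<Rightarrow> 'i list set \<Rightarrow> 'i list set \<Rightarrow> 'i list set set" where
  "reflections_through m s t =
     {r \<in> reflections m. hyperplane m r \<supseteq> hyperplane m s \<inter> hyperplane m t}"

definition refl_conj ::
  "('i \<Rightarrow> 'i \<Rightarrow> nat) \<Rightarrow> 'i list set \<Rightarrow> 'i list set \<Rightarrow> 'i list set set" where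
  "refl_conj m s t =
     {r \<in> reflections m. r \<otimes>\<^bsub>coxeter_group m\<^esub> t \<otimes>\<^bsub>coxeter_group m\<^esub> r = s}"

section \<open>Complex algebras given by generators and relations\<close>

text \<open>
  With concatenation as addition of words, \<open>'x list \<Rightarrow>\<^sub>0 complex\<close> with its convolution product is
  the free unital associative algebra on \<open>'x\<close>.
\<close>

instantiation list :: (type) monoid_add
begin

definition zero_list :: "'a list" where "zero_list = []"

definition plus_list :: "'a list \<Rightarrow> 'a list \<Rightarrow> 'a list" where "plus_list u v = u @ v"

instance by standard (simp_all add: zero_list_def plus_list_def)

end

type_synonym 'x free_poly = "'x list \<Rightarrow>\<^sub>0 complex"

abbreviation mon :: "'x list \<Rightarrow> 'x free_poly" where
  "mon w \<equiv> Poly_Mapping.single w 1"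

abbreviation const :: "complex \<Rightarrow> 'x free_poly" where
  "const c \<equiv> Poly_Mapping.single [] c"

text \<open>Algebras are \<open>module\<close> records over \<open>complex\<close>; the library's algebra locale is restricted to
  commutative algebras.\<close>

definition free_algebra :: "'x set \<Rightarrow> (complex, 'x free_poly) module" where
  "free_algebra X =
     \<lparr>carrier = {p. Poly_Mapping.keys p \<subseteq> lists X},
      mult = (*), one = 1, zero = 0, add = (+),
      smult = (\<lambda>c p. const c * p)\<rparr>"

definition quotient_algebra ::
  "(complex, 'a) module \<Rightarrow> 'a set \<Rightarrow> (complex, 'a set) module" where
  "quotient_algebra A I =
     ring.extend (A Quot I) (module.fields (\<lambda>c C. \<Union>x\<in>C. I +>\<^bsub>A\<^esub> (c \<odot>\<^bsub>A\<^esub> x)))"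

text \<open>A pair \<open>(p, q)\<close> of polynomials stands for the relation \<open>p = q\<close>; the library's ideals are
  two-sided.\<close>

definition relation_ideal ::
  "'x set \<Rightarrow> ('x free_poly \<times> 'x free_poly) set \<Rightarrow> 'x free_poly set" where
  "relation_ideal X Rel = Idl\<^bsub>free_algebra X\<^esub> {p - q | p q. (p, q) \<in> Rel}"

definition presented_algebra ::
  "'x set \<Rightarrow> ('x free_poly \<times> 'x free_poly) set \<Rightarrow> (complex, 'x free_poly set) module" where
  "presented_algebra X Rel = quotient_algebra (free_algebra X) (relation_ideal X Rel)"

definition presented_gen ::
  "'x set \<Rightarrow> ('x free_poly \<times> 'x free_poly) set \<Rightarrow> 'x \<Rightarrow> 'x free_poly set" where
  "presented_gen X Rel x = relation_ideal X Rel +>\<^bsub>free_algebra X\<^esub> mon [x]"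

definition algebra_iso ::
  "(complex, 'a) module \<Rightarrow> (complex, 'b) module \<Rightarrow> ('a \<Rightarrow> 'b) set" where
  "algebra_iso A B =
     {h \<in> ring_iso A B. \<forall>c. \<forall>x\<in>carrier A. h (c \<odot>\<^bsub>A\<^esub> x) = c \<odot>\<^bsub>B\<^esub> h x}"

section \<open>The algebra $B_G(\Upsilon)$\<close>

text \<open>
  For $B_G(\Upsilon)$, \<open>W w\<close> is the generator $\bar w$ ($w \in G$) and \<open>E s\<close> is $e_s$ ($s \in R$).
  For the second presentation, \<open>W i\<close> and \<open>E i\<close> are the generators $s_i$ and $e_i$.
\<close>

datatype 'a gen = W 'a | E 'a

definition BG_gens :: "('i \<Rightarrow> 'i \<Rightarrow> nat) \<Rightarrow> 'i list set gen set" where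
  "BG_gens m = W ` carrier (coxeter_group m) \<union> E ` reflections m"

inductive_set BG_rels ::
  "('i::finite \<Rightarrow> 'i \<Rightarrow> nat) \<Rightarrow> ('i list set \<Rightarrow> complex) \<Rightarrow> ('i list set \<Rightarrow> complex) \<Rightarrow>
   ('i list set gen free_poly \<times> 'i list set gen free_poly) set"
  for m :: "'i \<Rightarrow> 'i \<Rightarrow> nat" and \<mu> \<tau> :: "'i list set \<Rightarrow> complex" where
  unit: "(mon [W \<one>\<^bsub>coxeter_group m\<^esub>], 1) \<in> BG_rels m \<mu> \<tau>"
| prod: "\<lbrakk>w1 \<in> carrier (coxeter_group m); w2 \<in> carrier (coxeter_group m);
    w1 \<otimes>\<^bsub>coxeter_group m\<^esub> w2 = w3\<rbrakk>
    \<Longrightarrow> (mon [W w1, W w2], mon [W w3]) \<in> BG_rels m \<mu> \<tau>"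
| absorb_left: "s \<in> reflections m \<Longrightarrow> (mon [W s, E s], mon [E s]) \<in> BG_rels m \<mu> \<tau>"
| absorb_right: "s \<in> reflections m \<Longrightarrow> (mon [E s, W s], mon [E s]) \<in> BG_rels m \<mu> \<tau>"
| square: "s \<in> reflections m \<Longrightarrow> (mon [E s, E s], const (\<tau> s) * mon [E s]) \<in> BG_rels m \<mu> \<tau>"
| conj: "\<lbrakk>w \<in> carrier (coxeter_group m); s \<in> reflections m; t \<in> reflections m;
    conj_by (coxeter_group m) w t = s\<rbrakk>
    \<Longrightarrow> (mon [W w, E t], mon [E s, W w]) \<in> BG_rels m \<mu> \<tau>"
| commute: "\<lbrakk>s \<in> reflections m; t \<in> reflections m; s \<noteq> t; reflections_through m s t = {s, t}\<rbrakk>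
    \<Longrightarrow> (mon [E s, E t], mon [E t, E s]) \<in> BG_rels m \<mu> \<tau>"
| linked: "\<lbrakk>s \<in> reflections m; t \<in> reflections m; s \<noteq> t; reflections_through m s t \<noteq> {s, t};
    refl_conj m s t \<noteq> {}\<rbrakk>
    \<Longrightarrow> (mon [E s, E t], (\<Sum>r\<in>refl_conj m s t. const (\<mu> r) * mon [W r]) * mon [E t])
      \<in> BG_rels m \<mu> \<tau>"
| orthogonal: "\<lbrakk>s \<in> reflections m; t \<in> reflections m; s \<noteq> t; reflections_through m s t \<noteq> {s, t};
    refl_conj m s t = {}\<rbrakk>
    \<Longrightarrow> (mon [E s, E t], 0) \<in> BG_rels m \<mu> \<tau>"

abbreviation BG_algebra ::
  "('i::finite \<Rightarrow> 'i \<Rightarrow> nat) \<Rightarrow> ('i list set \<Rightarrow> complex) \<Rightarrow> ('i list set \<Rightarrow> complex) \<Rightarrow>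
   (complex, 'i list set gen free_poly set) module" where
  "BG_algebra m \<mu> \<tau> \<equiv> presented_algebra (BG_gens m) (BG_rels m \<mu> \<tau>)"

text \<open>
  In \<open>zero\<close> and \<open>link_even\<close>, \<open>m i j = 2 * k\<close> with \<open>k \<ge> 2\<close>: the case \<open>m i j = 2\<close> is governed
  by \<open>comm_W\<close> and \<open>comm_E\<close>. In \<open>link_even\<close> the index \<open>l = k\<close> is left out: there
  \<open>s = [s_j s_i \<dots>]\<close> of length \<open>2 * k - 1\<close> commutes with \<open>s_i\<close>, so that \<open>e_i s e_i = \<tau>\<^sub>i s e_i\<close>
  already by \<open>comm_even\<close> and \<open>square_E\<close>, and the right-hand side of \<open>link_even\<close>, which comes from
  \<open>linked\<close> for the two distinct reflections \<open>s_i\<close> and \<open>s s_i s\<close>, would be wrong.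
  In \<open>link_odd\<close> and \<open>link_even\<close>, \<open>2 * l - 1\<close> is truncated subtraction with \<open>l \<ge> 1\<close>.
\<close>

inductive_set simple_rels ::
  "('i \<Rightarrow> 'i \<Rightarrow> nat) \<Rightarrow> ('i list set \<Rightarrow> complex) \<Rightarrow> ('i list set \<Rightarrow> complex) \<Rightarrow>
   ('i gen free_poly \<times> 'i gen free_poly) set"
  for m :: "'i \<Rightarrow> 'i \<Rightarrow> nat" and \<mu> \<tau> :: "'i list set \<Rightarrow> complex" where
  square_W: "(mon [W i, W i], 1) \<in> simple_rels m \<mu> \<tau>"
| braid: "(mon (alt (m i j) (W i) (W j)), mon (alt (m i j) (W j) (W i))) \<in> simple_rels m \<mu> \<tau>"
| absorb_left: "(mon [W i, E i], mon [E i]) \<in> simple_rels m \<mu> \<tau>"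
| absorb_right: "(mon [E i, W i], mon [E i]) \<in> simple_rels m \<mu> \<tau>"
| square_E: "(mon [E i, E i], const (\<tau> (simple m i)) * mon [E i]) \<in> simple_rels m \<mu> \<tau>"
| comm_W: "m i j = 2 \<Longrightarrow> (mon [W i, E j], mon [E j, W i]) \<in> simple_rels m \<mu> \<tau>"
| comm_E: "m i j = 2 \<Longrightarrow> (mon [E i, E j], mon [E j, E i]) \<in> simple_rels m \<mu> \<tau>"
| link_odd: "\<lbrakk>m i j = 2 * k + 1; 1 \<le> l; l \<le> k\<rbrakk>
    \<Longrightarrow> (mon ([E i] @ alt (2 * l - 1) (W j) (W i) @ [E i]),
         const (\<mu> (simple m (if odd l then i else j))) * mon [E i]) \<in> simple_rels m \<mu> \<tau>"
| slide_odd: "m i j = 2 * k + 1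
    \<Longrightarrow> (mon (alt (2 * k) (W i) (W j) @ [E i]), mon ([E j] @ alt (2 * k) (W i) (W j)))
      \<in> simple_rels m \<mu> \<tau>"
| zero: "\<lbrakk>m i j = 2 * k; k \<ge> 2; w \<in> lists {W i, W j}\<rbrakk>
    \<Longrightarrow> (mon ([E i] @ w @ [E j]), 0) \<in> simple_rels m \<mu> \<tau>"
| link_even: "\<lbrakk>m i j = 2 * k; 1 \<le> l; l < k;
    c = cox_class m (alt (2 * k) i j); s = cox_class m (alt (2 * l - 1) j i);
    s' = inv\<^bsub>coxeter_group m\<^esub> c \<otimes>\<^bsub>coxeter_group m\<^esub> s\<rbrakk>
    \<Longrightarrow> (mon ([E i] @ alt (2 * l - 1) (W j) (W i) @ [E i]),
         (const (\<mu> s) + const (\<mu> s') * mon (alt (2 * k) (W i) (W j))) * mon [E i])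
      \<in> simple_rels m \<mu> \<tau>"
| comm_even: "m i j = 2 * k
    \<Longrightarrow> (mon (alt (2 * k - 1) (W i) (W j) @ [E j]), mon ([E j] @ alt (2 * k - 1) (W i) (W j)))
      \<in> simple_rels m \<mu> \<tau>"

abbreviation simple_algebra ::
  "('i \<Rightarrow> 'i \<Rightarrow> nat) \<Rightarrow> ('i list set \<Rightarrow> complex) \<Rightarrow> ('i list set \<Rightarrow> complex) \<Rightarrow>
   (complex, 'i gen free_poly set) module" where
  "simple_algebra m \<mu> \<tau> \<equiv> presented_algebra UNIV (simple_rels m \<mu> \<tau>)"

end

theory Submission
  imports Defs "HOL-Algebra.Multiplicative_Group"
begin

text \<open>
  The generator \<open>e\<^sub>s\<close> with \<open>s = u s\<^sub>i u\<inverse>\<close> has to be sent to \<open>u e\<^sub>i u\<inverse>\<close>. This is independent of \<open>u\<close> and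
  \<open>i\<close> because an element mapping a simple root to a simple root factors into alternating words in
  two generators \<open>s\<^sub>i, s\<^sub>j\<close> of length \<open>m\<^sub>i\<^sub>j - 1\<close>, which are exactly the words that relations (7) and
  (10) move past some \<open>e\<^sub>i\<close>. The relations between \<open>e\<^sub>s\<close> and \<open>e\<^sub>t\<close> only involve the
  reflections whose roots lie in the plane spanned by the roots of \<open>s\<close> and \<open>t\<close>. For finite \<open>G\<close> a
  dominant vector in the orbit of a generic vector orthogonal to that plane shows that the plane is
  conjugate to one spanned by two simple roots, so everything reduces to dihedral groups. There
  \<open>e\<^sub>s e\<^sub>i = q e\<^sub>i q e\<^sub>i\<close> whenever \<open>s = q s\<^sub>i q\<close> for a reflection \<open>q\<close>, which turns relations (6), (8), (9)
  into (5), (6) of the other presentation and back.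
\<close>

section \<open>Algebras given by generators and relations\<close>

text \<open>Both homomorphisms send a generator to a single word, so the comparison is a calculus of
  words modulo relations, without a basis of either algebra. The obstacle lies in the group: its
  presentation does not show that \<open>s_i s_j\<close> has order exactly \<open>m i j\<close>, nor
  that a reflection is determined by its root. Hence positive and negative roots and the
  faithfulness of the geometric representation are derived from the presentation, over the reals;
  complex vectors occur only as pairs of real ones. Finiteness of G gives finitely many roots (for
  generic and dominant vectors and for induction on height) and, by averaging, a nondegenerate form.
  The latter turns \<open>hyperplane\<close> inclusions into membership of roots in a plane. In a
  dihedral group everything rests on the congruence \<open>2 * l = n\<close> modulo
  \<open>m i j\<close>, whose solutions index the reflections conjugating \<open>s_i\<close> to the
  one of index \<open>n\<close>. It has one solution for odd \<open>m i j\<close>, and two or none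
  for even \<open>m i j\<close>: the origin of the single coefficient in \<open>link_odd\<close>, of
  the two in \<open>link_even\<close>, and of \<open>zero\<close>.\<close>

lemma keys_minus_subset:
  "Poly_Mapping.keys (p - q) \<subseteq> Poly_Mapping.keys p \<union> Poly_Mapping.keys (q :: 'a \<Rightarrow>\<^sub>0 'b::ab_group_add)"
  by (auto simp: in_keys_iff lookup_minus)

lemma keys_uminus: "Poly_Mapping.keys (- p) = Poly_Mapping.keys (p :: 'a \<Rightarrow>\<^sub>0 'b::ab_group_add)"
  by (auto simp: in_keys_iff)

lemma keys_mult_lists:
  assumes "Poly_Mapping.keys p \<subseteq> lists X" "Poly_Mapping.keys q \<subseteq> lists X"
  shows "Poly_Mapping.keys (p * q) \<subseteq> lists X"
proof
  fix w assume "w \<in> Poly_Mapping.keys (p * q)"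
  then obtain u v where "w = u + v" "u \<in> Poly_Mapping.keys p" "v \<in> Poly_Mapping.keys q"
    using keys_mult by fastforce
  then show "w \<in> lists X" using assms by (auto simp: plus_list_def)
qed

lemma mon_mult: "mon u * mon v = mon (u @ v)"
  by (simp add: mult_single plus_list_def)

lemma mon_Nil: "mon [] = 1"
  by (metis single_one zero_list_def)

lemma const_mult_single: "const a * Poly_Mapping.single w b = Poly_Mapping.single w (a * b)"
  by (simp add: mult_single plus_list_def)

lemma single_mult_const: "Poly_Mapping.single w b * const a = Poly_Mapping.single w (a * b)"
  by (simp add: mult_single plus_list_def mult.commute)

lemma ring_free_algebra: "ring (free_algebra X)"
proof (rule ringI)
  show "abelian_group (free_algebra X)"
  proof (rule abelian_groupI)
    fix p assume "p \<in> carrier (free_algebra X)"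
    then show "\<exists>q\<in>carrier (free_algebra X). q \<oplus>\<^bsub>free_algebra X\<^esub> p = \<zero>\<^bsub>free_algebra X\<^esub>"
      by (intro bexI[of _ "- p"]) (auto simp: free_algebra_def keys_uminus)
  qed (use keys_add in \<open>fastforce simp: free_algebra_def algebra_simps\<close>)+
  show "monoid (free_algebra X)"
    by (rule monoidI)
       (simp_all add: free_algebra_def zero_list_def mult.assoc keys_mult_lists)
qed (auto simp: free_algebra_def algebra_simps)

text \<open>The added term may sit on a word that already occurs, so additivity alone settles the
  step case for linear maps.\<close>

lemma free_poly_induct [case_names zero add]:
  fixes p :: "'x free_poly"
  assumes "P 0" and "\<And>p w c. P p \<Longrightarrow> P (p + Poly_Mapping.single w c)"
  shows "P p"
proof (induction p rule: update_induct)
  case const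
  then show ?case by (rule assms(1))
next
  case (update p w c)
  have "Poly_Mapping.update w c p = p + Poly_Mapping.single w c"
    using update(1) by (intro poly_mapping_eqI)
      (auto simp: lookup_update lookup_add lookup_single in_keys_iff when_def)
  then show ?case using assms(2) update(3) by simp
qed

text \<open>The linear extension of a map of words. When \<open>F\<close> respects concatenation it
  is a homomorphism of free algebras, namely one that sends each generator to a single word; both
  maps of the final isomorphism are of this kind.\<close>

definition push :: "('x list \<Rightarrow> 'y list) \<Rightarrow> 'x free_poly \<Rightarrow> 'y free_poly" where
  "push F p = (\<Sum>w\<in>Poly_Mapping.keys p. Poly_Mapping.single (F w) (Poly_Mapping.lookup p w))"

lemma push_superset:
  assumes "finite S" "Poly_Mapping.keys p \<subseteq> S"
  shows "push F p = (\<Sum>w\<in>S. Poly_Mapping.single (F w) (Poly_Mapping.lookup p w))"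
  unfolding push_def using assms by (intro sum.mono_neutral_left) (auto simp: in_keys_iff)

lemma push_zero [simp]: "push F 0 = 0"
  by (simp add: push_def)

lemma push_single [simp]: "push F (Poly_Mapping.single w c) = Poly_Mapping.single (F w) c"
  by (subst push_superset[of "{w}"]) auto

lemma push_add: "push F (p + q) = push F p + push F q"
proof -
  define S where "S = Poly_Mapping.keys p \<union> Poly_Mapping.keys q"
  have S: "finite S" "Poly_Mapping.keys p \<subseteq> S" "Poly_Mapping.keys q \<subseteq> S" "Poly_Mapping.keys (p + q) \<subseteq> S"
    using keys_add[of p q] by (auto simp: S_def)
  show ?thesis
    using S by (simp add: push_superset[of S] lookup_add single_add sum.distrib)
qed

lemma push_uminus: "push F (- p) = - push F p"
  using push_add[of F p "- p"] by (simp add: eq_neg_iff_add_eq_0 add.commute)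

lemma push_diff: "push F (p - q) = push F p - push F q"
  using push_add[of F p "- q"] by (simp add: push_uminus)

lemma push_sum: "push F (\<Sum>a\<in>S. p a) = (\<Sum>a\<in>S. push F (p a))"
  by (induction S rule: infinite_finite_induct) (auto simp: push_add)

lemma push_mult:
  assumes "\<And>u v. F (u @ v) = F u @ F v"
  shows "push F (p * q) = push F p * push F q"
proof (induction p rule: free_poly_induct)
  case (add p u a)
  have "push F (Poly_Mapping.single u a * q) = Poly_Mapping.single (F u) a * push F q"
    by (induction q rule: free_poly_induct)
       (auto simp: distrib_left push_add mult_single plus_list_def assms)
  then show ?case using add by (simp add: distrib_right push_add)
qed simp

lemma keys_push: "Poly_Mapping.keys (push F p) \<subseteq> F ` Poly_Mapping.keys p"
proof -
  have "Poly_Mapping.keys (push F p)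
      \<subseteq> (\<Union>w\<in>Poly_Mapping.keys p. Poly_Mapping.keys (Poly_Mapping.single (F w) (Poly_Mapping.lookup p w)))"
    unfolding push_def by (rule keys_sum)
  also have "\<dots> \<subseteq> F ` Poly_Mapping.keys p" by auto
  finally show ?thesis .
qed

lemma push_push: "push G (push F p) = push (G \<circ> F) p"
  by (induction p rule: free_poly_induct) (auto simp: push_add)

locale presentation =
  fixes X :: "'x set" and Rel :: "('x free_poly \<times> 'x free_poly) set"
  assumes rel_carrier:
    "\<And>p q. (p, q) \<in> Rel \<Longrightarrow> Poly_Mapping.keys p \<subseteq> lists X \<and> Poly_Mapping.keys q \<subseteq> lists X"
begin

text \<open>The supports are part of the relation because the type also contains polynomials in
  letters outside \<open>X\<close>, while the ideal absorbs only elements of the carrier.\<close>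

definition eqv :: "'x free_poly \<Rightarrow> 'x free_poly \<Rightarrow> bool" (infix "\<doteq>" 50) where
  "p \<doteq> q \<longleftrightarrow> Poly_Mapping.keys p \<subseteq> lists X \<and> Poly_Mapping.keys q \<subseteq> lists X
     \<and> p - q \<in> relation_ideal X Rel"

lemma carrier_iff: "p \<in> carrier (free_algebra X) \<longleftrightarrow> Poly_Mapping.keys p \<subseteq> lists X"
  by (simp add: free_algebra_def)

lemma relators_carrier: "{p - q | p q. (p, q) \<in> Rel} \<subseteq> carrier (free_algebra X)"
proof clarify
  fix p q assume "(p, q) \<in> Rel"
  then show "p - q \<in> carrier (free_algebra X)"
    using rel_carrier[of p q] keys_minus_subset[of p q] unfolding carrier_iff by blast
qed

sublocale A: ring "free_algebra X"
  by (rule ring_free_algebra)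

sublocale I: ideal "relation_ideal X Rel" "free_algebra X"
  unfolding relation_ideal_def by (rule A.genideal_ideal[OF relators_carrier])

lemma a_inv_eq: "Poly_Mapping.keys p \<subseteq> lists X \<Longrightarrow> \<ominus>\<^bsub>free_algebra X\<^esub> p = - p"
  by (rule A.minus_equality) (auto simp: free_algebra_def keys_uminus)

lemma a_minus_eq: "Poly_Mapping.keys p \<subseteq> lists X \<Longrightarrow> Poly_Mapping.keys q \<subseteq> lists X \<Longrightarrow>
    p \<ominus>\<^bsub>free_algebra X\<^esub> q = p - q"
  by (simp add: a_minus_def a_inv_eq) (simp add: free_algebra_def)

lemma eqv_carrier: "p \<doteq> q \<Longrightarrow> Poly_Mapping.keys p \<subseteq> lists X \<and> Poly_Mapping.keys q \<subseteq> lists X"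
  by (simp add: eqv_def)

lemma eqv_rel: "(p, q) \<in> Rel \<Longrightarrow> p \<doteq> q"
  unfolding eqv_def relation_ideal_def
  using A.genideal_self[OF relators_carrier] rel_carrier by blast

lemma eqv_refl: "Poly_Mapping.keys p \<subseteq> lists X \<Longrightarrow> p \<doteq> p"
  using I.zero_closed by (auto simp: eqv_def free_algebra_def)

lemma I_add: "p \<in> relation_ideal X Rel \<Longrightarrow> q \<in> relation_ideal X Rel \<Longrightarrow> p + q \<in> relation_ideal X Rel"
  using I.a_closed by (simp add: free_algebra_def)

lemma I_uminus: "p \<in> relation_ideal X Rel \<Longrightarrow> - p \<in> relation_ideal X Rel"
  using I.I_l_closed[of p "- 1"] by (simp add: free_algebra_def keys_uminus zero_list_def)

lemma eqv_sym: "p \<doteq> q \<Longrightarrow> q \<doteq> p"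
  using I_uminus[of "p - q"] by (simp add: eqv_def)

lemma eqv_trans [trans]: "p \<doteq> q \<Longrightarrow> q \<doteq> r \<Longrightarrow> p \<doteq> r"
  using I_add[of "p - q" "q - r"] by (simp add: eqv_def)

lemma eqv_add: "p \<doteq> p' \<Longrightarrow> q \<doteq> q' \<Longrightarrow> p + q \<doteq> p' + q'"
proof -
  assume a: "p \<doteq> p'" "q \<doteq> q'"
  then have "(p - p') + (q - q') \<in> relation_ideal X Rel"
    by (intro I_add) (simp_all add: eqv_def)
  also have "(p - p') + (q - q') = p + q - (p' + q')" by simp
  finally show ?thesis
    using a keys_add[of p q] keys_add[of p' q'] unfolding eqv_def by blast
qed

lemma eqv_mult:
  assumes "p \<doteq> p'" "q \<doteq> q'" shows "p * q \<doteq> p' * q'"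
proof -
  have "(p - p') * q \<in> relation_ideal X Rel"
    using I.I_r_closed[of "p - p'" q] assms by (auto simp: eqv_def free_algebra_def)
  moreover have "p' * (q - q') \<in> relation_ideal X Rel"
    using I.I_l_closed[of "q - q'" p'] assms by (auto simp: eqv_def free_algebra_def)
  ultimately have "(p - p') * q + p' * (q - q') \<in> relation_ideal X Rel"
    by (rule I_add)
  also have "(p - p') * q + p' * (q - q') = p * q - p' * q'"
    by (simp add: algebra_simps)
  finally show ?thesis
    using assms by (simp add: eqv_def keys_mult_lists)
qed

lemma eqv_sum:
  assumes "\<And>a. a \<in> S \<Longrightarrow> p a \<doteq> q a"
  shows "(\<Sum>a\<in>S. p a) \<doteq> (\<Sum>a\<in>S. q a)"
  using assms by (induction S rule: infinite_finite_induct) (auto intro!: eqv_add eqv_refl)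

lemma coset_eq_iff:
  assumes "Poly_Mapping.keys p \<subseteq> lists X" "Poly_Mapping.keys q \<subseteq> lists X"
  shows "relation_ideal X Rel +>\<^bsub>free_algebra X\<^esub> p = relation_ideal X Rel +>\<^bsub>free_algebra X\<^esub> q \<longleftrightarrow> p \<doteq> q"
  using assms A.quotient_eq_iff_same_a_r_cos[OF I.is_ideal, of p q]
  by (simp add: carrier_iff eqv_def a_minus_eq)

definition cls :: "'x free_poly \<Rightarrow> 'x free_poly set" where
  "cls p = relation_ideal X Rel +>\<^bsub>free_algebra X\<^esub> p"

lemma cls_eq_iff:
  "Poly_Mapping.keys p \<subseteq> lists X \<Longrightarrow> Poly_Mapping.keys q \<subseteq> lists X \<Longrightarrow> cls p = cls q \<longleftrightarrow> p \<doteq> q"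
  unfolding cls_def by (rule coset_eq_iff)

lemma mem_cls_iff: "Poly_Mapping.keys p \<subseteq> lists X \<Longrightarrow> q \<in> cls p \<longleftrightarrow> p \<doteq> q"
proof
  assume p: "Poly_Mapping.keys p \<subseteq> lists X" and "q \<in> cls p"
  then obtain a where a: "a \<in> relation_ideal X Rel" "q = a + p"
    unfolding cls_def a_r_coset_def r_coset_def by (auto simp: free_algebra_def)
  have "Poly_Mapping.keys a \<subseteq> lists X" using I.Icarr[OF a(1)] carrier_iff by blast
  then have "Poly_Mapping.keys q \<subseteq> lists X" using keys_add[of a p] a(2) p by blast
  then have "q \<doteq> p" using a p by (simp add: eqv_def)
  then show "p \<doteq> q" by (rule eqv_sym)
next
  assume "p \<doteq> q"
  then have "q - p \<in> relation_ideal X Rel" using eqv_sym eqv_def by blast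
  then show "q \<in> cls p"
    unfolding cls_def a_r_coset_def r_coset_def
    by (force simp: free_algebra_def intro: exI[of _ "q - p"])
qed

abbreviation "Alg \<equiv> presented_algebra X Rel"

lemma presented_simps:
  "carrier Alg = {cls p | p. Poly_Mapping.keys p \<subseteq> lists X}"
  "\<one>\<^bsub>Alg\<^esub> = cls 1"
  "Poly_Mapping.keys p \<subseteq> lists X \<Longrightarrow> Poly_Mapping.keys q \<subseteq> lists X \<Longrightarrow> cls p \<otimes>\<^bsub>Alg\<^esub> cls q = cls (p * q)"
  "Poly_Mapping.keys p \<subseteq> lists X \<Longrightarrow> Poly_Mapping.keys q \<subseteq> lists X \<Longrightarrow> cls p \<oplus>\<^bsub>Alg\<^esub> cls q = cls (p + q)"
  "Poly_Mapping.keys p \<subseteq> lists X \<Longrightarrow> c \<odot>\<^bsub>Alg\<^esub> cls p = cls (const c * p)"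
proof -
  note defs = presented_algebra_def quotient_algebra_def ring.extend_def module.fields_def
    FactRing_def monoid.defs ring.defs module.defs
  show "carrier Alg = {cls p | p. Poly_Mapping.keys p \<subseteq> lists X}"
    by (auto simp: defs A_RCOSETS_def' cls_def carrier_iff)
  show "\<one>\<^bsub>Alg\<^esub> = cls 1"
    by (simp add: defs cls_def free_algebra_def)
  assume p: "Poly_Mapping.keys p \<subseteq> lists X"
  show "c \<odot>\<^bsub>Alg\<^esub> cls p = cls (const c * p)"
  proof -
    \<comment> \<open>Scalar multiplication in the quotient is a union over all representatives
      \<open>q\<close>, so each of them has to give the same coset.\<close>
    have "cls (const c * q) = cls (const c * p)" if "q \<in> cls p" for q
    proof -
      have "p \<doteq> q" using that p mem_cls_iff by simp
      then have "const c * p \<doteq> const c * q" by (intro eqv_mult eqv_refl) auto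
      then show ?thesis using cls_eq_iff eqv_carrier by blast
    qed
    moreover have "p \<in> cls p" using p mem_cls_iff eqv_refl by simp
    ultimately have "(\<Union>q\<in>cls p. cls (const c * q)) = cls (const c * p)" by blast
    then show ?thesis by (simp add: defs cls_def[symmetric]) (simp add: free_algebra_def)
  qed
  assume q: "Poly_Mapping.keys q \<subseteq> lists X"
  show "cls p \<otimes>\<^bsub>Alg\<^esub> cls q = cls (p * q)"
    using I.rcoset_mult_add[of p q] p q by (simp add: defs cls_def carrier_iff) (simp add: free_algebra_def)
  show "cls p \<oplus>\<^bsub>Alg\<^esub> cls q = cls (p + q)"
    using I.a_rcos_sum[of p q] p q by (simp add: defs cls_def carrier_iff) (simp add: free_algebra_def)
qed

lemma presented_gen_eq: "presented_gen X Rel x = cls (mon [x])"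
  by (simp add: presented_gen_def cls_def)

end

section \<open>Homomorphisms of presented algebras given on generators\<close>

definition subst :: "('x \<Rightarrow> 'y list) \<Rightarrow> 'x list \<Rightarrow> 'y list" where
  "subst f w = concat (map f w)"

lemma subst_simps [simp]:
  "subst f [] = []" "subst f (x # w) = f x @ subst f w" "subst f (u @ v) = subst f u @ subst f v"
  by (simp_all add: subst_def)

text \<open>Words are products of generators and \<open>eqv\<close> is a congruence, so generators
  decide. Applied to a composite of two substitutions, this reduces invertibility to
  generators.\<close>

lemma (in presentation) push_subst_eqv:
  assumes h: "\<And>x. x \<in> X \<Longrightarrow> mon (h x) \<doteq> mon [x]" and p: "Poly_Mapping.keys p \<subseteq> lists X"
  shows "push (subst h) p \<doteq> p"
proof -
  have word: "mon (subst h w) \<doteq> mon w" if "w \<in> lists X" for w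
    using that
  proof (induction w)
    case (Cons x w)
    then have "mon (h x) * mon (subst h w) \<doteq> mon [x] * mon w"
      by (intro eqv_mult h) auto
    then show ?case by (simp add: mon_mult)
  qed (simp add: eqv_refl)
  have "push (subst h) p = (\<Sum>w\<in>Poly_Mapping.keys p. const (Poly_Mapping.lookup p w) * mon (subst h w))"
    by (simp add: push_def const_mult_single)
  also have "\<dots> \<doteq> (\<Sum>w\<in>Poly_Mapping.keys p. const (Poly_Mapping.lookup p w) * mon w)"
    using p by (intro eqv_sum eqv_mult word eqv_refl) auto
  also have "\<dots> = push (\<lambda>w. w) p"
    by (simp add: push_def const_mult_single)
  also have "push (\<lambda>w. w) p = p"
    by (induction p rule: free_poly_induct) (auto simp: push_add)
  finally show ?thesis .
qed

locale presentation_map = A: presentation X RX + B: presentation Y RY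
  for X :: "'x set" and RX and Y :: "'y set" and RY +
  fixes f :: "'x \<Rightarrow> 'y list"
  assumes gen: "x \<in> X \<Longrightarrow> f x \<in> lists Y"
    and rel: "(p, q) \<in> RX \<Longrightarrow> B.eqv (push (subst f) p) (push (subst f) q)"
begin

lemma subst_lists: "w \<in> lists X \<Longrightarrow> subst f w \<in> lists Y"
  using gen by (induction w) auto

lemma push_keys: "Poly_Mapping.keys p \<subseteq> lists X \<Longrightarrow> Poly_Mapping.keys (push (subst f) p) \<subseteq> lists Y"
  using keys_push[of "subst f" p] subst_lists by blast

text \<open>The preimage \<open>K\<close> of the target ideal is a two-sided ideal, and
  \<open>rel\<close> puts the relators into it, so it contains the ideal they generate.\<close>

lemma push_ideal:
  assumes "p \<in> relation_ideal X RX"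
  shows "push (subst f) p \<in> relation_ideal Y RY"
proof -
  define K where "K = {p. Poly_Mapping.keys p \<subseteq> lists X \<and> push (subst f) p \<in> relation_ideal Y RY}"
  have "ideal K (free_algebra X)"
  proof (rule idealI)
    show "subgroup K (add_monoid (free_algebra X))"
    proof (rule group.subgroupI)
      show "Group.group (add_monoid (free_algebra X))"
        using A.A.add.group_axioms .
      show "K \<noteq> {}" using B.I.zero_closed by (auto simp: K_def free_algebra_def intro!: exI[of _ 0])
    next
      fix p assume "p \<in> K"
      then show "inv\<^bsub>add_monoid (free_algebra X)\<^esub> p \<in> K"
        using A.a_inv_eq[of p] B.I_uminus by (simp add: K_def a_inv_def push_uminus keys_uminus)
    next
      fix p q assume "p \<in> K" "q \<in> K"
      then show "p \<otimes>\<^bsub>add_monoid (free_algebra X)\<^esub> q \<in> K"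
        using B.I_add order_trans[OF keys_add[of p q]] by (simp add: K_def push_add free_algebra_def)
    qed (auto simp: K_def free_algebra_def)
  next
    fix p q assume "p \<in> K" "q \<in> carrier (free_algebra X)"
    moreover from this have "push (subst f) q \<in> carrier (free_algebra Y)"
      using push_keys by (simp add: A.carrier_iff B.carrier_iff)
    ultimately show "q \<otimes>\<^bsub>free_algebra X\<^esub> p \<in> K" "p \<otimes>\<^bsub>free_algebra X\<^esub> q \<in> K"
      using B.I.I_l_closed[of "push (subst f) p" "push (subst f) q"]
        B.I.I_r_closed[of "push (subst f) p" "push (subst f) q"] keys_mult_lists[of p X q] keys_mult_lists[of q X p]
      by (simp_all add: K_def free_algebra_def push_mult)
  qed (rule ring_free_algebra)
  moreover have "{p - q | p q. (p, q) \<in> RX} \<subseteq> K"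
  proof clarify
    fix p q assume "(p, q) \<in> RX"
    moreover from this have "p - q \<in> carrier (free_algebra X)"
      using A.relators_carrier by blast
    ultimately show "p - q \<in> K"
      using rel by (simp add: K_def push_diff B.eqv_def A.carrier_iff)
  qed
  ultimately have "relation_ideal X RX \<subseteq> K"
    unfolding relation_ideal_def by (rule A.A.genideal_minimal)
  then show ?thesis using assms by (auto simp: K_def)
qed

lemma push_eqv: "A.eqv p q \<Longrightarrow> B.eqv (push (subst f) p) (push (subst f) q)"
  using push_ideal push_keys by (auto simp: A.eqv_def B.eqv_def push_diff[symmetric])

text \<open>The union ranges over all representatives to avoid choosing one; by
  \<open>push_eqv\<close> its members coincide, so it is a single coset.\<close>

definition induced :: "'x free_poly set \<Rightarrow> 'y free_poly set" where
  "induced C = (\<Union>p\<in>C. B.cls (push (subst f) p))"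

lemma induced_cls:
  assumes "Poly_Mapping.keys p \<subseteq> lists X" shows "induced (A.cls p) = B.cls (push (subst f) p)"
proof -
  have "B.cls (push (subst f) q) = B.cls (push (subst f) p)" if "q \<in> A.cls p" for q
    using that assms push_eqv[of p q] A.mem_cls_iff B.cls_eq_iff B.eqv_carrier by blast
  moreover have "p \<in> A.cls p" using assms A.mem_cls_iff A.eqv_refl by simp
  ultimately show ?thesis unfolding induced_def by blast
qed

end

lemma subst_subst: "subst g (subst f w) = subst (subst g \<circ> f) w"
  by (induction w) auto

lemma (in presentation) induced_inverse:
  assumes "presentation_map X Rel Y RY f" "presentation_map Y RY X Rel g"
    and gf: "\<And>x. x \<in> X \<Longrightarrow> mon (subst g (f x)) \<doteq> mon [x]"
    and C: "C \<in> carrier (presented_algebra X Rel)"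
  shows "presentation_map.induced X Rel g (presentation_map.induced Y RY f C) = C"
proof -
  interpret F: presentation_map X Rel Y RY f by fact
  interpret G: presentation_map Y RY X Rel g by fact
  obtain p where p: "C = cls p" "Poly_Mapping.keys p \<subseteq> lists X"
    using C by (auto simp: presented_simps)
  have "push (subst g) (push (subst f) p) = push (subst (subst g \<circ> f)) p"
    by (simp add: push_push comp_def subst_subst)
  also have "\<dots> \<doteq> p"
    using gf p(2) by (intro push_subst_eqv) auto
  finally show ?thesis
    using p F.push_keys[OF p(2)] G.push_keys F.induced_cls G.induced_cls cls_eq_iff by simp
qed

theorem presentation_iso:
  assumes "presentation_map X RX Y RY f" "presentation_map Y RY X RX g"
    and gf: "\<And>x. x \<in> X \<Longrightarrow> presentation.eqv X RX (mon (subst g (f x))) (mon [x])"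
    and fg: "\<And>y. y \<in> Y \<Longrightarrow> presentation.eqv Y RY (mon (subst f (g y))) (mon [y])"
  shows "\<exists>h\<in>algebra_iso (presented_algebra X RX) (presented_algebra Y RY).
    \<forall>x\<in>X. h (presented_gen X RX x) = presentation.cls Y RY (mon (f x))"
proof (intro bexI ballI)
  interpret F: presentation_map X RX Y RY f by fact
  interpret G: presentation_map Y RY X RX g by fact
  have inv: "G.induced (F.induced C) = C" if "C \<in> carrier (presented_algebra X RX)" for C
    using F.A.induced_inverse[OF assms(1,2) gf that] .
  have inv': "F.induced (G.induced C) = C" if "C \<in> carrier (presented_algebra Y RY)" for C
    using F.B.induced_inverse[OF assms(2,1) fg that] .
  have closed: "F.induced C \<in> carrier (presented_algebra Y RY)"
    if "C \<in> carrier (presented_algebra X RX)" for C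
    using that F.push_keys F.induced_cls unfolding F.A.presented_simps F.B.presented_simps by blast
  have closed': "G.induced C \<in> carrier (presented_algebra X RX)"
    if "C \<in> carrier (presented_algebra Y RY)" for C
    using that G.push_keys G.induced_cls unfolding F.A.presented_simps F.B.presented_simps by blast
  note simps = F.A.presented_simps F.B.presented_simps F.induced_cls F.push_keys
  have "F.induced \<in> ring_hom (presented_algebra X RX) (presented_algebra Y RY)"
  proof (rule ring_hom_memI)
    fix C D assume "C \<in> carrier (presented_algebra X RX)" "D \<in> carrier (presented_algebra X RX)"
    then obtain p q where pq: "C = F.A.cls p" "Poly_Mapping.keys p \<subseteq> lists X"
        "D = F.A.cls q" "Poly_Mapping.keys q \<subseteq> lists X"
      by (auto simp: F.A.presented_simps)
    show "F.induced (C \<otimes>\<^bsub>presented_algebra X RX\<^esub> D)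
        = F.induced C \<otimes>\<^bsub>presented_algebra Y RY\<^esub> F.induced D"
      using pq keys_mult_lists[of p X q] by (simp add: simps push_mult)
    show "F.induced (C \<oplus>\<^bsub>presented_algebra X RX\<^esub> D)
        = F.induced C \<oplus>\<^bsub>presented_algebra Y RY\<^esub> F.induced D"
      using pq order_trans[OF keys_add[of p q]] by (simp add: simps push_add)
  next
    have "push (subst f) 1 = 1" by (simp flip: mon_Nil)
    moreover have "Poly_Mapping.keys (1 :: 'a free_poly) \<subseteq> lists X" by (simp flip: mon_Nil)
    ultimately show "F.induced \<one>\<^bsub>presented_algebra X RX\<^esub> = \<one>\<^bsub>presented_algebra Y RY\<^esub>"
      by (simp add: simps)
  qed (rule closed)
  moreover have "bij_betw F.induced (carrier (presented_algebra X RX)) (carrier (presented_algebra Y RY))"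
    using inv inv' closed closed' by (intro bij_betw_byWitness[where f' = G.induced]) auto
  moreover have "F.induced (c \<odot>\<^bsub>presented_algebra X RX\<^esub> C) = c \<odot>\<^bsub>presented_algebra Y RY\<^esub> F.induced C"
    if "C \<in> carrier (presented_algebra X RX)" for c C
  proof -
    obtain p where p: "C = F.A.cls p" "Poly_Mapping.keys p \<subseteq> lists X"
      using \<open>C \<in> _\<close> by (auto simp: F.A.presented_simps)
    then show ?thesis
      using keys_mult_lists[of "const c" X p] by (simp add: simps push_mult)
  qed
  ultimately show "F.induced \<in> algebra_iso (presented_algebra X RX) (presented_algebra Y RY)"
    by (simp add: algebra_iso_def ring_iso_def)
  show "F.induced (presented_gen X RX x) = F.B.cls (mon (f x))" if "x \<in> X" for x
    using that by (simp add: F.A.presented_gen_eq F.induced_cls)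
qed

section \<open>Coxeter groups and their roots\<close>

lemma length_alt [simp]: "length (alt k x y) = k"
  by (induction k x y rule: alt.induct) auto

lemma alt_append: "alt (a + b) x y = alt a x y @ (if even a then alt b x y else alt b y x)"
  by (induction a arbitrary: x y) auto

lemma alt_snoc: "alt (Suc k) x y = alt k x y @ [if even k then x else y]"
  using alt_append[of k 1 x y] by simp

lemma rev_alt: "rev (alt k x y) = (if even k then alt k y x else alt k x y)"
proof (induction k arbitrary: x y)
  case (Suc k)
  have "rev (alt (Suc k) x y) = (if even k then x else y) # rev (alt k x y)"
    by (simp only: alt_snoc rev_append) simp
  then show ?case by (simp add: Suc)
qed simp

lemma map_alt: "map f (alt k x y) = alt k (f x) (f y)"
  by (induction k arbitrary: x y) auto

lemma alt_lists: "x \<in> A \<Longrightarrow> y \<in> A \<Longrightarrow> alt k x y \<in> lists A"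
  by (induction k arbitrary: x y) auto

locale coxeter =
  fixes m :: "'i::finite \<Rightarrow> 'i \<Rightarrow> nat"
  assumes coxeter_matrix: "coxeter_matrix m"
begin

lemma m_diag: "m i i = 1" and m_sym: "m i j = m j i" and m_ge2: "i \<noteq> j \<Longrightarrow> m i j \<ge> 2"
  using coxeter_matrix by (auto simp: coxeter_matrix_def)

abbreviation word_eq :: "'i list \<Rightarrow> 'i list \<Rightarrow> bool" (infix "\<sim>" 50) where
  "u \<sim> v \<equiv> cox_eq m u v"

declare cox_eq.trans [trans]

lemma word_eq_append_left: "v \<sim> v' \<Longrightarrow> u @ v \<sim> u @ v'"
  and word_eq_append_right: "u \<sim> u' \<Longrightarrow> u @ v \<sim> u' @ v"
  by (auto intro: cox_eq.append cox_eq.refl)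

lemma word_eq_cancel: "w @ rev w \<sim> []"
proof (induction w)
  case (Cons i w)
  have "[i] @ (w @ rev w) @ [i] \<sim> [i] @ [] @ [i]"
    by (intro word_eq_append_left word_eq_append_right Cons)
  then show ?case using cox_eq.square cox_eq.trans by fastforce
qed (simp add: cox_eq.refl)

lemma word_eq_cancel': "rev w @ w \<sim> []"
  using word_eq_cancel[of "rev w"] by simp

lemma word_eq_snoc_snoc: "w @ [i, i] \<sim> w"
  using word_eq_append_left[OF cox_eq.square] by simp

text \<open>This is the sign character: \<open>square\<close> changes the length by two and both
  sides of \<open>braid\<close> are equally long. It excludes \<open>len (w @ [i]) = len w\<close>,
  so every letter is an ascent or a descent.\<close>

lemma word_eq_parity: "u \<sim> v \<Longrightarrow> even (length u) = even (length v)"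
  by (induction rule: cox_eq.induct) auto

subsection \<open>Roots\<close>

definition gram :: "real ^ 'i ^ 'i" where
  "gram = (\<chi> i j. - cos (pi / real (m i j)))"

text \<open>The real counterpart of \<open>cox_form\<close>: positivity of roots needs ordered
  coordinates. The complex space is reached again through \<open>cplx\<close>.\<close>

definition form :: "real ^ 'i \<Rightarrow> real ^ 'i \<Rightarrow> real" where
  "form x y = x \<bullet> (gram *v y)"

abbreviation \<alpha> :: "'i \<Rightarrow> real ^ 'i" where "\<alpha> i \<equiv> axis i 1"

lemma form_sym: "form x y = form y x"
proof -
  have "transpose gram = gram"
    by (simp add: gram_def transpose_def vec_eq_iff m_sym)
  then show ?thesis
    unfolding form_def by (metis dot_lmul_matrix inner_commute transpose_matrix_vector)
qed

lemma form_linear [simp]: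
  "form x (y + z) = form x y + form x z" "form (x + y) z = form x z + form y z"
  "form x (y - z) = form x y - form x z" "form (x - y) z = form x z - form y z"
  "form x (c *\<^sub>R y) = c * form x y" "form (c *\<^sub>R x) y = c * form x y"
  "form x (- y) = - form x y" "form (- x) y = - form x y"
  "form x 0 = 0" "form 0 y = 0"
proof -
  show "form x (y + z) = form x y + form x z" "form (x + y) z = form x z + form y z"
    "form x (y - z) = form x y - form x z" "form (x - y) z = form x z - form y z"
    "form x (c *\<^sub>R y) = c * form x y" "form (c *\<^sub>R x) y = c * form x y"
    "form x 0 = 0" "form 0 y = 0" for x y z c
    by (simp_all add: form_def inner_simps matrix_vector_right_distrib matrix_vector_mult_diff_distrib
        matrix_vector_mult_scaleR)
  from this(5)[of x "-1" y] this(6)[of "-1" x y]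
  show "form x (- y) = - form x y" "form (- x) y = - form x y" by simp_all
qed

lemma form_\<alpha>_\<alpha>: "form (\<alpha> i) (\<alpha> j) = - cos (pi / real (m i j))"
  by (simp add: form_def matrix_vector_mult_basis column_def inner_axis' gram_def)

lemma form_\<alpha>_self [simp]: "form (\<alpha> i) (\<alpha> i) = 1"
  by (simp add: form_\<alpha>_\<alpha> m_diag)

definition refl_in :: "real ^ 'i \<Rightarrow> real ^ 'i \<Rightarrow> real ^ 'i" where
  "refl_in \<beta> v = v - (2 * form \<beta> v) *\<^sub>R \<beta>"

definition act :: "'i list \<Rightarrow> real ^ 'i \<Rightarrow> real ^ 'i" where
  "act w v = foldr (\<lambda>i. refl_in (\<alpha> i)) w v"

lemma act_simps [simp]:
  "act [] v = v" "act (i # w) v = refl_in (\<alpha> i) (act w v)" "act (u @ w) v = act u (act w v)"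
  by (simp_all add: act_def)

lemma linear_refl_in: "linear (refl_in \<beta>)"
  by (rule linearI) (simp_all add: refl_in_def algebra_simps)

lemma linear_act: "linear (act w)"
proof (induction w)
  case Nil
  show ?case by (rule linearI) simp_all
next
  case (Cons i w)
  have "act (i # w) = refl_in (\<alpha> i) \<circ> act w" by (simp add: fun_eq_iff)
  then show ?case using linear_compose[OF Cons linear_refl_in] by metis
qed

lemmas act_linear [simp] = linear_add[OF linear_act] linear_diff[OF linear_act]
  linear_scale[OF linear_act] linear_neg[OF linear_act] linear_0[OF linear_act]

lemma refl_in_self: "form \<beta> \<beta> = 1 \<Longrightarrow> refl_in \<beta> \<beta> = - \<beta>"
  by (simp add: refl_in_def scaleR_2)

lemma refl_in_involution: "form \<beta> \<beta> = 1 \<Longrightarrow> refl_in \<beta> (refl_in \<beta> v) = v"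
  by (simp add: refl_in_def algebra_simps)

lemma form_refl_in: "form \<beta> \<beta> = 1 \<Longrightarrow> form (refl_in \<beta> u) (refl_in \<beta> v) = form u v"
  by (simp add: refl_in_def algebra_simps form_sym)

lemma form_act [simp]: "form (act w u) (act w v) = form u v"
  by (induction w) (simp_all add: form_refl_in)

lemma angle_bounds:
  assumes "x \<noteq> y" shows "0 < pi / real (m x y)" "pi / real (m x y) \<le> pi / 2" "sin (pi / real (m x y)) > 0"
proof -
  have m: "real (m x y) \<ge> 2" using m_ge2[OF assms] by simp
  show pos: "0 < pi / real (m x y)" using m by (simp add: zero_less_divide_iff)
  show le: "pi / real (m x y) \<le> pi / 2" using m by (intro divide_left_mono) auto
  show "sin (pi / real (m x y)) > 0" using pos le pi_gt_zero by (intro sin_gt_zero) linarith+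
qed

text \<open>Prefixing a letter changes the coefficients by \<open>sin ((p + 2) \<theta>) = 2 cos
  \<theta> sin ((p + 1) \<theta>) - sin (p \<theta>)\<close>, because
  \<open>form (\<alpha> x) (\<alpha> y) = - cos \<theta>\<close>. The root acted on belongs to the
  letter that would continue the word.\<close>

lemma act_alt:
  assumes "x \<noteq> y"
  defines "\<theta> \<equiv> pi / real (m x y)"
  shows "act (alt p x y) (\<alpha> (if even p then x else y))
    = (sin (real (p + 1) * \<theta>) / sin \<theta>) *\<^sub>R \<alpha> x + (sin (real p * \<theta>) / sin \<theta>) *\<^sub>R \<alpha> y"
  using assms(1) unfolding \<theta>_def
proof (induction p arbitrary: x y)
  case 0
  then show ?case using angle_bounds(3)[OF 0] by simp
next
  case (Suc p)
  define \<theta> where "\<theta> = pi / real (m x y)"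
  have \<theta>: "pi / real (m y x) = \<theta>" by (simp add: \<theta>_def m_sym)
  have s: "sin \<theta> > 0" using angle_bounds(3)[OF Suc.prems] by (simp add: \<theta>_def)
  have rec: "sin (real (Suc p + 1) * \<theta>) = 2 * cos \<theta> * sin (real (p + 1) * \<theta>) - sin (real p * \<theta>)"
    using sin_add[of "real (p + 1) * \<theta>" \<theta>] sin_diff[of "real (p + 1) * \<theta>" \<theta>]
    by (simp add: algebra_simps)
  have "act (alt (Suc p) x y) (\<alpha> (if even (Suc p) then x else y))
      = refl_in (\<alpha> x) (act (alt p y x) (\<alpha> (if even p then y else x)))"
    by simp
  also have "\<dots> = refl_in (\<alpha> x) ((sin (real (p + 1) * \<theta>) / sin \<theta>) *\<^sub>R \<alpha> y + (sin (real p * \<theta>) / sin \<theta>) *\<^sub>R \<alpha> x)"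
    using Suc.IH[of y x] Suc.prems \<theta> by simp
  also have "\<dots> = ((2 * cos \<theta> * sin (real (p + 1) * \<theta>) - sin (real p * \<theta>)) / sin \<theta>) *\<^sub>R \<alpha> x
      + (sin (real (p + 1) * \<theta>) / sin \<theta>) *\<^sub>R \<alpha> y"
  proof -
    have "form (\<alpha> x) (\<alpha> y) = - cos \<theta>" by (simp add: form_\<alpha>_\<alpha> \<theta>_def)
    then have "refl_in (\<alpha> x) (a *\<^sub>R \<alpha> y + b *\<^sub>R \<alpha> x) = (2 * cos \<theta> * a - b) *\<^sub>R \<alpha> x + a *\<^sub>R \<alpha> y" for a b
      by (simp add: refl_in_def vec_eq_iff algebra_simps)
    then show ?thesis by (simp add: diff_divide_distrib)
  qed
  finally show ?case unfolding rec[symmetric] unfolding \<theta>_def Suc_eq_plus1 .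
qed

lemma act_alt_full:
  assumes "x \<noteq> y"
  shows "act (alt (m x y) x y) (\<alpha> (if even (m x y) then x else y)) = - \<alpha> x"
proof -
  have "m x y \<noteq> 0" using m_ge2[OF assms] by simp
  then have *: "real (m x y) * (pi / real (m x y)) = pi"
    "real (m x y + 1) * (pi / real (m x y)) = pi / real (m x y) + pi"
    by (simp_all add: field_simps)
  show ?thesis
    using angle_bounds(3)[OF assms] unfolding act_alt[OF assms] * by simp
qed

text \<open>At \<open>p = m x y - 1\<close> the coefficients are \<open>sin pi = 0\<close> and
  \<open>sin (pi - \<theta>) / sin \<theta> = 1\<close>. These words are the building blocks of all
  elements that carry one simple root to another.\<close>

lemma act_alt_almost_full:
  assumes "x \<noteq> y"
  shows "act (alt (m x y - 1) x y) (\<alpha> (if even (m x y - 1) then x else y)) = \<alpha> y"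
proof -
  have m: "m x y \<ge> 2" using m_ge2[OF assms] by simp
  then have *: "real (m x y - 1 + 1) * (pi / real (m x y)) = pi"
    "real (m x y - 1) * (pi / real (m x y)) = pi - pi / real (m x y)"
    by (simp_all add: field_simps of_nat_diff)
  show ?thesis
    using angle_bounds(3)[OF assms] unfolding act_alt[OF assms] * by simp
qed

lemma act_braid_root:
  assumes "x \<noteq> y"
  shows "act (alt (m x y) x y) (\<alpha> (if even (m x y) then x else y))
       = act (alt (m x y) y x) (\<alpha> (if even (m x y) then x else y))"
proof -
  obtain p where p: "m x y = Suc p" using m_ge2[OF assms] by (cases "m x y") auto
  \<comment> \<open>The word \<open>alt (Suc p) y x\<close> ends in the letter of the root, which
    negates it; what remains has length \<open>m x y - 1\<close>.\<close>
  have "act (alt (Suc p) y x) (\<alpha> (if even (Suc p) then x else y))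
      = act (alt p y x) (- \<alpha> (if even p then y else x))"
    unfolding alt_snoc by (simp add: refl_in_self)
  also have "\<dots> = - \<alpha> x"
    using act_alt_almost_full[of y x] assms m_sym[of y x] unfolding p by simp
  finally show ?thesis using act_alt_full[OF assms] p by simp
qed

lemma act_fixes_orthogonal:
  assumes "w \<in> lists {x, y}" "form (\<alpha> x) v = 0" "form (\<alpha> y) v = 0"
  shows "act w v = v"
  using assms by (induction w) (auto simp: refl_in_def)

lemma act_braid:
  assumes "x \<noteq> y" shows "act (alt (m x y) x y) = act (alt (m x y) y x)"
proof
  fix v
  define \<theta> where "\<theta> = pi / real (m x y)"
  \<comment> \<open>These solve \<open>form (\<alpha> x) (v - u) = 0\<close> and
    \<open>form (\<alpha> y) (v - u) = 0\<close>; the Gram matrix of the two roots has determinant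
    \<open>(sin \<theta>)^2\<close>. Thus \<open>u\<close> is the projection of \<open>v\<close> to
    their plane, and both words fix \<open>v - u\<close>.\<close>
  define a b where "a = (form (\<alpha> x) v + cos \<theta> * form (\<alpha> y) v) / (sin \<theta>)\<^sup>2"
    and "b = (form (\<alpha> y) v + cos \<theta> * form (\<alpha> x) v) / (sin \<theta>)\<^sup>2"
  define u where "u = a *\<^sub>R \<alpha> x + b *\<^sub>R \<alpha> y"
  have s: "sin \<theta> > 0" using angle_bounds(3)[OF assms] by (simp add: \<theta>_def)
  have f: "form (\<alpha> x) (\<alpha> y) = - cos \<theta>" "form (\<alpha> y) (\<alpha> x) = - cos \<theta>"
    by (simp_all add: form_\<alpha>_\<alpha> \<theta>_def m_sym)
  have c: "1 - (cos \<theta>)\<^sup>2 = (sin \<theta>)\<^sup>2" by (simp add: sin_squared_eq)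
  have "a - b * cos \<theta> = form (\<alpha> x) v * (1 - (cos \<theta>)\<^sup>2) / (sin \<theta>)\<^sup>2"
    unfolding a_def b_def times_divide_eq_left diff_divide_distrib[symmetric]
    by (simp add: algebra_simps power2_eq_square)
  then have "form (\<alpha> x) (v - u) = 0" using s by (simp add: u_def f c)
  moreover have "b - a * cos \<theta> = form (\<alpha> y) v * (1 - (cos \<theta>)\<^sup>2) / (sin \<theta>)\<^sup>2"
    unfolding a_def b_def times_divide_eq_left diff_divide_distrib[symmetric]
    by (simp add: algebra_simps power2_eq_square)
  then have "form (\<alpha> y) (v - u) = 0" using s by (simp add: u_def f c)
  ultimately have "act w (v - u) = v - u" if "w \<in> lists {x, y}" for w
    using that act_fixes_orthogonal by blast
  then have split: "act w v = act w u + (v - u)" if "w \<in> lists {x, y}" for w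
    using that act_linear(2)[of w v u] by (simp add: algebra_simps)
  have "act (alt (m x y) x y) (\<alpha> z) = act (alt (m x y) y x) (\<alpha> z)" if "z \<in> {x, y}" for z
    using act_braid_root[OF assms] act_braid_root[of y x] assms that m_sym[of x y]
    by (auto split: if_splits)
  then have "act (alt (m x y) x y) u = act (alt (m x y) y x) u"
    by (simp add: u_def)
  then show "act (alt (m x y) x y) v = act (alt (m x y) y x) v"
    by (simp add: split alt_lists)
qed

lemma act_word_eq: "u \<sim> v \<Longrightarrow> act u = act v"
proof (induction rule: cox_eq.induct)
  case (append u u' v v')
  then show ?case by (simp add: fun_eq_iff)
next
  case (braid i j)
  then show ?case by (rule act_braid)
qed (auto simp: refl_in_involution fun_eq_iff)

lemma act_rev [simp]: "act w (act (rev w) v) = v" "act (rev w) (act w v) = v"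
  using act_word_eq[OF word_eq_cancel, of w] act_word_eq[OF word_eq_cancel', of w]
  by (metis act_simps(1,3))+

subsection \<open>Lengths and descents\<close>

definition len :: "'i list \<Rightarrow> nat" where
  "len w = (LEAST n. \<exists>u. w \<sim> u \<and> length u = n)"

lemma len_le: "w \<sim> u \<Longrightarrow> len w \<le> length u"
  unfolding len_def by (rule Least_le) blast

lemma reduced_word: obtains u where "w \<sim> u" "length u = len w"
  unfolding len_def
  using LeastI[of "\<lambda>n. \<exists>u. w \<sim> u \<and> length u = n" "length w"] cox_eq.refl[of m w] by blast

lemma len_cong: assumes "u \<sim> v" shows "len u = len v"
proof (rule antisym)
  obtain u' v' where "u \<sim> u'" "length u' = len u" "v \<sim> v'" "length v' = len v"
    using reduced_word by metis
  then show "len u \<le> len v" "len v \<le> len u"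
    using assms len_le cox_eq.trans cox_eq.sym by metis+
qed

lemma len_append_le: "len (u @ v) \<le> len u + length v"
proof -
  obtain u' where u': "u \<sim> u'" "length u' = len u" using reduced_word by blast
  then have "len (u @ v) \<le> length (u' @ v)" using len_le word_eq_append_right by blast
  then show ?thesis using u' by simp
qed

lemma len_parity: "even (len w) = even (length w)"
  using reduced_word[of w] word_eq_parity by metis

lemma len_snoc_neq: "len (w @ [i]) \<noteq> len w"
  using len_parity[of w] len_parity[of "w @ [i]"] by auto

lemma len_snoc_less: "len (w @ [i]) < len w \<longleftrightarrow> \<not> len w < len (w @ [i])"
  using len_snoc_neq[of w i] by linarith

lemma len_0: "len w = 0 \<Longrightarrow> w \<sim> []"
  using reduced_word[of w] by (metis length_0_conv)

text \<open>Among all reduced decompositions \<open>w = v (\<dots>ik)\<close>, with a fixed last letter \<open>k\<close> and an alternating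
  right factor, one with the longest right factor is chosen; the other conditions then follow.\<close>

lemma descent:
  assumes less: "len w < len (w @ [i])" and nz: "len w > 0"
  obtains v p x y where "x \<noteq> y" "0 < p" "p < m x y" "i = (if even p then x else y)"
    "w \<sim> v @ alt p x y" "len w = len v + p" "len v < len (v @ [x])" "len v < len (v @ [y])"
proof -
  obtain u where u: "w \<sim> u" "length u = len w" using reduced_word by blast
  with nz obtain u' k where uk: "u = u' @ [k]" by (metis length_greater_0_conv rev_exhaust)
  have len_u': "len u' + 1 = len w"
  proof -
    have "len w \<le> len u' + 1" using len_append_le[of u' "[k]"] u uk len_cong by simp
    moreover have "len u' \<le> length u'" using len_le cox_eq.refl by blast
    ultimately show ?thesis using u uk by simp
  qed
  have "k \<noteq> i"
  proof
    assume "k = i"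
    then have "w @ [i] \<sim> u' @ [i, i]" using word_eq_append_right[OF u(1), of "[i]"] uk by simp
    then have "w @ [i] \<sim> u'" using word_eq_snoc_snoc cox_eq.trans by blast
    then show False using less len_u' len_cong by fastforce
  qed
  \<comment> \<open>The letters are arranged from the right: \<open>alt p (x p) (y p)\<close> ends
    in \<open>k\<close> for every \<open>p > 0\<close> and would be continued by
    \<open>i\<close>.\<close>
  define x where "x p = (if even p then i else k)" for p :: nat
  define y where "y p = (if even p then k else i)" for p :: nat
  define P where "P p \<longleftrightarrow> (\<exists>v. w \<sim> v @ alt p (x p) (y p) \<and> len w = len v + p)" for p
  have "P 1" using u uk len_u' by (auto simp: P_def x_def y_def)
  moreover have bound: "p \<le> len w" if "P p" for p using that by (auto simp: P_def)
  ultimately obtain p where p: "P p" "\<And>q. P q \<Longrightarrow> q \<le> p"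
    using ex_has_greatest_nat[of P 1 "\<lambda>p. p" "len w + 1"] by fastforce
  have p1: "p \<ge> 1" using p(2) \<open>P 1\<close> .
  from p(1) obtain v where v: "w \<sim> v @ alt p (x p) (y p)" "len w = len v + p"
    by (auto simp: P_def)
  have xy: "x p \<noteq> y p" "x (Suc p) = y p" "y (Suc p) = x p" using \<open>k \<noteq> i\<close> by (auto simp: x_def y_def)
  have i: "i = (if even p then x p else y p)" by (auto simp: x_def y_def)
  show thesis
  proof (rule that[OF xy(1) _ _ i v])
    show "0 < p" using p1 by simp
    \<comment> \<open>Otherwise a braid move on the last \<open>m (x p) (y p)\<close> letters makes
      the word end in \<open>i\<close>, and \<open>w @ [i]\<close> becomes shorter than
      \<open>w\<close>.\<close>
    show "p < m (x p) (y p)"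
    proof (rule ccontr)
      define n where "n = m (x p) (y p)"
      assume "\<not> p < m (x p) (y p)"
      then have le: "n \<le> p" by (simp add: n_def)
      have n: "n \<ge> 2" using m_ge2[OF xy(1)] by (simp add: n_def)
      define a b where "a = (if even (p - n) then x p else y p)" and "b = (if even (p - n) then y p else x p)"
      have ab: "a \<noteq> b" "m a b = n" "m b a = n" using xy(1) m_sym by (auto simp: a_def b_def n_def)
      have "alt p (x p) (y p) = alt (p - n) (x p) (y p) @ alt n a b"
        using alt_append[of "p - n" n "x p" "y p"] le by (simp add: a_def b_def)
      moreover have "alt n a b \<sim> alt n b a" using cox_eq.braid[OF ab(1), of m] ab by simp
      ultimately have "w \<sim> v @ alt (p - n) (x p) (y p) @ alt n b a"
        using v(1) word_eq_append_left cox_eq.trans by metis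
      moreover have "alt n b a = alt (n - 1) b a @ [i]"
        using alt_snoc[of "n - 1" b a] n i le by (auto simp: a_def b_def)
      ultimately have "w @ [i] \<sim> (v @ alt (p - n) (x p) (y p) @ alt (n - 1) b a) @ [i, i]"
        using word_eq_append_right[of w _ "[i]"] by fastforce
      then have "w @ [i] \<sim> v @ (alt (p - n) (x p) (y p) @ alt (n - 1) b a)"
        using word_eq_snoc_snoc cox_eq.trans by fastforce
      then have "len (w @ [i]) \<le> len v + (p - n + (n - 1))"
        using len_append_le[of v "alt (p - n) (x p) (y p) @ alt (n - 1) b a"] len_cong by simp
      then show False using less v(2) n le by linarith
    qed
    show "len v < len (v @ [x p])"
    proof (rule ccontr)
      assume "\<not> len v < len (v @ [x p])"
      then have l: "len (v @ [x p]) < len v" using len_snoc_less by blast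
      obtain q where q: "p = Suc q" using p1 by (cases p) auto
      have "v @ alt p (x p) (y p) \<sim> (v @ [x p, x p]) @ alt p (x p) (y p)"
        by (intro word_eq_append_right cox_eq.sym[OF word_eq_snoc_snoc])
      also have "(v @ [x p, x p]) @ alt p (x p) (y p) = (v @ [x p]) @ [x p, x p] @ alt q (y p) (x p)"
        by (simp add: q)
      also have "(v @ [x p]) @ [x p, x p] @ alt q (y p) (x p) \<sim> (v @ [x p]) @ [] @ alt q (y p) (x p)"
        by (intro word_eq_append_right word_eq_append_left cox_eq.square)
      finally have "len w \<le> len (v @ [x p]) + q"
        using len_append_le[of "v @ [x p]" "alt q (y p) (x p)"] v(1) len_cong by simp
      then show False using l v(2) q by simp
    qed
    \<comment> \<open>A descent of \<open>v\<close> at \<open>y p\<close> would lengthen the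
      alternating factor, against the choice of \<open>p\<close>; the descent at \<open>x p\<close>
      treated before would cancel its first letter.\<close>
    show "len v < len (v @ [y p])"
    proof (rule ccontr)
      assume "\<not> len v < len (v @ [y p])"
      then have l: "len (v @ [y p]) < len v" using len_snoc_less by blast
      have "v @ alt p (x p) (y p) \<sim> (v @ [y p, y p]) @ alt p (x p) (y p)"
        by (intro word_eq_append_right cox_eq.sym[OF word_eq_snoc_snoc])
      then have w: "w \<sim> (v @ [y p]) @ alt (Suc p) (x (Suc p)) (y (Suc p))"
        using v(1) cox_eq.trans xy by fastforce
      then have "len w \<le> len (v @ [y p]) + Suc p"
        using len_append_le[of "v @ [y p]" "alt (Suc p) (x (Suc p)) (y (Suc p))"] len_cong by simp
      then have "len w = len (v @ [y p]) + Suc p" using l v(2) by simp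
      then have "P (Suc p)" using w unfolding P_def by blast
      then show False using p(2) by fastforce
    qed
  qed
qed

subsection \<open>Positive and negative roots\<close>

definition nonneg :: "real ^ 'i \<Rightarrow> bool" where "nonneg v \<longleftrightarrow> (\<forall>k. 0 \<le> v $ k)"

definition roots :: "(real ^ 'i) set" where "roots = {act w (\<alpha> i) | w i. True}"

lemma act_roots: "\<beta> \<in> roots \<Longrightarrow> act w \<beta> \<in> roots"
proof -
  assume "\<beta> \<in> roots"
  then obtain u i where "\<beta> = act u (\<alpha> i)" by (auto simp: roots_def)
  then have "act w \<beta> = act (w @ u) (\<alpha> i)" by simp
  then show ?thesis unfolding roots_def by blast
qed

lemma simple_roots [simp]: "\<alpha> i \<in> roots"
  unfolding roots_def by (auto intro!: exI[of _ "[]"])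

lemma form_root [simp]: "\<beta> \<in> roots \<Longrightarrow> form \<beta> \<beta> = 1"
  by (auto simp: roots_def)

lemma uminus_roots: "\<beta> \<in> roots \<Longrightarrow> - \<beta> \<in> roots"
proof -
  assume "\<beta> \<in> roots"
  then obtain w i where "\<beta> = act w (\<alpha> i)" by (auto simp: roots_def)
  then have "- \<beta> = act (w @ [i]) (\<alpha> i)" by (simp add: refl_in_self)
  then show ?thesis unfolding roots_def by blast
qed

lemma nonneg_combine: "nonneg u \<Longrightarrow> nonneg v \<Longrightarrow> a \<ge> 0 \<Longrightarrow> b \<ge> 0 \<Longrightarrow> nonneg (a *\<^sub>R u + b *\<^sub>R v)"
  by (simp add: nonneg_def)

lemma sine_coeff_nonneg:
  assumes "x \<noteq> y" "p \<le> m x y"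
  shows "sin (real p * (pi / real (m x y))) / sin (pi / real (m x y)) \<ge> 0"
proof -
  have "real p * (pi / real (m x y)) \<le> real (m x y) * (pi / real (m x y))"
    using assms angle_bounds(1)[OF assms(1)] by (intro mult_right_mono) auto
  also have "\<dots> = pi" using m_ge2[OF assms(1)] by simp
  finally have "sin (real p * (pi / real (m x y))) \<ge> 0"
    using angle_bounds(1)[OF assms(1)] by (intro sin_ge_zero) auto
  then show ?thesis using angle_bounds(3)[OF assms(1)] by simp
qed

lemma sine_coeff_pos:
  assumes "x \<noteq> y" "0 < p" "p < m x y"
  shows "sin (real p * (pi / real (m x y))) / sin (pi / real (m x y)) > 0"
proof -
  have "real p * (pi / real (m x y)) < real (m x y) * (pi / real (m x y))"
    using assms angle_bounds(1)[OF assms(1)] by (intro mult_strict_right_mono) auto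
  also have "\<dots> = pi" using m_ge2[OF assms(1)] by simp
  finally have "sin (real p * (pi / real (m x y))) > 0"
    using angle_bounds(1)[OF assms(1)] assms(2) by (intro sin_gt_zero mult_pos_pos) auto
  then show ?thesis using angle_bounds(3)[OF assms(1)] by simp
qed

text \<open>\<open>descent\<close> splits off a dihedral factor and leaves a shorter
  \<open>v\<close> with ascents at \<open>x\<close> and \<open>y\<close>. By \<open>act_alt\<close>
  the root is a combination of \<open>act v (\<alpha> x)\<close> and
  \<open>act v (\<alpha> y)\<close>, with nonnegative coefficients because
  \<open>p + 1 \<le> m x y\<close>.\<close>

lemma ascent_nonneg: "len w < len (w @ [i]) \<Longrightarrow> nonneg (act w (\<alpha> i))"
proof (induction "len w" arbitrary: w i rule: less_induct)
  case less
  show ?case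
  proof (cases "len w = 0")
    case True
    then have "act w = act []" using act_word_eq len_0 by blast
    then show ?thesis by (simp add: nonneg_def axis_def)
  next
    case False
    then have nz: "len w > 0" by simp
    obtain v p x y where d: "x \<noteq> y" "0 < p" "p < m x y" "i = (if even p then x else y)"
      "w \<sim> v @ alt p x y" "len w = len v + p" "len v < len (v @ [x])" "len v < len (v @ [y])"
      by (rule descent[OF less.prems nz])
    have "act w (\<alpha> i) = act v (act (alt p x y) (\<alpha> (if even p then x else y)))"
      using act_word_eq[OF d(5)] d(4) by simp
    also have "\<dots> = (sin (real (p + 1) * (pi / real (m x y))) / sin (pi / real (m x y))) *\<^sub>R act v (\<alpha> x)
        + (sin (real p * (pi / real (m x y))) / sin (pi / real (m x y))) *\<^sub>R act v (\<alpha> y)"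
      unfolding act_alt[OF d(1)] by simp
    also have "nonneg \<dots>"
      using d less.hyps[of v] by (intro nonneg_combine sine_coeff_nonneg) auto
    finally show ?thesis .
  qed
qed

lemma descent_nonpos: "len (w @ [i]) < len w \<Longrightarrow> nonneg (- act w (\<alpha> i))"
proof -
  assume "len (w @ [i]) < len w"
  moreover have "len ((w @ [i]) @ [i]) = len w" using len_cong[OF word_eq_snoc_snoc] by simp
  ultimately have "nonneg (act (w @ [i]) (\<alpha> i))" by (intro ascent_nonneg) simp
  then show ?thesis by (simp add: refl_in_self)
qed

lemma root_nonneg_cases: "\<beta> \<in> roots \<Longrightarrow> nonneg \<beta> \<or> nonneg (- \<beta>)"
  unfolding roots_def using ascent_nonneg descent_nonpos len_snoc_less by blast

lemma not_nonneg_both: "\<beta> \<in> roots \<Longrightarrow> nonneg \<beta> \<Longrightarrow> \<not> nonneg (- \<beta>)"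
proof
  assume "\<beta> \<in> roots" "nonneg \<beta>" "nonneg (- \<beta>)"
  then have "\<beta> = 0" by (simp add: nonneg_def vec_eq_iff) (meson dual_order.antisym)
  then show False using form_root[OF \<open>\<beta> \<in> roots\<close>] by simp
qed

lemma ascent_iff: "len w < len (w @ [i]) \<longleftrightarrow> nonneg (act w (\<alpha> i))"
proof -
  have "act w (\<alpha> i) \<in> roots" by (simp add: act_roots)
  then show ?thesis using ascent_nonneg descent_nonpos len_snoc_less not_nonneg_both by blast
qed

lemma nonneg_simple [simp]: "nonneg (\<alpha> i)"
  by (simp add: nonneg_def axis_def)

text \<open>The last letter \<open>k\<close> of a nonempty reduced word is a descent, so
  \<open>w\<close> makes \<open>\<alpha> k\<close> negative, which the identity does not.\<close>

lemma act_eq_id: assumes "act w = act []" shows "w \<sim> []"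
proof (rule ccontr)
  assume "\<not> w \<sim> []"
  then have nz: "len w \<noteq> 0" using len_0 by blast
  obtain u where u: "w \<sim> u" "length u = len w" using reduced_word by blast
  with nz obtain u' k where uk: "u = u' @ [k]" by (metis list.size(3) rev_exhaust)
  have "w @ [k] \<sim> u' @ [k, k]" using word_eq_append_right[OF u(1), of "[k]"] uk by simp
  then have "w @ [k] \<sim> u'" using word_eq_snoc_snoc cox_eq.trans by blast
  then have "len (w @ [k]) < len w" using u uk len_le by fastforce
  then have "nonneg (- \<alpha> k)" using descent_nonpos assms by force
  then show False using not_nonneg_both by simp
qed

lemma faithful: assumes "act u = act v" shows "u \<sim> v"
proof -
  have "act (u @ rev v) = act []" using assms by (simp add: fun_eq_iff)
  then have "u @ rev v \<sim> []" by (rule act_eq_id)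
  then have "(u @ rev v) @ v \<sim> [] @ v" by (rule word_eq_append_right)
  moreover have "u @ rev v @ v \<sim> u @ []" by (intro word_eq_append_left word_eq_cancel')
  ultimately show ?thesis using cox_eq.trans cox_eq.sym by fastforce
qed

text \<open>By \<open>descent\<close> and \<open>act_alt\<close>, \<open>w \<alpha>\<^sub>i\<close> is a nonnegative combination of the two nonnegative roots
  \<open>v \<alpha>\<^sub>x\<close> and \<open>v \<alpha>\<^sub>y\<close>. If it is simple, one coefficient vanishes, which forces \<open>p = m\<^sub>x\<^sub>y - 1\<close>.\<close>

lemma simple_to_simple_induct [consumes 1, case_names nil comp cong rank2]:
  assumes "act w (\<alpha> i) = \<alpha> j"
    and nil: "\<And>i. Q [] i i"
    and comp: "\<And>u v i j k. Q u i j \<Longrightarrow> Q v j k \<Longrightarrow> Q (v @ u) i k"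
    and cong: "\<And>u v i j. u \<sim> v \<Longrightarrow> Q u i j \<Longrightarrow> Q v i j"
    and rank2: "\<And>x y. x \<noteq> y \<Longrightarrow> Q (alt (m x y - 1) x y) (if even (m x y - 1) then x else y) y"
  shows "Q w i j"
  using assms(1)
proof (induction "len w" arbitrary: w i j rule: less_induct)
  case less
  have asc: "len w < len (w @ [i])" unfolding ascent_iff using less.prems by simp
  show ?case
  proof (cases "len w = 0")
    case True
    then have "w \<sim> []" by (rule len_0)
    then have "act w = act []" by (rule act_word_eq)
    then have "i = j" using less.prems by (simp add: axis_eq_axis)
    then show ?thesis using nil cong cox_eq.sym[OF \<open>w \<sim> []\<close>] by blast
  next
    case False
    then have nz: "len w > 0" by simp
    obtain v p x y where d: "x \<noteq> y" "0 < p" "p < m x y" "i = (if even p then x else y)"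
      "w \<sim> v @ alt p x y" "len w = len v + p" "len v < len (v @ [x])" "len v < len (v @ [y])"
      by (rule descent[OF asc nz])
    define a b where "a = sin (real (p + 1) * (pi / real (m x y))) / sin (pi / real (m x y))"
      and "b = sin (real p * (pi / real (m x y))) / sin (pi / real (m x y))"
    define \<beta> \<gamma> where "\<beta> = act v (\<alpha> x)" and "\<gamma> = act v (\<alpha> y)"
    have pos: "nonneg \<beta>" "nonneg \<gamma>" using ascent_nonneg d by (simp_all add: \<beta>_def \<gamma>_def)
    have wi: "act w (\<alpha> i) = act v (act (alt p x y) (\<alpha> (if even p then x else y)))"
      using act_word_eq[OF d(5)] d(4) by simp
    also have "\<dots> = a *\<^sub>R \<beta> + b *\<^sub>R \<gamma>"
      unfolding act_alt[OF d(1)] a_def b_def \<beta>_def \<gamma>_def by simp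
    finally have j: "\<alpha> j = a *\<^sub>R \<beta> + b *\<^sub>R \<gamma>" using less.prems by simp
    have b: "b > 0" unfolding b_def using d by (intro sine_coeff_pos)
    have "p = m x y - 1"
    proof (rule ccontr)
      assume "p \<noteq> m x y - 1"
      then have a: "a > 0" unfolding a_def using d by (intro sine_coeff_pos) auto
      \<comment> \<open>Nonnegative vectors with a strictly positive combination equal to
        \<open>\<alpha> j\<close> are both supported on \<open>j\<close>, hence proportional; but
        \<open>\<beta>\<close> and \<open>\<gamma>\<close> are images of independent vectors under
        an invertible map.\<close>
      have zero: "\<beta> $ k = 0 \<and> \<gamma> $ k = 0" if "k \<noteq> j" for k
      proof -
        have "a * \<beta> $ k + b * \<gamma> $ k = 0" using arg_cong[OF j, of "\<lambda>v. v $ k"] that by (simp add: axis_def)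
        moreover have "a * \<beta> $ k \<ge> 0" "b * \<gamma> $ k \<ge> 0" using a b pos by (simp_all add: nonneg_def)
        ultimately have "a * \<beta> $ k = 0" "b * \<gamma> $ k = 0" by linarith+
        then show ?thesis using a b by simp
      qed
      then have "(\<gamma> $ j) *\<^sub>R \<beta> - (\<beta> $ j) *\<^sub>R \<gamma> = 0"
        by (subst vec_eq_iff) (simp, metis mult.commute mult_zero_right)
      then have "act v ((\<gamma> $ j) *\<^sub>R \<alpha> x - (\<beta> $ j) *\<^sub>R \<alpha> y) = 0" by (simp add: \<beta>_def \<gamma>_def)
      then have "(\<gamma> $ j) *\<^sub>R \<alpha> x - (\<beta> $ j) *\<^sub>R \<alpha> y = 0" by (metis act_rev(2) act_linear(5))
      from arg_cong[OF this, of "\<lambda>v. v $ y"] have "\<beta> $ j = 0" using d(1) by (simp add: axis_def)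
      with zero have "\<beta> = 0" by (metis vec_eq_iff zero_index)
      moreover have "form \<beta> \<beta> = 1" by (simp add: \<beta>_def)
      ultimately show False by simp
    qed
    then have "act v (\<alpha> y) = \<alpha> j" using wi less.prems act_alt_almost_full[OF d(1)] by simp
    then have "Q v y j" using less.hyps d by simp
    moreover have "Q (alt p x y) i y" using rank2[OF d(1)] d(4) \<open>p = _\<close> by simp
    ultimately show ?thesis using comp cong d(5) cox_eq.sym by blast
  qed
qed

subsection \<open>The group and its reflections\<close>

abbreviation G where "G \<equiv> coxeter_group m"
abbreviation gmult (infixl "\<cdot>" 70) where "g \<cdot> h \<equiv> g \<otimes>\<^bsub>G\<^esub> h"
abbreviation cls where "cls \<equiv> cox_class m"
abbreviation R where "R \<equiv> reflections m"

lemma cls_eq_iff: "cls u = cls v \<longleftrightarrow> u \<sim> v"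
  unfolding cox_class_def using cox_eq.refl cox_eq.sym cox_eq.trans by (metis (mono_tags, lifting) Collect_cong mem_Collect_eq)

lemma mem_cls_iff: "v \<in> cls u \<longleftrightarrow> u \<sim> v"
  by (simp add: cox_class_def)

lemma carrier_G: "carrier G = range cls" and one_G: "\<one>\<^bsub>G\<^esub> = cls []"
  by (simp_all add: coxeter_group_def)

lemma cls_carrier [simp]: "cls w \<in> carrier G"
  by (simp add: carrier_G)

lemma carrierE: assumes "g \<in> carrier G" obtains w where "g = cls w"
  using assms carrier_G by auto

lemma cls_mult [simp]: "cls u \<cdot> cls v = cls (u @ v)"
proof -
  have "cls (u' @ v') = cls (u @ v)" if "u' \<in> cls u" "v' \<in> cls v" for u' v'
    using that cox_eq.append cox_eq.sym unfolding mem_cls_iff cls_eq_iff by metis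
  moreover have "u \<in> cls u" "v \<in> cls v" by (simp_all add: mem_cls_iff cox_eq.refl)
  ultimately have "(\<Union>u'\<in>cls u. \<Union>v'\<in>cls v. cls (u' @ v')) = cls (u @ v)" by blast
  then show ?thesis by (simp add: coxeter_group_def)
qed

sublocale group G
proof (rule groupI)
  fix g assume "g \<in> carrier G"
  then obtain w where "g = cls w" by (rule carrierE)
  then show "\<exists>h\<in>carrier G. h \<cdot> g = \<one>\<^bsub>G\<^esub>"
    by (intro bexI[of _ "cls (rev w)"]) (simp_all add: one_G cls_eq_iff word_eq_cancel')
qed (auto simp: one_G elim!: carrierE)

lemma inv_cls [simp]: "inv\<^bsub>G\<^esub> (cls w) = cls (rev w)"
  by (rule inv_equality) (simp_all add: one_G cls_eq_iff word_eq_cancel')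

definition gact :: "'i list set \<Rightarrow> real ^ 'i \<Rightarrow> real ^ 'i" where
  "gact g = act (SOME w. w \<in> g)"

lemma some_cls: "cls (SOME w. w \<in> cls u) = cls u"
  using someI[of "\<lambda>w. w \<in> cls u" u] cox_eq.refl[of m u]
  by (auto simp: mem_cls_iff cls_eq_iff intro: cox_eq.sym)

lemma gact_cls [simp]: "gact (cls w) = act w"
  unfolding gact_def using some_cls[of w] act_word_eq by (simp add: cls_eq_iff)

lemma gact_mult [simp]: "g \<in> carrier G \<Longrightarrow> h \<in> carrier G \<Longrightarrow> gact (g \<cdot> h) v = gact g (gact h v)"
  by (auto elim!: carrierE)

lemma gact_faithful: "g \<in> carrier G \<Longrightarrow> h \<in> carrier G \<Longrightarrow> gact g = gact h \<Longrightarrow> g = h"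
  by (elim carrierE) (simp add: cls_eq_iff faithful)

lemma conj_by_cls [simp]: "conj_by G (cls w) (cls u) = cls (w @ u @ rev w)"
  by (simp add: conj_by_def)

lemma reflections_eq: "R = {cls (w @ [i] @ rev w) | w i. True}"
proof (intro equalityI subsetI)
  fix r assume "r \<in> R"
  then obtain g i where "r = conj_by G g (cls [i])" "g \<in> carrier G"
    by (auto simp: reflections_def)
  moreover from this obtain w where "g = cls w" by (auto elim: carrierE)
  ultimately have "r = cls (w @ [i] @ rev w)" by simp
  then show "r \<in> {cls (w @ [i] @ rev w) | w i. True}" by blast
next
  fix r assume "r \<in> {cls (w @ [i] @ rev w) | w i. True}"
  then obtain w i where "r = conj_by G (cls w) (cls [i])" by auto
  then show "r \<in> R" unfolding reflections_def using cls_carrier by blast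
qed

lemma act_reflection: "act (w @ [i] @ rev w) = refl_in (act w (\<alpha> i))"
proof
  fix v
  have "form (\<alpha> i) (act (rev w) v) = form (act w (\<alpha> i)) v"
    using form_act[of w "\<alpha> i" "act (rev w) v"] by simp
  then show "act (w @ [i] @ rev w) v = refl_in (act w (\<alpha> i)) v"
    by (simp add: refl_in_def)
qed

lemma refl_in_eq_iff:
  assumes "form \<beta> \<beta> = 1" "form \<gamma> \<gamma> = 1"
  shows "refl_in \<beta> = refl_in \<gamma> \<longleftrightarrow> \<beta> = \<gamma> \<or> \<beta> = - \<gamma>"
proof
  assume "refl_in \<beta> = refl_in \<gamma>"
  then have "- \<beta> = refl_in \<gamma> \<beta>" using assms refl_in_self by metis
  then have *: "\<beta> = form \<gamma> \<beta> *\<^sub>R \<gamma>" by (simp add: refl_in_def vec_eq_iff algebra_simps)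
  then have "1 = (form \<gamma> \<beta>)\<^sup>2" using assms form_linear(5,6) by (metis mult.right_neutral power2_eq_square)
  then have "form \<gamma> \<beta> = 1 \<or> form \<gamma> \<beta> = -1" by (metis power2_eq_1_iff)
  then show "\<beta> = \<gamma> \<or> \<beta> = - \<gamma>" using * by auto
next
  assume "\<beta> = \<gamma> \<or> \<beta> = - \<gamma>"
  then show "refl_in \<beta> = refl_in \<gamma>" by (auto simp: refl_in_def fun_eq_iff)
qed

lemma reflections_carrier: "r \<in> R \<Longrightarrow> r \<in> carrier G"
  by (auto simp: reflections_eq)

lemma simple_reflections [simp]: "cls [i] \<in> R"
  unfolding reflections_eq by (auto intro!: exI[of _ "[]"])

text \<open>A reflection determines its root only up to sign, so statements about this choice carry
  a sign alternative or are phrased with spans.\<close>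

definition root_of :: "'i list set \<Rightarrow> real ^ 'i" where
  "root_of r = (SOME \<beta>. \<beta> \<in> roots \<and> gact r = refl_in \<beta>)"

lemma root_of: assumes "r \<in> R" shows "root_of r \<in> roots" "gact r = refl_in (root_of r)"
proof -
  obtain w i where "r = cls (w @ [i] @ rev w)" using assms by (auto simp: reflections_eq)
  then have "act w (\<alpha> i) \<in> roots \<and> gact r = refl_in (act w (\<alpha> i))"
    using act_reflection act_roots simple_roots by (metis gact_cls)
  then show "root_of r \<in> roots" "gact r = refl_in (root_of r)"
    unfolding root_of_def by (metis (mono_tags, lifting) someI_ex)+
qed

lemma root_of_unique:
  assumes "r \<in> R" "\<beta> \<in> roots" "gact r = refl_in \<beta>" shows "root_of r = \<beta> \<or> root_of r = - \<beta>"
  using refl_in_eq_iff root_of[OF assms(1)] assms(2,3) by auto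

lemma root_of_simple: "root_of (cls [i]) = \<alpha> i \<or> root_of (cls [i]) = - \<alpha> i"
  by (rule root_of_unique) (auto simp: fun_eq_iff)

lemma root_of_inj: "r \<in> R \<Longrightarrow> s \<in> R \<Longrightarrow> root_of r = root_of s \<or> root_of r = - root_of s \<Longrightarrow> r = s"
  using root_of refl_in_eq_iff gact_faithful reflections_carrier form_root by metis

lemma conj_by_reflections: assumes "g \<in> carrier G" "r \<in> R" shows "conj_by G g r \<in> R"
proof -
  obtain u w i where "g = cls u" "r = cls (w @ [i] @ rev w)"
    using assms by (auto simp: reflections_eq elim!: carrierE)
  then have "conj_by G g r = cls ((u @ w) @ [i] @ rev (u @ w))" by simp
  then show ?thesis unfolding reflections_eq by blast
qed

lemma root_of_conj_by:
  assumes "g \<in> carrier G" "r \<in> R"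
  shows "root_of (conj_by G g r) = gact g (root_of r) \<or> root_of (conj_by G g r) = - gact g (root_of r)"
proof (rule root_of_unique[OF conj_by_reflections[OF assms]])
  obtain u where u: "g = cls u" using assms by (auto elim!: carrierE)
  obtain w where w: "r = cls w" using assms by (auto simp: reflections_eq)
  show "gact g (root_of r) \<in> roots" using root_of[OF assms(2)] act_roots u by simp
  show "gact (conj_by G g r) = refl_in (gact g (root_of r))"
  proof
    fix v
    have "form (root_of r) (act (rev u) v) = form (act u (root_of r)) v"
      using form_act[of u "root_of r" "act (rev u) v"] by simp
    then have "act u (refl_in (root_of r) (act (rev u) v)) = refl_in (act u (root_of r)) v"
      by (simp add: refl_in_def)
    moreover have "act w = refl_in (root_of r)" using root_of(2)[OF assms(2)] w by simp
    ultimately show "gact (conj_by G g r) v = refl_in (gact g (root_of r)) v"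
      by (simp add: u w)
  qed
qed

lemma reflection_square: "r \<in> R \<Longrightarrow> r \<cdot> r = \<one>\<^bsub>G\<^esub>"
  using root_of[of r] by (intro gact_faithful)
    (auto simp: reflections_carrier fun_eq_iff refl_in_involution one_G)

lemma reflection_inv: "r \<in> R \<Longrightarrow> inv\<^bsub>G\<^esub> r = r"
  using reflection_square reflections_carrier inv_equality by blast

end

section \<open>Linear algebra: planes and generic orthogonal vectors\<close>

lemma mem_span_pair: "x \<in> span {u, v} \<longleftrightarrow> (\<exists>a b. x = a *\<^sub>R u + b *\<^sub>R (v :: 'a::real_vector))"
proof
  assume "x \<in> span {u, v}"
  then obtain a where "x - a *\<^sub>R u \<in> span {v}" using span_breakdown_eq[of x u "{v}"] by auto
  then obtain b where "x - a *\<^sub>R u = b *\<^sub>R v" by (auto simp: span_singleton)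
  then show "\<exists>a b. x = a *\<^sub>R u + b *\<^sub>R v" by (metis add.commute diff_add_cancel)
next
  assume "\<exists>a b. x = a *\<^sub>R u + b *\<^sub>R v"
  then obtain a b where "x = a *\<^sub>R u + b *\<^sub>R v" by blast
  moreover have "u \<in> span {u, v}" "v \<in> span {u, v}" by (simp_all add: span_base)
  ultimately show "x \<in> span {u, v}" by (simp add: span_add span_scale)
qed

text \<open>Vectors are added one at a time. As \<open>f\<close> lies outside \<open>U\<close>,
  which is its own double complement, some \<open>w\<close> orthogonal to \<open>U\<close> detects
  \<open>f\<close>, and \<open>v + c w\<close> works for all but finitely many
  \<open>c\<close>.\<close>

lemma exists_generic_orthogonal:
  fixes F :: "'a::euclidean_space set"
  assumes "finite F" "subspace U" "F \<inter> U = {}"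
  shows "\<exists>v. (\<forall>u\<in>U. v \<bullet> u = 0) \<and> (\<forall>f\<in>F. v \<bullet> f \<noteq> 0)"
  using assms(1,3)
proof (induction F)
  case empty
  then show ?case by (intro exI[of _ 0]) simp
next
  case (insert f F)
  then obtain v where v: "\<forall>u\<in>U. v \<bullet> u = 0" "\<forall>g\<in>F. v \<bullet> g \<noteq> 0" by auto
  have "f \<notin> U\<^sup>\<bottom>\<^sup>\<bottom>" using orthogonal_comp_self[OF assms(2)] insert.prems by simp
  then obtain w where w: "\<forall>u\<in>U. w \<bullet> u = 0" "w \<bullet> f \<noteq> 0"
    by (auto simp: orthogonal_comp_def orthogonal_def inner_commute)
  obtain c where c: "c \<notin> (\<lambda>g. - (v \<bullet> g) / (w \<bullet> g)) ` insert f F"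
    using ex_new_if_finite[of "(\<lambda>g. - (v \<bullet> g) / (w \<bullet> g)) ` insert f F"] insert.hyps infinite_UNIV_char_0
    by blast
  have "v \<bullet> g + c * (w \<bullet> g) \<noteq> 0" if "g \<in> insert f F" for g
  proof (cases "w \<bullet> g = 0")
    case True
    then show ?thesis using that v w by auto
  next
    case False
    show ?thesis
    proof
      assume "v \<bullet> g + c * (w \<bullet> g) = 0"
      then have "c = - (v \<bullet> g) / (w \<bullet> g)" using False by (simp add: field_simps)
      then show False using c that by blast
    qed
  qed
  then show ?case using v w by (intro exI[of _ "v + c *\<^sub>R w"]) (auto simp: inner_simps)
qed

context coxeter begin

subsection \<open>Hyperplanes\<close>

text \<open>The action has real coefficients and so treats real and imaginary parts separately;
  complex hyperplane questions become pairs of real ones.\<close>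

definition cplx :: "real ^ 'i \<Rightarrow> real ^ 'i \<Rightarrow> complex ^ 'i" where
  "cplx x y = (\<chi> k. Complex (x $ k) (y $ k))"

lemma cplx_cases: obtains x y where "v = cplx x y"
proof
  show "v = cplx (\<chi> k. Re (v $ k)) (\<chi> k. Im (v $ k))" by (simp add: cplx_def vec_eq_iff)
qed

lemma cplx_eq_iff [simp]: "cplx x y = cplx x' y' \<longleftrightarrow> x = x' \<and> y = y'"
  by (auto simp: cplx_def vec_eq_iff)

lemma form_\<alpha>: "form (\<alpha> i) x = (\<Sum>j\<in>UNIV. - cos (pi / real (m i j)) * x $ j)"
  unfolding form_def by (simp add: inner_axis' matrix_vector_mult_def gram_def)

lemma cox_form_cplx: "cox_form m (axis i 1) (cplx x y) = Complex (form (\<alpha> i) x) (form (\<alpha> i) y)"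
proof -
  have "cox_form m (axis i 1) (cplx x y)
      = (\<Sum>k\<in>UNIV. if k = i then \<Sum>j\<in>UNIV. complex_of_real (- cos (pi / real (m k j))) * cplx x y $ j else 0)"
    unfolding cox_form_def by (intro sum.cong) (auto simp: axis_def)
  also have "\<dots> = (\<Sum>j\<in>UNIV. complex_of_real (- cos (pi / real (m i j))) * cplx x y $ j)"
    by simp
  also have "\<dots> = Complex (form (\<alpha> i) x) (form (\<alpha> i) y)"
    by (simp add: complex_eq_iff form_\<alpha> cplx_def)
  finally show ?thesis .
qed

lemma simple_reflection_cplx:
  "simple_reflection m i (cplx x y) = cplx (refl_in (\<alpha> i) x) (refl_in (\<alpha> i) y)"
  unfolding simple_reflection_def cox_form_cplx
  by (auto simp: vec_eq_iff cplx_def refl_in_def axis_def complex_eq_iff)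

lemma geometric_rep_cplx: "geometric_rep m g (cplx x y) = cplx (gact g x) (gact g y)"
proof -
  have "foldr (simple_reflection m) w (cplx x y) = cplx (act w x) (act w y)" for w
    by (induction w) (simp_all add: simple_reflection_cplx)
  then show ?thesis by (simp add: geometric_rep_def gact_def)
qed

lemma hyperplane_cplx: "cplx x y \<in> hyperplane m g \<longleftrightarrow> gact g x = x \<and> gact g y = y"
  by (simp add: hyperplane_def geometric_rep_cplx)

lemma gact_fixed_iff: "r \<in> R \<Longrightarrow> gact r x = x \<longleftrightarrow> form (root_of r) x = 0"
proof -
  assume r: "r \<in> R"
  then have "root_of r \<noteq> 0" using form_root[OF root_of(1)] by fastforce
  then show ?thesis using root_of(2)[OF r] by (simp add: refl_in_def)
qed

end

locale finite_coxeter = coxeter +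
  assumes finite_G: "finite (carrier (coxeter_group m))"
begin

lemma finite_roots: "finite roots"
proof (rule finite_subset)
  show "roots \<subseteq> (\<lambda>(g, i). gact g (\<alpha> i)) ` (carrier G \<times> UNIV)"
  proof
    fix \<beta> assume "\<beta> \<in> roots"
    then obtain w i where "\<beta> = gact (cls w) (\<alpha> i)" by (auto simp: roots_def)
    then show "\<beta> \<in> (\<lambda>(g, i). gact g (\<alpha> i)) ` (carrier G \<times> UNIV)"
      by (intro image_eqI[of _ _ "(cls w, i)"]) simp_all
  qed
  show "finite ((\<lambda>(g, i). gact g (\<alpha> i)) ` (carrier G \<times> UNIV))" using finite_G by auto
qed

lemma linear_gact: "linear (gact g)"
  unfolding gact_def by (rule linear_act)

lemma expand_simple: "(\<Sum>l\<in>UNIV. v $ l *\<^sub>R \<alpha> l) = v"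
  using basis_expansion[of v] by (simp add: scalar_mult_eq_scaleR)

lemma mem_span_simple: "v \<in> span (range \<alpha>)"
proof -
  have "(\<Sum>l\<in>UNIV. v $ l *\<^sub>R \<alpha> l) \<in> span (range \<alpha>)"
    by (intro span_sum span_scale span_base) simp
  then show ?thesis by (simp only: expand_simple)
qed

text \<open>Right multiplication by \<open>s_i\<close> permutes the group and negates
  \<open>\<alpha> i\<close>, so the sum at a simple root equals its own negative.\<close>

lemma sum_gact: "(\<Sum>g\<in>carrier G. gact g v) = 0"
proof -
  have simple: "(\<Sum>g\<in>carrier G. gact g (\<alpha> i)) = 0" for i
  proof -
    have "(\<Sum>g\<in>carrier G. gact g (\<alpha> i)) = (\<Sum>g\<in>carrier G. - gact g (\<alpha> i))"
    proof (rule sum.reindex_bij_witness[of _ "\<lambda>g. g \<cdot> cls [i]" "\<lambda>g. g \<cdot> cls [i]"])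
      fix g assume g: "g \<in> carrier G"
      then show "g \<cdot> cls [i] \<cdot> cls [i] = g"
        using reflection_square[of "cls [i]"] by (simp add: m_assoc)
      then show "g \<cdot> cls [i] \<cdot> cls [i] = g" .
      show "- gact (g \<cdot> cls [i]) (\<alpha> i) = gact g (\<alpha> i)"
        using g by (simp add: refl_in_self linear_neg[OF linear_gact])
    qed auto
    then have "2 *\<^sub>R (\<Sum>g\<in>carrier G. gact g (\<alpha> i)) = 0"
      unfolding scaleR_2 sum_negf by (metis add.right_inverse)
    then show ?thesis unfolding scaleR_eq_0_iff by simp
  qed
  have "linear (\<lambda>v. \<Sum>g\<in>carrier G. gact g v)" by (intro linear_compose_sum ballI linear_gact)
  then show ?thesis
    by (rule linear_eq_0_on_span[where b = "range \<alpha>"]) (use simple mem_span_simple in auto)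
qed

text \<open>A vector in the radical is fixed by the group, hence annihilated by the operator in \<open>sum_gact\<close>.\<close>

lemma form_nondegenerate: assumes "\<And>i. form (\<alpha> i) x = 0" shows "x = 0"
proof -
  have "act w x = x" for w by (induction w) (simp_all add: refl_in_def assms)
  then have "gact g x = x" for g by (simp add: gact_def)
  then have "real (card (carrier G)) *\<^sub>R x = 0"
    using sum_gact[of x] by (simp only: sum_constant_scaleR)
  moreover have "card (carrier G) \<noteq> 0" using finite_G one_closed by auto
  ultimately show ?thesis unfolding scaleR_eq_0_iff by simp
qed

text \<open>The hyperplane of a reflection is the kernel of \<open>form\<close> with its root, and a
  functional that vanishes wherever two others do is a combination of them. Nondegeneracy carries
  the combination from functionals back to roots.\<close>

lemma mem_reflections_through_iff:
  assumes "s \<in> R" "t \<in> R"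
  shows "r \<in> reflections_through m s t \<longleftrightarrow> r \<in> R \<and> root_of r \<in> span {root_of s, root_of t}"
proof (cases "r \<in> R")
  case True
  have cplx_inclusion: "hyperplane m s \<inter> hyperplane m t \<subseteq> hyperplane m r
      \<longleftrightarrow> (\<forall>x. form (root_of s) x = 0 \<and> form (root_of t) x = 0 \<longrightarrow> form (root_of r) x = 0)"
    (is "?L \<longleftrightarrow> ?C")
  proof
    assume L: ?L
    show ?C
    proof (intro allI impI)
      fix x assume "form (root_of s) x = 0 \<and> form (root_of t) x = 0"
      then have "cplx x x \<in> hyperplane m s \<inter> hyperplane m t"
        using assms by (simp add: hyperplane_cplx gact_fixed_iff)
      then have "cplx x x \<in> hyperplane m r" using L by blast
      then show "form (root_of r) x = 0" using True by (simp add: hyperplane_cplx gact_fixed_iff)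
    qed
  next
    assume C: ?C
    show ?L
    proof
      fix v assume v: "v \<in> hyperplane m s \<inter> hyperplane m t"
      obtain x y where "v = cplx x y" by (rule cplx_cases)
      then show "v \<in> hyperplane m r" using v C assms True by (simp add: hyperplane_cplx gact_fixed_iff)
    qed
  qed
  have "?C \<longleftrightarrow> root_of r \<in> span {root_of s, root_of t}"
  proof
    assume C: ?C
    have f: "form \<beta> x = (gram *v \<beta>) \<bullet> x" for \<beta> x
      using form_sym[of \<beta> x] by (simp add: form_def inner_commute)
    \<comment> \<open>The functionals are represented by the vectors \<open>gram *v \<beta>\<close>
      in the coordinate inner product, where a subspace is its own double orthogonal
      complement.\<close>
    define U where "U = span {gram *v root_of s, gram *v root_of t}"
    have "gram *v root_of r \<in> U\<^sup>\<bottom>\<^sup>\<bottom>"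
      unfolding orthogonal_comp_def
    proof (intro CollectI ballI)
      fix x assume "x \<in> {x. \<forall>y\<in>U. orthogonal y x}"
      then have x: "\<And>y. y \<in> U \<Longrightarrow> y \<bullet> x = 0" by (simp add: orthogonal_def)
      have "form (root_of s) x = 0" "form (root_of t) x = 0"
        unfolding f by (intro x, simp add: U_def span_base)+
      then show "orthogonal x (gram *v root_of r)"
        using C by (simp add: f orthogonal_def inner_commute)
    qed
    then have "gram *v root_of r \<in> U" using orthogonal_comp_self[of U] by (simp add: U_def)
    then obtain a b where "gram *v root_of r = a *\<^sub>R (gram *v root_of s) + b *\<^sub>R (gram *v root_of t)"
      unfolding U_def mem_span_pair by blast
    then have "gram *v (root_of r - (a *\<^sub>R root_of s + b *\<^sub>R root_of t)) = 0"
      by (simp add: matrix_vector_mult_diff_distrib matrix_vector_right_distrib matrix_vector_mult_scaleR)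
    then have "root_of r - (a *\<^sub>R root_of s + b *\<^sub>R root_of t) = 0"
      by (intro form_nondegenerate) (simp only: form_def inner_zero_right)
    then show "root_of r \<in> span {root_of s, root_of t}" unfolding mem_span_pair by auto
  next
    assume "root_of r \<in> span {root_of s, root_of t}"
    then show ?C unfolding mem_span_pair by auto
  qed
  then show ?thesis using True cplx_inclusion by (simp add: reflections_through_def)
qed (simp add: reflections_through_def)

subsection \<open>Reduction to rank two\<close>

lemma simple_multiple_root: "c *\<^sub>R \<alpha> i \<in> roots \<Longrightarrow> c = 1 \<or> c = - 1"
  using form_root[of "c *\<^sub>R \<alpha> i"] by (simp add: power2_eq_1_iff flip: power2_eq_square)

text \<open>\<open>s_k\<close> changes only the \<open>k\<close>-th coordinate. If the result were
  negative, all other coordinates of \<open>\<beta>\<close> would vanish and \<open>\<beta>\<close>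
  would be a root proportional to \<open>\<alpha> k\<close>.\<close>

lemma refl_simple_nonneg:
  assumes "\<beta> \<in> roots" "nonneg \<beta>" "\<beta> \<noteq> \<alpha> k"
  shows "nonneg (refl_in (\<alpha> k) \<beta>)"
proof (rule ccontr)
  assume "\<not> nonneg (refl_in (\<alpha> k) \<beta>)"
  moreover have "refl_in (\<alpha> k) \<beta> \<in> roots" using act_roots[OF assms(1), of "[k]"] by simp
  ultimately have neg: "nonneg (- refl_in (\<alpha> k) \<beta>)" using root_nonneg_cases by blast
  have "\<beta> $ j = 0" if "j \<noteq> k" for j
  proof -
    have "0 \<le> (- refl_in (\<alpha> k) \<beta>) $ j" "0 \<le> \<beta> $ j" using neg assms(2) unfolding nonneg_def by blast+
    then show ?thesis using that by (simp add: refl_in_def axis_def)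
  qed
  then have b: "\<beta> = (\<beta> $ k) *\<^sub>R \<alpha> k" by (auto simp: vec_eq_iff axis_def)
  have "\<beta> $ k = 1 \<or> \<beta> $ k = - 1"
    by (rule simple_multiple_root[of _ k]) (fold b, rule assms(1))
  moreover have "\<beta> $ k \<ge> 0" using assms(2) by (simp add: nonneg_def)
  ultimately show False using b assms(3) by auto
qed

text \<open>Choose \<open>w\<close> with the fewest positive roots \<open>\<beta>\<close> such that
  \<open>v \<bullet> act w \<beta> < 0\<close>. Were some \<open>\<alpha> k\<close> among them,
  \<open>w @ [k]\<close> would lose it and only permute the others, since \<open>s_k\<close> keeps
  every other positive root positive.\<close>

lemma exists_dominant:
  obtains w where "\<And>k. v \<bullet> act w (\<alpha> k) \<ge> 0"
proof -
  define N where "N w = {\<beta> \<in> roots. nonneg \<beta> \<and> v \<bullet> act w \<beta> < 0}" for w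
  obtain w where min: "\<And>u. card (N w) \<le> card (N u)"
    using ex_has_least_nat[of "\<lambda>_. True" "[]" "\<lambda>w. card (N w)"] by blast
  have "v \<bullet> act w (\<alpha> k) \<ge> 0" for k
  proof (rule ccontr)
    assume neg: "\<not> v \<bullet> act w (\<alpha> k) \<ge> 0"
    have "refl_in (\<alpha> k) ` N (w @ [k]) \<subset> N w"
    proof
      show "refl_in (\<alpha> k) ` N (w @ [k]) \<subseteq> N w"
      proof clarify
        fix \<beta> assume b: "\<beta> \<in> N (w @ [k])"
        then have "\<beta> \<noteq> \<alpha> k" using neg by (auto simp: N_def refl_in_self)
        then show "refl_in (\<alpha> k) \<beta> \<in> N w"
          using b refl_simple_nonneg act_roots[of \<beta> "[k]"] by (simp add: N_def)
      qed
      have "\<alpha> k \<notin> refl_in (\<alpha> k) ` N (w @ [k])"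
      proof
        assume "\<alpha> k \<in> refl_in (\<alpha> k) ` N (w @ [k])"
        then obtain \<beta> where "\<beta> \<in> N (w @ [k])" "\<alpha> k = refl_in (\<alpha> k) \<beta>" by auto
        then have "\<beta> = - \<alpha> k" "nonneg \<beta>"
          using refl_in_involution[of "\<alpha> k" \<beta>] by (auto simp: N_def refl_in_self)
        then show False using not_nonneg_both[of "\<alpha> k"] by simp
      qed
      moreover have "\<alpha> k \<in> N w" using neg by (simp add: N_def)
      ultimately show "refl_in (\<alpha> k) ` N (w @ [k]) \<noteq> N w" by blast
    qed
    then have "card (refl_in (\<alpha> k) ` N (w @ [k])) < card (N w)"
      by (rule psubset_card_mono[rotated]) (simp add: N_def finite_roots)
    moreover have "inj (refl_in (\<alpha> k))"
      by (metis form_\<alpha>_self injI refl_in_involution)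
    then have "card (refl_in (\<alpha> k) ` N (w @ [k])) = card (N (w @ [k]))"
      by (rule card_image[OF inj_on_subset[OF _ subset_UNIV]])
    ultimately show False using min[of "w @ [k]"] by simp
  qed
  then show thesis using that by blast
qed

text \<open>Let \<open>v\<close> vanish on exactly the roots in the plane \<open>U\<close>, let
  \<open>w\<close> make it dominant, and let \<open>J\<close> index the simple roots on which it
  vanishes after \<open>w\<close>. Pulled back by \<open>w\<close>, the two given roots involve only
  \<open>J\<close>, and conversely the simple roots of \<open>J\<close> lie in the pulled-back
  plane. Independence gives \<open>card J \<le> 2\<close>; two nonproportional roots force
  equality.\<close>

lemma exists_rank_two:
  assumes "\<beta> \<in> roots" "\<gamma> \<in> roots" "\<beta> \<noteq> \<gamma>" "\<beta> \<noteq> - \<gamma>"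
  obtains w i j where "i \<noteq> j" "act w \<beta> \<in> span {\<alpha> i, \<alpha> j}" "act w \<gamma> \<in> span {\<alpha> i, \<alpha> j}"
proof -
  define U where "U = span {\<beta>, \<gamma>}"
  obtain v where v: "\<And>u. u \<in> U \<Longrightarrow> v \<bullet> u = 0" "\<And>\<delta>. \<delta> \<in> roots - U \<Longrightarrow> v \<bullet> \<delta> \<noteq> 0"
    using exists_generic_orthogonal[of "roots - U" U] finite_roots unfolding U_def
    by (metis Diff_disjoint finite_Diff inf_commute subspace_span)
  obtain w where w: "\<And>k. v \<bullet> act w (\<alpha> k) \<ge> 0" using exists_dominant[of v] by blast
  define J where "J = {k. v \<bullet> act w (\<alpha> k) = 0}"
  have support: "\<delta> $ k = 0" if "\<delta> \<in> roots" "v \<bullet> act w \<delta> = 0" "k \<notin> J" for \<delta> k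
  proof -
    have expand: "act w \<delta> = (\<Sum>l\<in>UNIV. \<delta> $ l *\<^sub>R act w (\<alpha> l))" for \<delta>
    proof -
      have "act w \<delta> = act w (\<Sum>l\<in>UNIV. \<delta> $ l *\<^sub>R \<alpha> l)"
        by (simp only: expand_simple)
      then show ?thesis by (simp add: linear_sum[OF linear_act])
    qed
    \<comment> \<open>A vanishing sum of nonnegative terms vanishes termwise, and outside
      \<open>J\<close> the pairing with \<open>v\<close> is positive.\<close>
    have pos: "\<delta> $ k = 0" if "nonneg \<delta>" "v \<bullet> act w \<delta> = 0" for \<delta>
    proof -
      have "(\<Sum>l\<in>UNIV. \<delta> $ l * (v \<bullet> act w (\<alpha> l))) = 0"
        using that(2) by (subst (asm) expand) (simp add: inner_sum_right)
      moreover have "\<forall>l\<in>UNIV. 0 \<le> \<delta> $ l * (v \<bullet> act w (\<alpha> l))"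
        using that(1) w by (simp add: nonneg_def)
      ultimately have "\<delta> $ k * (v \<bullet> act w (\<alpha> k)) = 0"
        using sum_nonneg_eq_0_iff[of UNIV "\<lambda>l. \<delta> $ l * (v \<bullet> act w (\<alpha> l))"] by simp
      then show ?thesis using \<open>k \<notin> J\<close> by (simp add: J_def)
    qed
    show ?thesis
    proof (cases "nonneg \<delta>")
      case False
      then have "(- \<delta>) $ k = 0"
        using root_nonneg_cases that by (intro pos) (auto simp: inner_minus_right)
      then show ?thesis by simp
    qed (use pos that in blast)
  qed
  define \<beta>' \<gamma>' where "\<beta>' = act (rev w) \<beta>" and "\<gamma>' = act (rev w) \<gamma>"
  have roots': "\<beta>' \<in> roots" "\<gamma>' \<in> roots" using assms act_roots by (auto simp: \<beta>'_def \<gamma>'_def)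
  have "v \<bullet> act w \<beta>' = 0" "v \<bullet> act w \<gamma>' = 0"
    using v(1) by (auto simp: \<beta>'_def \<gamma>'_def U_def span_base)
  then have supp: "\<beta>' $ k = 0 \<and> \<gamma>' $ k = 0" if "k \<notin> J" for k
    using that support roots' by blast
  have "\<alpha> ` J \<subseteq> span {\<beta>', \<gamma>'}"
  proof clarify
    fix k assume "k \<in> J"
    then have "act w (\<alpha> k) \<in> U" using v(2)[of "act w (\<alpha> k)"] act_roots[of "\<alpha> k" w] by (auto simp: J_def)
    then obtain a b where "act w (\<alpha> k) = a *\<^sub>R \<beta> + b *\<^sub>R \<gamma>" by (auto simp: U_def mem_span_pair)
    then have "act (rev w) (act w (\<alpha> k)) = a *\<^sub>R \<beta>' + b *\<^sub>R \<gamma>'" by (simp add: \<beta>'_def \<gamma>'_def)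
    then show "\<alpha> k \<in> span {\<beta>', \<gamma>'}" unfolding mem_span_pair act_rev by blast
  qed
  moreover have "independent (\<alpha> ` J)"
    by (rule independent_mono[OF independent_Basis]) (auto simp: axis_in_Basis_iff)
  ultimately have "card (\<alpha> ` J) \<le> card {\<beta>', \<gamma>'}"
    using independent_span_bound[of "{\<beta>', \<gamma>'}" "\<alpha> ` J"] by auto
  also have "\<dots> \<le> 2" by (simp add: card_insert_if)
  finally have "card J \<le> 2" by (simp add: card_image inj_on_def axis_eq_axis)
  moreover have "\<not> card J \<le> 1"
  proof
    assume "card J \<le> 1"
    then obtain i where i: "J \<subseteq> {i}" using card_le_Suc0_iff_eq[of J] by (cases "J = {}") auto
    have *: "\<beta>' = (\<beta>' $ i) *\<^sub>R \<alpha> i" "\<gamma>' = (\<gamma>' $ i) *\<^sub>R \<alpha> i"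
      using supp i by (auto simp: vec_eq_iff axis_def)
    have "\<beta>' $ i = 1 \<or> \<beta>' $ i = - 1" "\<gamma>' $ i = 1 \<or> \<gamma>' $ i = - 1"
      by (rule simple_multiple_root[of _ i], fold *, rule roots')+
    then have "\<beta>' \<in> {\<alpha> i, - \<alpha> i}" "\<gamma>' \<in> {\<alpha> i, - \<alpha> i}" using * by auto
    then have "\<beta>' = \<gamma>' \<or> \<beta>' = - \<gamma>'" by auto
    then have "act w \<beta>' = act w \<gamma>' \<or> act w \<beta>' = - act w \<gamma>'" by (metis act_linear(4))
    then show False using assms by (simp add: \<beta>'_def \<gamma>'_def)
  qed
  ultimately have "card J = 2" by simp
  then obtain i j where J: "J = {i, j}" "i \<noteq> j" by (auto simp: card_2_iff)
  have "\<beta>' = (\<beta>' $ i) *\<^sub>R \<alpha> i + (\<beta>' $ j) *\<^sub>R \<alpha> j" "\<gamma>' = (\<gamma>' $ i) *\<^sub>R \<alpha> i + (\<gamma>' $ j) *\<^sub>R \<alpha> j"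
    using supp J by (auto simp: vec_eq_iff axis_def)
  then have "\<beta>' \<in> span {\<alpha> i, \<alpha> j}" "\<gamma>' \<in> span {\<alpha> i, \<alpha> j}" unfolding mem_span_pair by blast+
  then show thesis using that[OF J(2)] by (simp add: \<beta>'_def \<gamma>'_def)
qed

lemma sum_\<alpha>: "(\<Sum>k\<in>UNIV. \<alpha> z $ k) = 1"
  by (simp add: axis_def)

text \<open>Induction on the number of roots of smaller height (coordinate sum). Since
  \<open>form \<beta> \<beta> = 1\<close>, one of the two simple roots has positive
  \<open>form\<close> with \<open>\<beta>\<close>, and reflecting in it lowers the height.\<close>

lemma rank_two_root:
  assumes "\<beta> \<in> roots" "\<beta> \<in> span {\<alpha> i, \<alpha> j}" "i \<noteq> j" "nonneg \<beta>"
  shows "\<exists>w\<in>lists {i, j}. \<exists>z\<in>{i, j}. \<beta> = act w (\<alpha> z)"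
  using assms
proof (induction "card {\<gamma> \<in> roots. (\<Sum>k\<in>UNIV. \<gamma> $ k) < (\<Sum>k\<in>UNIV. \<beta> $ k)}" arbitrary: \<beta> rule: less_induct)
  case less
  obtain a b where ab: "\<beta> = a *\<^sub>R \<alpha> i + b *\<^sub>R \<alpha> j" using less.prems by (auto simp: mem_span_pair)
  have "a = \<beta> $ i" "b = \<beta> $ j" using less.prems(3) by (auto simp: ab axis_def)
  then have pos: "a \<ge> 0" "b \<ge> 0" using less.prems(4) by (simp_all add: nonneg_def)
  have "1 = form \<beta> \<beta>" using less.prems by simp
  also have "\<dots> = a * form (\<alpha> i) \<beta> + b * form (\<alpha> j) \<beta>" by (subst (1) ab) simp
  finally have "\<not> (form (\<alpha> i) \<beta> \<le> 0 \<and> form (\<alpha> j) \<beta> \<le> 0)"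
    using pos by (smt (verit) mult_nonneg_nonpos)
  then obtain z where z: "z \<in> {i, j}" "form (\<alpha> z) \<beta> > 0" by force
  show ?case
  proof (cases "\<beta> = \<alpha> z")
    case True
    then show ?thesis using z by (intro bexI[of _ "[]"] bexI[of _ z]) auto
  next
    case False
    define \<gamma> where "\<gamma> = refl_in (\<alpha> z) \<beta>"
    have root: "\<gamma> \<in> roots" using act_roots[OF less.prems(1), of "[z]"] by (simp add: \<gamma>_def)
    have nn: "nonneg \<gamma>" unfolding \<gamma>_def using less.prems False by (intro refl_simple_nonneg)
    have "\<alpha> z \<in> span {\<alpha> i, \<alpha> j}" using z by (auto intro: span_base)
    then have sp: "\<gamma> \<in> span {\<alpha> i, \<alpha> j}"
      unfolding \<gamma>_def refl_in_def using less.prems by (intro span_diff span_scale)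
    have "(\<Sum>k\<in>UNIV. \<gamma> $ k) = (\<Sum>k\<in>UNIV. \<beta> $ k) - 2 * form (\<alpha> z) \<beta>"
      by (simp add: \<gamma>_def refl_in_def sum_subtractf sum_\<alpha> flip: sum_distrib_left)
    then have lt: "(\<Sum>k\<in>UNIV. \<gamma> $ k) < (\<Sum>k\<in>UNIV. \<beta> $ k)" using z by simp
    have smaller: "card {\<delta> \<in> roots. (\<Sum>k\<in>UNIV. \<delta> $ k) < (\<Sum>k\<in>UNIV. \<gamma> $ k)}
        < card {\<delta> \<in> roots. (\<Sum>k\<in>UNIV. \<delta> $ k) < (\<Sum>k\<in>UNIV. \<beta> $ k)}"
      using lt root finite_roots by (intro psubset_card_mono psubsetI) auto
    obtain w y where w: "w \<in> lists {i, j}" "y \<in> {i, j}" "\<gamma> = act w (\<alpha> y)"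
      using less.hyps[OF smaller root sp less.prems(3) nn] by blast
    have "act (z # w) (\<alpha> y) = refl_in (\<alpha> z) \<gamma>" by (simp add: w(3))
    then have "\<beta> = act (z # w) (\<alpha> y)" by (simp add: \<gamma>_def refl_in_involution)
    then show ?thesis using w z by (intro bexI[of _ "z # w"] bexI[of _ y]) auto
  qed
qed

end

section \<open>Conjugation and its effect on the sets R(s,t)\<close>

context coxeter begin

lemma conj_by_closed [simp]: "g \<in> carrier G \<Longrightarrow> x \<in> carrier G \<Longrightarrow> conj_by G g x \<in> carrier G"
  by (simp add: conj_by_def)

lemma conj_by_mult:
  "g \<in> carrier G \<Longrightarrow> x \<in> carrier G \<Longrightarrow> y \<in> carrier G \<Longrightarrow>
    conj_by G g (x \<cdot> y) = conj_by G g x \<cdot> conj_by G g y"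
  by (simp add: conj_by_def m_assoc inv_solve_left)

lemma conj_by_conj_by:
  "g \<in> carrier G \<Longrightarrow> h \<in> carrier G \<Longrightarrow> x \<in> carrier G \<Longrightarrow>
    conj_by G g (conj_by G h x) = conj_by G (g \<cdot> h) x"
  by (simp add: conj_by_def m_assoc inv_mult_group)

lemma conj_by_one [simp]: "x \<in> carrier G \<Longrightarrow> conj_by G \<one>\<^bsub>G\<^esub> x = x"
  by (simp add: conj_by_def)

lemma conj_by_inv [simp]:
  "g \<in> carrier G \<Longrightarrow> x \<in> carrier G \<Longrightarrow> conj_by G (inv\<^bsub>G\<^esub> g) (conj_by G g x) = x"
  "g \<in> carrier G \<Longrightarrow> x \<in> carrier G \<Longrightarrow> conj_by G g (conj_by G (inv\<^bsub>G\<^esub> g) x) = x"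
  by (simp_all add: conj_by_conj_by)

lemma conj_by_eq_iff:
  "g \<in> carrier G \<Longrightarrow> x \<in> carrier G \<Longrightarrow> y \<in> carrier G \<Longrightarrow> conj_by G g x = conj_by G g y \<longleftrightarrow> x = y"
  by (metis conj_by_inv(1))

lemma conj_by_reflection: "r \<in> R \<Longrightarrow> x \<in> carrier G \<Longrightarrow> conj_by G r x = r \<cdot> x \<cdot> r"
  by (simp add: conj_by_def reflection_inv)

lemma mem_refl_conj_iff: "r \<in> refl_conj m s t \<longleftrightarrow> r \<in> R \<and> r \<cdot> t \<cdot> r = s"
  by (simp add: refl_conj_def)

lemma refl_conj_subset: "refl_conj m s t \<subseteq> R"
  by (auto simp: refl_conj_def)

lemma refl_conj_conj_by:
  assumes g: "g \<in> carrier G" and s: "s \<in> R" and t: "t \<in> R"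
  shows "refl_conj m (conj_by G g s) (conj_by G g t) = conj_by G g ` refl_conj m s t"
proof -
  have sub: "conj_by G g r \<in> refl_conj m (conj_by G g s) (conj_by G g t)"
    if "g \<in> carrier G" "s \<in> R" "t \<in> R" "r \<in> refl_conj m s t" for g r s t
    using that conj_by_reflections[of g r]
    by (auto simp: mem_refl_conj_iff reflections_carrier simp flip: conj_by_mult)
  show ?thesis
  proof (intro equalityI subsetI)
    fix r assume r: "r \<in> refl_conj m (conj_by G g s) (conj_by G g t)"
    have "conj_by G (inv\<^bsub>G\<^esub> g) r \<in> refl_conj m s t"
      using sub[OF inv_closed[OF g] conj_by_reflections[OF g s] conj_by_reflections[OF g t] r] g s t
      by (simp add: reflections_carrier)
    moreover have "r \<in> R" using r refl_conj_subset by blast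
    then have "r = conj_by G g (conj_by G (inv\<^bsub>G\<^esub> g) r)" by (simp add: g reflections_carrier)
    ultimately show "r \<in> conj_by G g ` refl_conj m s t" by blast
  qed (use sub g s t in blast)
qed

lemma refl_conj_sym: "s \<in> R \<Longrightarrow> t \<in> R \<Longrightarrow> refl_conj m s t = refl_conj m t s"
proof -
  have "r \<cdot> s \<cdot> r = t" if "r \<in> R" "s \<in> R" "t \<in> R" "r \<cdot> t \<cdot> r = s" for r s t
    using that conj_by_inv(1)[of r t] reflections_carrier by (metis conj_by_reflection reflection_inv)
  then show "s \<in> R \<Longrightarrow> t \<in> R \<Longrightarrow> refl_conj m s t = refl_conj m t s"
    by (auto simp: mem_refl_conj_iff)
qed

subsection \<open>Rank two parabolic subgroups\<close>

text \<open>\<open>rot i j\<close> enumerates the rotations of the dihedral group of \<open>i\<close> and \<open>j\<close>, and \<open>dref i j\<close> its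
  reflections, with \<open>dref i j 0 = s\<^sub>i\<close> and \<open>dref i j 1 = s\<^sub>j\<close>; both are periodic modulo \<open>m i j\<close>.\<close>

definition rot :: "'i \<Rightarrow> 'i \<Rightarrow> int \<Rightarrow> 'i list set" where
  "rot i j l = cls [j, i] [^]\<^bsub>G\<^esub> l"

definition dref :: "'i \<Rightarrow> 'i \<Rightarrow> int \<Rightarrow> 'i list set" where
  "dref i j l = rot i j l \<cdot> cls [i]"

lemma rot_closed [simp]: "rot i j l \<in> carrier G"
  by (simp add: rot_def)

lemma dref_closed [simp]: "dref i j l \<in> carrier G"
  by (simp add: dref_def)

lemma rot_0 [simp]: "rot i j 0 = \<one>\<^bsub>G\<^esub>"
  by (simp add: rot_def)

lemma rot_add: "rot i j (k + l) = rot i j k \<cdot> rot i j l"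
  by (simp add: rot_def int_pow_mult)

lemma rot_uminus: "rot i j (- k) = inv\<^bsub>G\<^esub> rot i j k"
  by (simp add: rot_def int_pow_neg)

lemma simple_square: "cls [i] \<cdot> cls [i] = \<one>\<^bsub>G\<^esub>"
  by (rule reflection_square) simp

lemma simple_rot: "cls [i] \<cdot> rot i j l = rot i j (- l) \<cdot> cls [i]"
proof -
  have 1: "cls [i] \<cdot> rot i j 1 = rot i j (- 1) \<cdot> cls [i]"
    by (simp add: rot_uminus) (simp add: rot_def)
  have step: "cls [i] \<cdot> rot i j (k + l) = rot i j (- (k + l)) \<cdot> cls [i]"
    if "cls [i] \<cdot> rot i j k = rot i j (- k) \<cdot> cls [i]" "cls [i] \<cdot> rot i j l = rot i j (- l) \<cdot> cls [i]" for k l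
  proof -
    have "cls [i] \<cdot> rot i j (k + l) = (cls [i] \<cdot> rot i j k) \<cdot> rot i j l"
      by (simp add: rot_add m_assoc del: cls_mult)
    also have "\<dots> = rot i j (- k) \<cdot> (cls [i] \<cdot> rot i j l)"
      by (simp add: that(1) m_assoc del: cls_mult)
    also have "\<dots> = rot i j (- k) \<cdot> rot i j (- l) \<cdot> cls [i]"
      by (simp add: that(2) m_assoc del: cls_mult)
    finally show ?thesis by (simp flip: rot_add)
  qed
  have "1 = (-1) + (2::int)" by simp
  have neg: "cls [i] \<cdot> rot i j (- l) = rot i j l \<cdot> cls [i]"
    if "cls [i] \<cdot> rot i j l = rot i j (- l) \<cdot> cls [i]" for l
  proof -
    have "cls [i] \<cdot> rot i j (- l) = cls [i] \<cdot> (rot i j (- l) \<cdot> cls [i]) \<cdot> cls [i]"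
      by (simp add: m_assoc simple_square del: cls_mult)
    also have "\<dots> = (cls [i] \<cdot> cls [i]) \<cdot> rot i j l \<cdot> cls [i]"
      by (simp add: m_assoc del: cls_mult flip: that)
    finally show ?thesis by (simp add: simple_square del: cls_mult)
  qed
  show ?thesis
  proof (induction l rule: int_induct[where k = 0])
    case base
    show ?case by simp
  next
    case (step1 l)
    then show ?case using step[of l 1] 1 by simp
  next
    case (step2 l)
    then show ?case using step[of l "- 1"] neg[OF 1] 1 by simp
  qed
qed

lemma dref_mult_rot: "dref i j k \<cdot> rot i j l = dref i j (k - l)"
proof -
  have "dref i j k \<cdot> rot i j l = rot i j k \<cdot> (cls [i] \<cdot> rot i j l)"
    by (simp add: dref_def m_assoc del: cls_mult)
  also have "\<dots> = (rot i j k \<cdot> rot i j (- l)) \<cdot> cls [i]"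
    by (simp add: simple_rot m_assoc del: cls_mult)
  finally show ?thesis by (simp add: dref_def flip: rot_add)
qed

lemma rot_mult_dref: "rot i j k \<cdot> dref i j l = dref i j (k + l)"
  by (simp add: dref_def rot_add m_assoc)

lemma dref_mult: "dref i j k \<cdot> dref i j l = rot i j (k - l)"
proof -
  have "dref i j k \<cdot> dref i j l = dref i j (k - l) \<cdot> cls [i]"
    unfolding dref_def[of i j l] by (simp add: m_assoc[symmetric] dref_mult_rot del: cls_mult)
  also have "\<dots> = rot i j (k - l)"
    by (simp add: dref_def m_assoc simple_square del: cls_mult)
  finally show ?thesis .
qed

lemma dref_0: "dref i j 0 = cls [i]"
  by (simp add: dref_def)

lemma dref_1: "dref i j 1 = cls [j]"
  using word_eq_snoc_snoc[of "[j]" i] by (simp add: dref_def rot_def cls_eq_iff)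

lemma dref_inv: "inv\<^bsub>G\<^esub> dref i j k = dref i j k"
  by (rule inv_equality) (simp_all add: dref_mult)

lemma conj_by_dref: "conj_by G (dref i j k) (dref i j l) = dref i j (2 * k - l)"
  by (simp add: conj_by_def dref_inv dref_mult rot_mult_dref)

lemma dref_conjugate:
  obtains k where "dref i j l = conj_by G (dref i j k) (cls [i])"
  | k where "dref i j l = conj_by G (dref i j k) (cls [j])"
proof (cases "even l")
  case True
  then obtain k where "l = 2 * k" by blast
  then have "dref i j l = conj_by G (dref i j k) (cls [i])" using conj_by_dref[of i j k 0] by (simp add: dref_0)
  then show ?thesis using that by blast
next
  case False
  then obtain k where "l = 2 * k + 1" using oddE by blast
  then have "dref i j l = conj_by G (dref i j (k + 1)) (cls [j])"
    using conj_by_dref[of i j "k + 1" 1] by (simp add: dref_1 algebra_simps)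
  then show ?thesis using that by blast
qed

lemma dref_reflections [simp]: "dref i j l \<in> R"
  by (rule dref_conjugate[of i j l]) (simp_all add: conj_by_reflections del: conj_by_cls)

lemma cls_alt_even: "cls (alt (2 * l) j i) = rot i j (int l)"
proof (induction l)
  case 0
  then show ?case by (simp add: one_G)
next
  case (Suc l)
  have "cls (alt (2 * Suc l) j i) = cls [j, i] \<cdot> cls (alt (2 * l) j i)" by simp
  also have "\<dots> = rot i j 1 \<cdot> rot i j (int l)" by (simp only: Suc) (simp add: rot_def)
  finally show ?case by (simp flip: rot_add)
qed

text \<open>In terms of length: the word of length \<open>2 * l - 1\<close> starting with
  \<open>j\<close> is \<open>dref i j l\<close>. It is the reflection that the link relations put
  between two copies of \<open>e_i\<close>.\<close>

lemma cls_alt_odd: "cls (alt (2 * l + 1) j i) = dref i j (int l + 1)"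
proof -
  have "cls (alt (2 * l + 1) j i) = cls (alt (2 * l) j i) \<cdot> cls [j]"
    using alt_snoc[of "2 * l" j i] by simp
  then show ?thesis unfolding cls_alt_even by (simp add: rot_mult_dref flip: dref_1[of i j])
qed

lemma rot_swap: "rot j i l = rot i j (- l)"
proof -
  have "rot j i l = (inv\<^bsub>G\<^esub> cls [j, i]) [^]\<^bsub>G\<^esub> l" by (simp add: rot_def)
  then show ?thesis by (simp add: rot_def int_pow_inv int_pow_neg del: inv_cls)
qed

lemma dref_swap: "dref j i l = dref i j (1 - l)"
proof -
  have "dref j i l = rot i j (- l) \<cdot> dref i j 1" by (simp only: dref_def[of j i] rot_swap[of j i l] dref_1)
  then show ?thesis by (simp add: rot_mult_dref)
qed

lemma cls_alt_even': "cls (alt (2 * l) i j) = rot i j (- int l)"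
  using cls_alt_even[of l i j] rot_swap[of j i] by simp

text \<open>The relations show only that the order of \<open>s_j s_i\<close> divides
  \<open>m i j\<close>. That it is no smaller is read off from the geometric representation, where
  this element turns the plane by \<open>2 * \<theta>\<close>.\<close>

lemma rot_nat_eq_one_iff:
  assumes "i \<noteq> j" shows "rot i j (int d) = \<one>\<^bsub>G\<^esub> \<longleftrightarrow> m i j dvd d"
proof -
  define n where "n = m i j"
  have n: "n \<ge> 2" using m_ge2[OF assms] by (simp add: n_def)
  have braid: "alt n j i \<sim> alt n i j" using cox_eq.braid[of j i m] assms m_sym by (simp add: n_def)
  have full: "rot i j (int n) = \<one>\<^bsub>G\<^esub>"
  proof -
    have "alt (2 * n) j i = alt n j i @ (if even n then alt n j i else alt n i j)"
      using alt_append[of n n j i] by (simp add: mult_2)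
    also have "\<dots> \<sim> alt n j i @ rev (alt n j i)"
      using braid cox_eq.sym by (auto intro!: word_eq_append_left simp: rev_alt cox_eq.refl)
    also have "\<dots> \<sim> []" by (rule word_eq_cancel)
    finally show ?thesis unfolding cls_alt_even[symmetric] by (simp add: one_G cls_eq_iff)
  qed
  have nontrivial: "rot i j (int d) \<noteq> \<one>\<^bsub>G\<^esub>" if d: "0 < d" "d < n" for d
  proof
    define \<theta> where "\<theta> = pi / real n"
    assume "rot i j (int d) = \<one>\<^bsub>G\<^esub>"
    then have "act (alt (2 * d) j i) (\<alpha> j) = \<alpha> j"
      using act_word_eq[of "alt (2 * d) j i" "[]"] unfolding cls_alt_even[symmetric] one_G cls_eq_iff by simp
    then have e: "\<alpha> j = (sin (real (2 * d + 1) * \<theta>) / sin \<theta>) *\<^sub>R \<alpha> j + (sin (real (2 * d) * \<theta>) / sin \<theta>) *\<^sub>R \<alpha> i"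
      using act_alt[of j i "2 * d"] assms m_sym[of j i] by (simp add: \<theta>_def n_def)
    have s: "sin \<theta> > 0" using angle_bounds(3)[OF assms] by (simp add: \<theta>_def n_def)
    from arg_cong[OF e, of "\<lambda>v. v $ i"] have s0: "sin (real (2 * d) * \<theta>) = 0"
      using s assms by (simp add: axis_def)
    from arg_cong[OF e, of "\<lambda>v. v $ j"] have s1: "sin (real (2 * d + 1) * \<theta>) = sin \<theta>"
      using s assms by (simp add: axis_def split: if_splits)
    define x where "x = real d * \<theta>"
    have "sin (2 * x) = 0" using s0 by (simp add: x_def algebra_simps)
    moreover have "sin (2 * x + \<theta>) = sin \<theta>" using s1 by (simp add: x_def algebra_simps)
    ultimately have "cos (2 * x) = 1" using s by (simp add: sin_add)
    then have "sin x = 0" using cos_double_sin[of x] by simp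
    moreover have "0 < x" "x < pi" using d n by (auto simp: x_def \<theta>_def field_simps)
    ultimately show False using sin_gt_zero[of x] by simp
  qed
  have "rot i j (int d) = rot i j (int (d mod n))"
  proof -
    have "int d = int n * int (d div n) + int (d mod n)" by (metis mult_div_mod_eq of_nat_add of_nat_mult)
    then have "rot i j (int d) = rot i j (int n * int (d div n)) \<cdot> rot i j (int (d mod n))"
      by (simp only: rot_add)
    moreover have "rot i j (int n * int (d div n)) = rot i j (int n) [^]\<^bsub>G\<^esub> int (d div n)"
      by (simp add: rot_def int_pow_pow)
    ultimately show ?thesis using full by simp
  qed
  moreover have "d mod n < n" using n by simp
  ultimately show ?thesis using nontrivial[of "d mod n"] unfolding n_def[symmetric]
    by (metis dvd_eq_mod_eq_0 gr0I of_nat_0 rot_0)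
qed

lemma rot_eq_iff: assumes "i \<noteq> j" shows "rot i j k = rot i j l \<longleftrightarrow> int (m i j) dvd k - l"
proof -
  have "ord (cls [j, i]) = m i j"
    using rot_nat_eq_one_iff[OF assms] by (subst ord_unique) (simp_all add: rot_def int_pow_int)
  then show ?thesis using int_pow_eq[of "cls [j, i]" l k] by (auto simp: rot_def)
qed

lemma dref_eq_iff: assumes "i \<noteq> j" shows "dref i j k = dref i j l \<longleftrightarrow> int (m i j) dvd k - l"
  using rot_eq_iff[OF assms] by (simp add: dref_def)

text \<open>Each letter acts on indices by a map \<open>x \<mapsto> 2 * e - x\<close>, which keeps
  parity. For even \<open>m i j\<close> the parity of the index is thus an invariant of conjugacy
  inside the dihedral group.\<close>

lemma conj_by_word_dref:
  "w \<in> lists {i, j} \<Longrightarrow> \<exists>l. conj_by G (cls w) (dref i j n) = dref i j (n + 2 * l)"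
proof (induction w)
  case Nil
  then show ?case using conj_by_one[of "dref i j n"] by (intro exI[of _ 0]) (simp add: one_G)
next
  case (Cons z w)
  then obtain l where l: "conj_by G (cls w) (dref i j n) = dref i j (n + 2 * l)" by auto
  have "z = i \<or> z = j" using Cons.prems by auto
  then obtain e where e: "cls [z] = dref i j e" using dref_0[of i j] dref_1[of i j] by metis
  have "cls (z # w) = cls [z] \<cdot> cls w" by simp
  then have "conj_by G (cls (z # w)) (dref i j n) = conj_by G (cls [z]) (dref i j (n + 2 * l))"
    by (simp add: conj_by_conj_by del: cls_mult flip: l)
  also have "\<dots> = dref i j (2 * e - (n + 2 * l))" by (simp add: e conj_by_dref)
  also have "2 * e - (n + 2 * l) = n + 2 * (e - n - l)" by simp
  finally show ?case by blast
qed

lemma rot_word: "\<exists>w\<in>lists {i, j}. rot i j l = cls w"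
proof (cases l)
  case (nonneg n)
  then show ?thesis using cls_alt_even[of n j i] alt_lists[of j "{i, j}" i "2 * n"] by auto
next
  case (neg n)
  then show ?thesis using cls_alt_even'[of "Suc n" i j] alt_lists[of i "{i, j}" j "2 * Suc n"] by (metis insertCI)
qed

lemma dref_word: "\<exists>w\<in>lists {i, j}. dref i j l = cls w"
proof -
  obtain w where "w \<in> lists {i, j}" "rot i j l = cls w" using rot_word by blast
  then show ?thesis by (intro bexI[of _ "w @ [i]"]) (simp_all add: dref_def)
qed

lemma act_preserves_span:
  assumes "w \<in> lists {i, j}" "v \<in> span {\<alpha> i, \<alpha> j}" shows "act w v \<in> span {\<alpha> i, \<alpha> j}"
  using assms
proof (induction w)
  case (Cons z w)
  have "\<alpha> z \<in> span {\<alpha> i, \<alpha> j}" using Cons.hyps by (auto intro: span_base)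
  then show ?case using Cons by (auto simp: refl_in_def intro!: span_diff span_scale)
qed simp

lemma uminus_span_iff: "- x \<in> span S \<longleftrightarrow> x \<in> span S" for x :: "real ^ 'i"
  using span_neg[of x S] span_neg[of "- x" S] by auto

lemma root_of_dref: "root_of (dref i j l) \<in> span {\<alpha> i, \<alpha> j}"
proof -
  have z: "root_of (conj_by G (dref i j k) (cls [z])) \<in> span {\<alpha> i, \<alpha> j}" if "z \<in> {i, j}" for k z
  proof -
    obtain w where w: "w \<in> lists {i, j}" "dref i j k = cls w" using dref_word by blast
    have "\<alpha> z \<in> span {\<alpha> i, \<alpha> j}" using that by (auto intro: span_base)
    then have "root_of (cls [z]) \<in> span {\<alpha> i, \<alpha> j}" using root_of_simple[of z] uminus_span_iff by metis
    then have "act w (root_of (cls [z])) \<in> span {\<alpha> i, \<alpha> j}" using w act_preserves_span by blast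
    then show ?thesis using root_of_conj_by[of "cls w" "cls [z]"] uminus_span_iff unfolding w(2) by (metis cls_carrier gact_cls simple_reflections)
  qed
  show ?thesis by (rule dref_conjugate[of i j l]) (use z in auto)
qed

end

section \<open>Reflections in the plane of two simple roots\<close>

context finite_coxeter begin

text \<open>Up to sign the root is nonnegative, so \<open>rank_two_root\<close> makes it a dihedral
  image of a simple root; faithfulness then identifies the group elements.\<close>

lemma reflection_in_plane:
  assumes "r \<in> R" "i \<noteq> j"
  shows "root_of r \<in> span {\<alpha> i, \<alpha> j} \<longleftrightarrow> (\<exists>l. r = dref i j l)"
proof
  assume "root_of r \<in> span {\<alpha> i, \<alpha> j}"
  moreover obtain \<beta> where \<beta>: "\<beta> = root_of r \<or> \<beta> = - root_of r" "nonneg \<beta>"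
    using root_nonneg_cases[OF root_of(1)[OF assms(1)]] by blast
  ultimately have "\<beta> \<in> span {\<alpha> i, \<alpha> j}" "\<beta> \<in> roots"
    using uminus_span_iff uminus_roots root_of(1)[OF assms(1)] by auto
  then obtain w z where w: "w \<in> lists {i, j}" "z \<in> {i, j}" "\<beta> = act w (\<alpha> z)"
    using rank_two_root assms(2) \<beta>(2) by blast
  have "gact r = refl_in \<beta>"
    using root_of[OF assms(1)] \<beta>(1) refl_in_eq_iff by (metis form_root uminus_roots)
  then have "gact r = gact (conj_by G (cls w) (cls [z]))"
    using act_reflection[of w z] w(3) by simp
  then have r: "r = conj_by G (cls w) (cls [z])"
    using assms(1) reflections_carrier by (intro gact_faithful) auto
  obtain e where "cls [z] = dref i j e" using w(2) dref_0[of i j] dref_1[of i j] by (metis empty_iff insert_iff)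
  then show "\<exists>l. r = dref i j l" using conj_by_word_dref[OF w(1)] r by metis
qed (use root_of_dref in auto)

lemma span_two_roots:
  assumes "s \<in> R" "t \<in> R" "s \<noteq> t" "root_of s \<in> span {\<alpha> i, \<alpha> j}" "root_of t \<in> span {\<alpha> i, \<alpha> j}"
  shows "span {root_of s, root_of t} = span {\<alpha> i, \<alpha> j}"
proof (rule antisym)
  show "span {root_of s, root_of t} \<subseteq> span {\<alpha> i, \<alpha> j}" using assms(4,5) by (intro span_minimal) auto
  have notin: "root_of s \<notin> span {root_of t}"
  proof
    assume "root_of s \<in> span {root_of t}"
    then obtain c where c: "root_of s = c *\<^sub>R root_of t" by (auto simp: span_singleton)
    then have "c * c = 1" using form_root[OF root_of(1)[OF assms(1)]] form_root[OF root_of(1)[OF assms(2)]] by simp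
    then have "c = 1 \<or> c = - 1" by (simp add: power2_eq_1_iff flip: power2_eq_square)
    then show False using c root_of_inj[OF assms(1,2)] assms(3) by auto
  qed
  have "root_of t \<noteq> 0" using form_root[OF root_of(1)[OF assms(2)]] by fastforce
  then have ind: "independent {root_of s, root_of t}" using notin by (simp add: independent_insert)
  have "root_of s \<noteq> root_of t" using notin by (metis insertI1 span_base)
  then have "card {root_of s, root_of t} = 2" by simp
  moreover have "dim (span {\<alpha> i, \<alpha> j}) \<le> card {\<alpha> i, \<alpha> j}" unfolding dim_span by (rule dim_le_card') simp
  moreover have "card {\<alpha> i, \<alpha> j} \<le> 2" by (simp add: card_insert_if)
  ultimately have "dim (span {\<alpha> i, \<alpha> j}) \<le> card {root_of s, root_of t}" by simp
  then show "span {\<alpha> i, \<alpha> j} \<subseteq> span {root_of s, root_of t}"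
    using assms(4,5) by (intro card_ge_dim_independent[OF _ ind]) simp_all
qed

lemma reflections_through_dref:
  assumes "i \<noteq> j" "dref i j k \<noteq> dref i j l"
  shows "reflections_through m (dref i j k) (dref i j l) = range (dref i j)"
proof -
  have "span {root_of (dref i j k), root_of (dref i j l)} = span {\<alpha> i, \<alpha> j}"
    using assms(2) by (intro span_two_roots root_of_dref) auto
  then show ?thesis
    using reflection_in_plane[OF _ assms(1)] by (auto simp: mem_reflections_through_iff)
qed

text \<open>If \<open>m i j > 2\<close>, the indices 0, 1 and 2 give three distinct reflections; if
  \<open>m i j = 2\<close>, only the parity of the index matters.\<close>

lemma range_dref_eq_pair_iff:
  assumes "i \<noteq> j" "dref i j k \<noteq> dref i j l"
  shows "range (dref i j) = {dref i j k, dref i j l} \<longleftrightarrow> m i j = 2"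
proof
  assume r: "range (dref i j) = {dref i j k, dref i j l}"
  show "m i j = 2"
  proof (rule ccontr)
    assume "m i j \<noteq> 2"
    then have "int (m i j) > 2" using m_ge2[OF assms(1)] by simp
    then have "\<not> int (m i j) dvd 1" "\<not> int (m i j) dvd 2" using zdvd_not_zless by auto
    moreover have "dref i j k' = dref i j l' \<or> dref i j l' = dref i j n' \<or> dref i j k' = dref i j n'" for k' l' n'
      using r by (metis empty_iff insert_iff rangeI)
    from this[of 0 1 2] have "int (m i j) dvd 1 \<or> int (m i j) dvd 2"
      using dref_eq_iff[OF assms(1), of 0 1] dref_eq_iff[OF assms(1), of 1 2] dref_eq_iff[OF assms(1), of 0 2] by auto
    ultimately show False by blast
  qed
next
  assume m: "m i j = 2"
  have "dref i j n = dref i j k \<or> dref i j n = dref i j l" for n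
  proof -
    have "odd (k - l)" using assms m by (simp add: dref_eq_iff)
    then have "even (n - k) \<or> even (n - l)" by presburger
    then show ?thesis using assms(1) m by (simp add: dref_eq_iff)
  qed
  then show "range (dref i j) = {dref i j k, dref i j l}" by auto
qed

text \<open>\<open>refl_conj\<close> ranges over all of \<open>R\<close>, but a reflection that
  moves \<open>\<alpha> i\<close> within the plane changes it by a nonzero multiple of its own root.
  That root then lies in the plane, so the reflection is some \<open>dref i j l\<close>, which
  conjugates index 0 to index \<open>2 * l\<close>.\<close>

lemma refl_conj_dref:
  assumes "i \<noteq> j" "\<not> int (m i j) dvd n"
  shows "refl_conj m (dref i j n) (cls [i]) = {dref i j l | l. int (m i j) dvd 2 * l - n}"
proof (intro equalityI subsetI)
  fix r assume "r \<in> refl_conj m (dref i j n) (cls [i])"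
  then have r: "r \<in> R" "conj_by G r (cls [i]) = dref i j n"
    by (simp_all add: mem_refl_conj_iff conj_by_reflection)
  have neq: "dref i j n \<noteq> cls [i]" using dref_eq_iff[OF assms(1), of n 0] assms(2) by (simp add: dref_0)
  define \<beta> where "\<beta> = root_of r"
  have \<alpha>: "gact r (\<alpha> i) = \<alpha> i - (2 * form \<beta> (\<alpha> i)) *\<^sub>R \<beta>"
    using root_of(2)[OF r(1)] by (simp add: \<beta>_def refl_in_def)
  have lin: "gact r (- \<alpha> i) = - gact r (\<alpha> i)" unfolding gact_def by simp
  have conj: "root_of (dref i j n) = gact r (\<alpha> i) \<or> root_of (dref i j n) = - gact r (\<alpha> i)"
    using root_of_conj_by[of r "cls [i]"] r reflections_carrier root_of_simple[of i] lin by (metis minus_minus simple_reflections)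
  have "form \<beta> (\<alpha> i) \<noteq> 0"
  proof
    assume "form \<beta> (\<alpha> i) = 0"
    then have "gact r (\<alpha> i) = \<alpha> i" using \<alpha> by simp
    then have "root_of (dref i j n) = root_of (cls [i]) \<or> root_of (dref i j n) = - root_of (cls [i])"
      using conj root_of_simple[of i] by auto
    then show False using root_of_inj[of "dref i j n" "cls [i]"] neq by simp
  qed
  moreover have "gact r (\<alpha> i) \<in> span {\<alpha> i, \<alpha> j}"
    using conj root_of_dref[of i j n] uminus_span_iff by metis
  then have "(2 * form \<beta> (\<alpha> i)) *\<^sub>R \<beta> \<in> span {\<alpha> i, \<alpha> j}"
    using span_diff[of "\<alpha> i" "{\<alpha> i, \<alpha> j}" "gact r (\<alpha> i)"] \<alpha> by (simp add: span_base)
  then have "inverse (2 * form \<beta> (\<alpha> i)) *\<^sub>R (2 * form \<beta> (\<alpha> i)) *\<^sub>R \<beta> \<in> span {\<alpha> i, \<alpha> j}"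
    by (rule span_scale)
  ultimately have "\<beta> \<in> span {\<alpha> i, \<alpha> j}" by simp
  then obtain l where l: "r = dref i j l" using reflection_in_plane[OF r(1) assms(1)] \<beta>_def by blast
  then have "dref i j n = dref i j (2 * l)" using r(2) conj_by_dref[of i j l 0] by (simp add: dref_0)
  then show "r \<in> {dref i j l | l. int (m i j) dvd 2 * l - n}"
    using l dref_eq_iff[OF assms(1), of "2 * l" n] by auto
next
  fix r assume "r \<in> {dref i j l | l. int (m i j) dvd 2 * l - n}"
  then obtain l where l: "r = dref i j l" "int (m i j) dvd 2 * l - n" by blast
  then show "r \<in> refl_conj m (dref i j n) (cls [i])"
    using dref_eq_iff[OF assms(1), of "2 * l" n] conj_by_dref[of i j l 0] conj_by_reflection[of r "cls [i]"]
    by (simp add: mem_refl_conj_iff dref_0)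
qed

lemma reflections_through_conj_by:
  assumes g: "g \<in> carrier G" and s: "s \<in> R" and t: "t \<in> R"
  shows "reflections_through m (conj_by G g s) (conj_by G g t) = conj_by G g ` reflections_through m s t"
proof -
  have sub: "conj_by G g r \<in> reflections_through m (conj_by G g s) (conj_by G g t)"
    if "g \<in> carrier G" "s \<in> R" "t \<in> R" "r \<in> reflections_through m s t" for g r s t
  proof -
    have r: "r \<in> R" "root_of r \<in> span {root_of s, root_of t}"
      using that by (simp_all add: mem_reflections_through_iff)
    define S where "S = span {root_of (conj_by G g s), root_of (conj_by G g t)}"
    have "root_of (conj_by G g s) \<in> S" "root_of (conj_by G g t) \<in> S" by (simp_all add: S_def span_base)
    then have "gact g (root_of s) \<in> S" "gact g (root_of t) \<in> S"
      using root_of_conj_by[OF that(1,2)] root_of_conj_by[OF that(1,3)] uminus_span_iff unfolding S_def by metis+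
    moreover obtain a b where "root_of r = a *\<^sub>R root_of s + b *\<^sub>R root_of t" using r by (auto simp: mem_span_pair)
    ultimately have "gact g (root_of r) \<in> S"
      unfolding gact_def S_def by (simp add: span_add span_scale)
    then have "root_of (conj_by G g r) \<in> S"
      using root_of_conj_by[OF that(1) r(1)] uminus_span_iff unfolding S_def by metis
    then show ?thesis
      using that r conj_by_reflections by (simp add: mem_reflections_through_iff S_def)
  qed
  show ?thesis
  proof (intro equalityI subsetI)
    fix r assume r: "r \<in> reflections_through m (conj_by G g s) (conj_by G g t)"
    have "conj_by G (inv\<^bsub>G\<^esub> g) r \<in> reflections_through m s t"
      using sub[OF inv_closed[OF g] conj_by_reflections[OF g s] conj_by_reflections[OF g t] r] g s t
      by (simp add: reflections_carrier)
    moreover have "r = conj_by G g (conj_by G (inv\<^bsub>G\<^esub> g) r)"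
      using g r reflections_carrier by (simp add: reflections_through_def)
    ultimately show "r \<in> conj_by G g ` reflections_through m s t" by blast
  qed (use sub g s t in blast)
qed

text \<open>The normal form in which all relations between \<open>e_s\<close> and \<open>e_t\<close>
  are checked. Once both reflections lie in one dihedral group, conjugation inside it brings
  \<open>t\<close> to index 0 or 1, according to parity.\<close>

theorem exists_dihedral_form:
  assumes "s \<in> R" "t \<in> R" "s \<noteq> t"
  obtains g i j n where "g \<in> carrier G" "i \<noteq> j" "conj_by G g t = cls [i]" "conj_by G g s = dref i j n"
    "\<not> int (m i j) dvd n"
proof -
  note result = that
  have "root_of s \<noteq> root_of t" "root_of s \<noteq> - root_of t" using root_of_inj assms by blast+
  then obtain w i j where w: "i \<noteq> j" "act w (root_of s) \<in> span {\<alpha> i, \<alpha> j}" "act w (root_of t) \<in> span {\<alpha> i, \<alpha> j}"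
    using exists_rank_two root_of(1) assms by metis
  have "\<exists>l. conj_by G (cls w) r = dref i j l" if "r \<in> R" "act w (root_of r) \<in> span {\<alpha> i, \<alpha> j}" for r
    using root_of_conj_by[OF _ that(1), of "cls w"] that(2) uminus_span_iff
      reflection_in_plane[OF conj_by_reflections[OF _ that(1)] w(1), of "cls w"] by auto
  from this[OF assms(1) w(2)] this[OF assms(2) w(3)]
  obtain k l where kl: "conj_by G (cls w) s = dref i j k" "conj_by G (cls w) t = dref i j l"
    by metis
  have fin: thesis if "g \<in> carrier G" "i \<noteq> j" "conj_by G g t = cls [i]" "conj_by G g s = dref i j n" for g i j n
  proof (rule result[OF that])
    have "conj_by G g s \<noteq> conj_by G g t" using assms that(1) by (simp add: conj_by_eq_iff reflections_carrier)
    then show "\<not> int (m i j) dvd n"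
      using that(3,4) dref_eq_iff[OF that(2), of n 0] by (simp add: dref_0)
  qed
  have conj: "conj_by G (dref i j e \<cdot> cls w) s = dref i j (2 * e - k)"
    "conj_by G (dref i j e \<cdot> cls w) t = dref i j (2 * e - l)" for e
    using assms by (simp_all add: kl conj_by_dref reflections_carrier flip: conj_by_conj_by)
  show thesis
  proof (cases "even l")
    case True
    then obtain e where "l = 2 * e" by blast
    then show thesis using conj[of e] w(1) by (intro fin[of "dref i j e \<cdot> cls w" i j]) (simp_all add: dref_0)
  next
    case False
    \<comment> \<open>For odd index \<open>t\<close> is sent to \<open>s_j\<close>. Exchanging
      \<open>i\<close> and \<open>j\<close> makes this index 0 and replaces an index
      \<open>x\<close> by \<open>1 - x\<close>.\<close>
    then obtain e where "l = 2 * e + 1" using oddE by blast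
    then show thesis using conj[of "e + 1"] w(1)
      by (intro fin[of "dref i j (e + 1) \<cdot> cls w" j i "1 - (2 * (e + 1) - k)"])
        (simp_all add: dref_1 dref_swap[where i = i and j = j] algebra_simps)
  qed
qed

end

section \<open>The two presentations\<close>

context presentation begin

definition weq :: "'x list \<Rightarrow> 'x list \<Rightarrow> bool" where
  "weq u v \<longleftrightarrow> mon u \<doteq> mon v"

lemma weq_refl: "u \<in> lists X \<Longrightarrow> weq u u"
  by (simp add: weq_def eqv_refl)

lemma weq_sym: "weq u v \<Longrightarrow> weq v u"
  by (simp add: weq_def eqv_sym)

lemma weq_trans [trans]: "weq u v \<Longrightarrow> weq v w \<Longrightarrow> weq u w"
  unfolding weq_def by (rule eqv_trans)

lemma weq_rel: "(mon u, mon v) \<in> Rel \<Longrightarrow> weq u v"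
  unfolding weq_def by (rule eqv_rel)

lemma weq_append: "weq u u' \<Longrightarrow> weq v v' \<Longrightarrow> weq (u @ v) (u' @ v')"
  unfolding weq_def using eqv_mult[of "mon u" "mon u'" "mon v" "mon v'"] by (simp add: mon_mult)

lemma weq_context: "weq u v \<Longrightarrow> p \<in> lists X \<Longrightarrow> q \<in> lists X \<Longrightarrow> weq (p @ u @ q) (p @ v @ q)"
  by (intro weq_append weq_refl)

lemma zero_context_eqv:
  "p \<doteq> 0 \<Longrightarrow> u \<in> lists X \<Longrightarrow> v \<in> lists X \<Longrightarrow> mon u * p * mon v \<doteq> 0"
  using eqv_mult[OF eqv_mult[OF eqv_refl[of "mon u"], of p 0] eqv_refl[of "mon v"]] by simp

end

lemma const_mult_eq: "const c * p = p * const (c :: complex)" for p :: "'x free_poly"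
  by (induction p rule: free_poly_induct)
     (auto simp: distrib_left distrib_right const_mult_single single_mult_const)

locale class_functions = finite_coxeter +
  fixes \<mu> \<tau> :: "'a list set \<Rightarrow> complex"
  assumes \<mu>_conj_by: "\<And>g s. g \<in> carrier (coxeter_group m) \<Longrightarrow> s \<in> reflections m \<Longrightarrow> \<mu> (conj_by (coxeter_group m) g s) = \<mu> s"
    and \<tau>_conj_by: "\<And>g s. g \<in> carrier (coxeter_group m) \<Longrightarrow> s \<in> reflections m \<Longrightarrow> \<tau> (conj_by (coxeter_group m) g s) = \<tau> s"
begin

sublocale S: presentation UNIV "simple_rels m \<mu> \<tau>"
  by unfold_locales simp

abbreviation seq :: "'a gen list \<Rightarrow> 'a gen list \<Rightarrow> bool" (infix "\<bowtie>" 50) where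
  "u \<bowtie> v \<equiv> S.weq u v"

lemma S_refl: "S.eqv p p"
  by (rule S.eqv_refl) simp

lemma S_weq_refl: "u \<bowtie> u"
  by (rule S.weq_refl) simp

lemma S_context: "u \<bowtie> v \<Longrightarrow> p @ u @ q \<bowtie> p @ v @ q"
  by (rule S.weq_context) simp_all

lemma S_context_left: "u \<bowtie> v \<Longrightarrow> p @ u \<bowtie> p @ v"
  and S_context_right: "u \<bowtie> v \<Longrightarrow> u @ q \<bowtie> v @ q"
  by (simp_all add: S.weq_append S_weq_refl)

lemma S_rel: "(mon u, mon v) \<in> simple_rels m \<mu> \<tau> \<Longrightarrow> u \<bowtie> v"
  by (rule S.weq_rel)

lemma S_square_W: "[W i, W i] \<bowtie> []"
  unfolding S.weq_def mon_Nil by (rule S.eqv_rel) (rule simple_rels.square_W)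

lemma S_word_eq: "u \<sim> v \<Longrightarrow> map W u \<bowtie> map W v"
proof (induction rule: cox_eq.induct)
  case (append u u' v v')
  then show ?case unfolding map_append by (intro S.weq_append)
next
  case (braid i j)
  show ?case unfolding map_alt by (rule S_rel) (rule simple_rels.braid)
qed (auto intro: S_weq_refl S.weq_sym S.weq_trans simp: S_square_W)

lemma S_cancel: "map W (u @ rev u) \<bowtie> []" "map W (rev u @ u) \<bowtie> []"
  using S_word_eq[OF word_eq_cancel, of u] S_word_eq[OF word_eq_cancel', of u] by simp_all

lemma S_slide_positive:
  assumes "act w (\<alpha> i) = \<alpha> j" shows "map W w @ [E i] \<bowtie> [E j] @ map W w"
  using assms
proof (induction rule: simple_to_simple_induct)
  case (nil i)
  show ?case by (simp add: S_weq_refl)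
next
  case (comp u v i j k)
  have "map W v @ (map W u @ [E i]) \<bowtie> map W v @ ([E j] @ map W u)"
    by (intro S_context_left comp)
  also have "map W v @ ([E j] @ map W u) = (map W v @ [E j]) @ map W u" by simp
  also have "\<dots> \<bowtie> ([E k] @ map W v) @ map W u" by (intro S_context_right comp)
  finally show ?case by simp
next
  case (cong u v i j)
  have "map W v @ [E i] \<bowtie> map W u @ [E i]"
    by (intro S_context_right S.weq_sym[OF S_word_eq] cong)
  also have "\<dots> \<bowtie> [E j] @ map W u" by (rule cong)
  also have "\<dots> \<bowtie> [E j] @ map W v" by (intro S_context_left S_word_eq cong)
  finally show ?case .
next
  case (rank2 x y)
  show ?case
  proof (cases "even (m x y)")
    case True
    then obtain k where k: "m x y = 2 * k" by blast
    have "odd (m x y - 1)" using True m_ge2[OF rank2] by simp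
    then show ?thesis
      using S_rel[OF simple_rels.comm_even[where m = m and i = x and j = y and k = k, OF k]] by (simp add: k map_alt)
  next
    case False
    then obtain k where k: "m x y = 2 * k + 1" using oddE by blast
    show ?thesis
      using S_rel[OF simple_rels.slide_odd[where m = m and i = x and j = y and k = k, OF k]] by (simp add: k map_alt)
  qed
qed

lemma S_absorb: "[W i, E i] \<bowtie> [E i]" "[E i, W i] \<bowtie> [E i]"
  by (intro S_rel simple_rels.absorb_left simple_rels.absorb_right)+

text \<open>Conjugating \<open>s_i\<close> to \<open>s_j\<close> determines the image of
  \<open>\<alpha> i\<close> only up to sign. For the negative sign \<open>w s_i\<close> slides
  instead, and the extra letters come from and return to \<open>e_i\<close> by absorption.\<close>

lemma S_slide:
  assumes "cls (w @ [i] @ rev w) = cls [j]" shows "map W w @ [E i] \<bowtie> [E j] @ map W w"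
proof -
  have "refl_in (act w (\<alpha> i)) = refl_in (\<alpha> j)"
    using act_word_eq[of "w @ [i] @ rev w" "[j]"] assms unfolding cls_eq_iff act_reflection
    by (simp add: fun_eq_iff)
  then have "act w (\<alpha> i) = \<alpha> j \<or> act w (\<alpha> i) = - \<alpha> j" by (subst (asm) refl_in_eq_iff) simp_all
  then show ?thesis
  proof
    assume "act w (\<alpha> i) = - \<alpha> j"
    then have "act (w @ [i]) (\<alpha> i) = \<alpha> j" by (simp add: refl_in_self)
    then have slide: "map W (w @ [i]) @ [E i] \<bowtie> [E j] @ map W (w @ [i])" by (rule S_slide_positive)
    have "map W w @ [E i] \<bowtie> map W w @ [W i, E i]" by (intro S_context_left S.weq_sym[OF S_absorb(1)])
    also have "\<dots> \<bowtie> map W w @ [W i] @ [E i, W i]"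
      using S_context_left[OF S.weq_sym[OF S_absorb(2)], of "map W w @ [W i]" i] by simp
    also have "\<dots> = (map W (w @ [i]) @ [E i]) @ [W i]" by simp
    also have "\<dots> \<bowtie> ([E j] @ map W (w @ [i])) @ [W i]" by (intro S_context_right slide)
    also have "\<dots> = ([E j] @ map W w) @ [W i, W i]" by simp
    also have "\<dots> \<bowtie> ([E j] @ map W w) @ []" by (intro S_context_left S_square_W)
    finally show ?thesis by simp
  qed (rule S_slide_positive)
qed

definition Ws :: "'a list set \<Rightarrow> 'a gen list" where
  "Ws g = map W (SOME w. w \<in> g)"

definition ew :: "'a list \<Rightarrow> 'a \<Rightarrow> 'a gen list" where
  "ew u i = map W u @ [E i] @ map W (rev u)"

text \<open>The decomposition is an arbitrary choice; \<open>Es_cls\<close> shows that modulo the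
  relations every other decomposition gives the same element.\<close>

definition Es :: "'a list set \<Rightarrow> 'a gen list" where
  "Es s = (case SOME (u, i). s = cls (u @ [i] @ rev u) of (u, i) \<Rightarrow> ew u i)"

text \<open>For two decompositions of one reflection, \<open>rev v @ u\<close> conjugates
  \<open>s_i\<close> to \<open>s_j\<close>, so \<open>S_slide\<close> moves it past
  \<open>E i\<close>.\<close>

lemma ew_unique:
  assumes "cls (u @ [i] @ rev u) = cls (v @ [j] @ rev v)" shows "ew u i \<bowtie> ew v j"
proof -
  have "cls ((rev v @ u) @ [i] @ rev (rev v @ u)) = cls (rev v) \<cdot> cls (u @ [i] @ rev u) \<cdot> cls v" by simp
  also have "\<dots> = inv\<^bsub>G\<^esub> cls v \<cdot> cls v \<cdot> cls [j] \<cdot> (inv\<^bsub>G\<^esub> cls v \<cdot> cls v)" unfolding assms by simp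
  also have "\<dots> = cls [j]" by (simp del: cls_mult inv_cls)
  finally have slide: "map W (rev v @ u) @ [E i] \<bowtie> [E j] @ map W (rev v @ u)" by (rule S_slide)
  have "ew u i = [] @ map W u @ [E i] @ map W (rev u)" by (simp add: ew_def)
  also have "\<dots> \<bowtie> map W (v @ rev v) @ map W u @ [E i] @ map W (rev u)"
    by (intro S_context_right S.weq_sym[OF S_cancel(1)])
  also have "\<dots> = map W v @ (map W (rev v @ u) @ [E i]) @ map W (rev u)" by simp
  also have "\<dots> \<bowtie> map W v @ ([E j] @ map W (rev v @ u)) @ map W (rev u)"
    by (intro S_context slide)
  also have "\<dots> = (map W v @ [E j] @ map W (rev v)) @ map W (u @ rev u)" by simp
  also have "\<dots> \<bowtie> (map W v @ [E j] @ map W (rev v)) @ []"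
    by (intro S_context_left S_cancel)
  finally show ?thesis by (simp add: ew_def)
qed

lemma Ws_cls: "Ws (cls u) \<bowtie> map W u"
  unfolding Ws_def using some_cls[of u] by (intro S_word_eq) (simp add: cls_eq_iff)

lemma Es_cls: "Es (cls (u @ [i] @ rev u)) \<bowtie> ew u i"
proof -
  define P where "P = (\<lambda>(v, j). cls (u @ [i] @ rev u) = cls (v @ [j] @ rev v))"
  obtain v j where vj: "(SOME x. P x) = (v, j)" by fastforce
  have "P (u, i)" by (simp add: P_def)
  then have "P (SOME x. P x)" by (rule someI)
  then have "cls (u @ [i] @ rev u) = cls (v @ [j] @ rev v)" unfolding vj by (simp add: P_def)
  then have "ew v j \<bowtie> ew u i" by (intro ew_unique) simp
  moreover have "Es (cls (u @ [i] @ rev u)) = ew v j"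
    unfolding Es_def using vj by (simp add: P_def)
  ultimately show ?thesis by simp
qed

lemma Ws_simple: "Ws (cls [i]) \<bowtie> [W i]"
  using Ws_cls[of "[i]"] by simp

lemma Es_simple: "Es (cls [i]) \<bowtie> [E i]"
  using Es_cls[of "[]" i] by (simp add: ew_def)

lemma Ws_one: "Ws \<one>\<^bsub>G\<^esub> \<bowtie> []"
  using Ws_cls[of "[]"] by (simp add: one_G)

lemma Ws_mult: assumes "g \<in> carrier G" "h \<in> carrier G" shows "Ws g @ Ws h \<bowtie> Ws (g \<cdot> h)"
proof -
  obtain u v where uv: "g = cls u" "h = cls v" using assms by (auto elim!: carrierE)
  have "Ws g @ Ws h \<bowtie> map W u @ map W v" unfolding uv by (intro S.weq_append Ws_cls)
  also have "\<dots> = map W (u @ v)" by simp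
  also have "\<dots> \<bowtie> Ws (g \<cdot> h)" unfolding uv cls_mult by (intro S.weq_sym[OF Ws_cls])
  finally show ?thesis .
qed

lemma Ws_inv: assumes "g \<in> carrier G" shows "Ws g @ Ws (inv\<^bsub>G\<^esub> g) \<bowtie> []" "Ws (inv\<^bsub>G\<^esub> g) @ Ws g \<bowtie> []"
  using S.weq_trans[OF Ws_mult[OF assms inv_closed[OF assms]]] S.weq_trans[OF Ws_mult[OF inv_closed[OF assms] assms]]
    Ws_one assms by simp_all

lemma Es_conj_by:
  assumes g: "g \<in> carrier G" and s: "s \<in> R"
  shows "Es (conj_by G g s) \<bowtie> Ws g @ Es s @ Ws (inv\<^bsub>G\<^esub> g)"
proof -
  obtain u where u: "g = cls u" using g by (auto elim!: carrierE)
  obtain v i where v: "s = cls (v @ [i] @ rev v)" using s by (auto simp: reflections_eq)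
  have "conj_by G g s = cls ((u @ v) @ [i] @ rev (u @ v))" by (simp add: u v)
  then have "Es (conj_by G g s) \<bowtie> ew (u @ v) i" using Es_cls by metis
  also have "\<dots> = map W u @ ew v i @ map W (rev u)" by (simp add: ew_def)
  also have "\<dots> \<bowtie> Ws g @ Es s @ Ws (inv\<^bsub>G\<^esub> g)"
    unfolding u v inv_cls by (intro S.weq_append S.weq_sym[OF Ws_cls] S.weq_sym[OF Es_cls])
  finally show ?thesis .
qed

lemma Es_slide:
  assumes g: "g \<in> carrier G" and s: "s \<in> R"
  shows "Ws g @ Es s \<bowtie> Es (conj_by G g s) @ Ws g"
proof -
  have "Es (conj_by G g s) @ Ws g \<bowtie> (Ws g @ Es s @ Ws (inv\<^bsub>G\<^esub> g)) @ Ws g"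
    by (intro S_context_right Es_conj_by g s)
  also have "\<dots> = (Ws g @ Es s) @ (Ws (inv\<^bsub>G\<^esub> g) @ Ws g)" by simp
  also have "\<dots> \<bowtie> (Ws g @ Es s) @ []" by (intro S_context_left Ws_inv g)
  finally show ?thesis by (simp add: S.weq_sym)
qed

lemma S_absorb_reflection: assumes "s \<in> R" shows "Ws s @ Es s \<bowtie> Es s" "Es s @ Ws s \<bowtie> Es s"
proof -
  obtain u i where s: "s = cls (u @ [i] @ rev u)" using assms by (auto simp: reflections_eq)
  have "Ws s @ Es s \<bowtie> map W (u @ [i] @ rev u) @ ew u i"
    unfolding s by (intro S.weq_append Ws_cls Es_cls)
  also have "\<dots> = (map W u @ [W i]) @ map W (rev u @ u) @ [E i] @ map W (rev u)" by (simp add: ew_def)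
  also have "\<dots> \<bowtie> (map W u @ [W i]) @ [] @ [E i] @ map W (rev u)" by (intro S_context S_cancel)
  also have "\<dots> = map W u @ [W i, E i] @ map W (rev u)" by simp
  also have "\<dots> \<bowtie> map W u @ [E i] @ map W (rev u)" by (intro S_context S_absorb)
  also have "\<dots> = ew u i" by (simp add: ew_def)
  also have "\<dots> \<bowtie> Es s" unfolding s by (rule S.weq_sym[OF Es_cls])
  finally show "Ws s @ Es s \<bowtie> Es s" .
  have "Es s @ Ws s \<bowtie> ew u i @ map W (u @ [i] @ rev u)"
    unfolding s by (intro S.weq_append Ws_cls Es_cls)
  also have "\<dots> = (map W u @ [E i]) @ map W (rev u @ u) @ [W i] @ map W (rev u)" by (simp add: ew_def)
  also have "\<dots> \<bowtie> (map W u @ [E i]) @ [] @ [W i] @ map W (rev u)" by (intro S_context S_cancel)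
  also have "\<dots> = map W u @ [E i, W i] @ map W (rev u)" by simp
  also have "\<dots> \<bowtie> map W u @ [E i] @ map W (rev u)" by (intro S_context S_absorb)
  also have "\<dots> = ew u i" by (simp add: ew_def)
  also have "\<dots> \<bowtie> Es s" unfolding s by (rule S.weq_sym[OF Es_cls])
  finally show "Es s @ Ws s \<bowtie> Es s" .
qed

lemma mon_const_mon: "mon u * (const c * mon v) * mon w = const c * mon (u @ v @ w)"
proof -
  have "mon u * (const c * mon v) * mon w = (mon u * const c) * (mon v * mon w)"
    by (simp add: mult.assoc)
  also have "\<dots> = (const c * mon u) * (mon v * mon w)" by (simp only: const_mult_eq)
  also have "\<dots> = const c * (mon u * (mon v * mon w))" by (simp only: mult.assoc)
  finally show ?thesis by (simp only: mon_mult)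
qed

lemma S_square_reflection:
  assumes "s \<in> R" shows "S.eqv (mon (Es s @ Es s)) (const (\<tau> s) * mon (Es s))"
proof -
  obtain u i where s: "s = cls (u @ [i] @ rev u)" using assms by (auto simp: reflections_eq)
  have \<tau>: "\<tau> s = \<tau> (cls [i])" using \<tau>_conj_by[of "cls u" "cls [i]"] by (simp add: s)
  have "Es s @ Es s \<bowtie> ew u i @ ew u i" unfolding s by (intro S.weq_append Es_cls)
  also have "ew u i @ ew u i = (map W u @ [E i]) @ map W (rev u @ u) @ [E i] @ map W (rev u)"
    by (simp add: ew_def)
  also have "\<dots> \<bowtie> (map W u @ [E i]) @ [] @ [E i] @ map W (rev u)" by (intro S_context S_cancel)
  finally have "S.eqv (mon (Es s @ Es s)) (mon (map W u) * mon [E i, E i] * mon (map W (rev u)))"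
    by (simp add: S.weq_def mon_mult)
  also have "S.eqv \<dots> (mon (map W u) * (const (\<tau> (cls [i])) * mon [E i]) * mon (map W (rev u)))"
    by (intro S.eqv_mult S_refl S.eqv_rel simple_rels.square_E)
  also have "\<dots> = const (\<tau> s) * mon (ew u i)" by (simp add: mon_const_mon \<tau> ew_def)
  also have "S.eqv \<dots> (const (\<tau> s) * mon (Es s))"
    using S.weq_sym[OF Es_cls] unfolding s S.weq_def by (intro S.eqv_mult S_refl)
  finally show ?thesis .
qed

end

lemma const_left_commute: "p * (const c * q) = const c * (p * q)"
  by (metis const_mult_eq mult.assoc)

section \<open>Relations between e_s and e_t in the simple presentation\<close>

context class_functions begin

lemma Ws_word: "g = cls u \<Longrightarrow> Ws g \<bowtie> map W u"
  using Ws_cls by simp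

lemma \<mu>_dref: "\<mu> (dref i j (2 * l - n)) = \<mu> (dref i j n)"
  using \<mu>_conj_by[of "dref i j l" "dref i j n"] by (simp add: conj_by_dref)

text \<open>Shifting the index by an odd \<open>m i j\<close> changes its parity, so all reflections
  of the dihedral group are conjugate. In particular both branches of the coefficient in
  \<open>link_odd\<close> agree.\<close>

lemma \<mu>_dref_odd:
  assumes "i \<noteq> j" "odd (m i j)" shows "\<mu> (dref i j n) = \<mu> (cls [i])"
proof -
  have "\<mu> (dref i j n) = \<mu> (dref i j 0)" if "even n" for n
  proof -
    obtain k where "n = 2 * k" using \<open>even n\<close> by (elim evenE)
    then show ?thesis using \<mu>_dref[of i j k 0] by simp
  qed
  moreover have "dref i j (n + int (m i j)) = dref i j n" using dref_eq_iff[OF assms(1)] by simp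
  moreover have "even n \<or> even (n + int (m i j))" using assms(2) by simp
  ultimately show ?thesis unfolding dref_0[symmetric, of i j] by metis
qed

lemma dref_uminus: "dref i j (- l) = cls [i] \<cdot> dref i j l \<cdot> cls [i]"
  using conj_by_dref[of i j 0 l] conj_by_reflection[of "cls [i]" "dref i j l"] by (simp add: dref_0)

text \<open>Index \<open>- l\<close> is the conjugate of index \<open>l\<close> by
  \<open>s_i\<close>, and the two extra letters are absorbed by the neighbouring \<open>e_i\<close>.
  This reaches the indices beyond the range of \<open>link_odd\<close>.\<close>

lemma link_uminus: "[E i] @ Ws (dref i j (- l)) @ [E i] \<bowtie> [E i] @ Ws (dref i j l) @ [E i]"
proof -
  have "Ws (cls [i] \<cdot> dref i j l) @ Ws (cls [i]) \<bowtie> Ws (dref i j (- l))"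
    unfolding dref_uminus by (rule Ws_mult) simp_all
  moreover have "Ws (cls [i]) @ Ws (dref i j l) \<bowtie> Ws (cls [i] \<cdot> dref i j l)" by (rule Ws_mult) simp_all
  ultimately have "(Ws (cls [i]) @ Ws (dref i j l)) @ Ws (cls [i]) \<bowtie> Ws (dref i j (- l))"
    using S_context_right S.weq_trans by blast
  moreover have "[W i] @ Ws (dref i j l) @ [W i] \<bowtie> Ws (cls [i]) @ Ws (dref i j l) @ Ws (cls [i])"
    by (intro S.weq_append S_weq_refl S.weq_sym[OF Ws_simple])
  ultimately have *: "[W i] @ Ws (dref i j l) @ [W i] \<bowtie> Ws (dref i j (- l))"
    using S.weq_trans by simp
  have "[E i] @ Ws (dref i j (- l)) @ [E i] \<bowtie> [E i] @ ([W i] @ Ws (dref i j l) @ [W i]) @ [E i]"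
    by (intro S_context S.weq_sym[OF *])
  also have "\<dots> = [E i, W i] @ Ws (dref i j l) @ [W i, E i]" by simp
  also have "\<dots> \<bowtie> [E i] @ Ws (dref i j l) @ [E i]"
    by (intro S.weq_append S_weq_refl S_absorb)
  finally show ?thesis .
qed

text \<open>2 is invertible modulo an odd \<open>m i j\<close>, so the index \<open>l\<close> is
  unique modulo \<open>m i j\<close>.\<close>

lemma refl_conj_dref_odd:
  assumes ij: "i \<noteq> j" and odd: "odd (m i j)" and n: "\<not> int (m i j) dvd n" and l0: "int (m i j) dvd 2 * l0 - n"
  shows "refl_conj m (dref i j n) (cls [i]) = {dref i j l0}"
  unfolding refl_conj_dref[OF ij n]
proof (intro equalityI subsetI)
  have unique: "dref i j l = dref i j l0" if "int (m i j) dvd 2 * l - n" for l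
  proof -
    have "int (m i j) dvd (2 * l - n) - (2 * l0 - n)" using that l0 by (rule dvd_diff)
    then have "int (m i j) dvd 2 * (l - l0)" by (simp add: algebra_simps)
    moreover have "coprime (int (m i j)) 2" using odd by simp
    ultimately have "int (m i j) dvd l - l0" using coprime_dvd_mult_right_iff by blast
    then show ?thesis by (simp add: dref_eq_iff[OF ij])
  qed
  fix r assume "r \<in> {dref i j l | l. int (m i j) dvd 2 * l - n}"
  then show "r \<in> {dref i j l0}" by clarify (simp add: unique)
qed (use l0 in blast)

text \<open>Modulo \<open>2 * k\<close> the congruence \<open>2 * l = n\<close> fixes
  \<open>l\<close> only modulo \<open>k\<close>, which leaves the indices \<open>l\<close> and
  \<open>l + k\<close>.\<close>

lemma refl_conj_dref_even:
  assumes ij: "i \<noteq> j" and k: "m i j = 2 * k" and n: "\<not> int (m i j) dvd n" and l: "int (m i j) dvd 2 * l - n"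
  shows "refl_conj m (dref i j n) (cls [i]) = {dref i j l, dref i j (l + int k)}"
    and "dref i j l \<noteq> dref i j (l + int k)"
proof -
  have either: "dref i j l' = dref i j l \<or> dref i j l' = dref i j (l + int k)" if "int (m i j) dvd 2 * l' - n" for l'
  proof -
    have "int (m i j) dvd (2 * l' - n) - (2 * l - n)" using that l by (rule dvd_diff)
    then have "2 * int k dvd 2 * (l' - l)" by (simp add: k algebra_simps)
    then have "int k dvd l' - l" unfolding dvd_mult_cancel_left by simp
    then obtain q where q: "l' - l = int k * q" by blast
    show ?thesis
    proof (cases "even q")
      case True
      then have "2 * int k dvd l' - l" unfolding q by (simp add: mult.commute mult_dvd_mono)
      then show ?thesis by (simp add: dref_eq_iff[OF ij] k)
    next
      case False
      then obtain e where "q = 2 * e + 1" using oddE by blast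
      then have "l' - (l + int k) = 2 * int k * e" using q by (simp add: algebra_simps)
      then show ?thesis by (simp add: dref_eq_iff[OF ij] k)
    qed
  qed
  have shifted: "int (m i j) dvd 2 * (l + int k) - n"
  proof -
    have "2 * (l + int k) - n = (2 * l - n) + int (m i j)" by (simp add: k)
    then show ?thesis using l by (metis dvd_add dvd_refl)
  qed
  show "refl_conj m (dref i j n) (cls [i]) = {dref i j l, dref i j (l + int k)}"
    unfolding refl_conj_dref[OF ij n]
  proof (intro equalityI subsetI)
    fix r assume "r \<in> {dref i j l | l. int (m i j) dvd 2 * l - n}"
    then show "r \<in> {dref i j l, dref i j (l + int k)}" using either by clarify blast
  qed (use l shifted in blast)
  show "dref i j l \<noteq> dref i j (l + int k)"
    using k m_ge2[OF ij] zdvd_not_zless[of "int k" "2 * int k"] by (simp add: dref_eq_iff[OF ij] k)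
qed

lemma link_odd_core:
  assumes ij: "i \<noteq> j" and k: "m i j = 2 * k + 1" and l: "\<not> int (m i j) dvd l"
  shows "S.eqv (mon ([E i] @ Ws (dref i j l) @ [E i])) (const (\<mu> (cls [i])) * mon [E i])"
proof -
  have core: "S.eqv (mon ([E i] @ Ws (dref i j l) @ [E i])) (const (\<mu> (cls [i])) * mon [E i])"
    if l: "1 \<le> l" "l \<le> int k" for l
  proof -
    define p where "p = nat l - 1"
    have p: "nat l = p + 1" "l = int p + 1" using l by (simp_all add: p_def)
    have "[E i] @ Ws (dref i j l) @ [E i] \<bowtie> [E i] @ map W (alt (2 * p + 1) j i) @ [E i]"
      using cls_alt_odd[of p j i] p by (intro S_context Ws_word) simp
    also have "\<dots> = [E i] @ alt (2 * (p + 1) - 1) (W j) (W i) @ [E i]" by (simp only: map_alt) simp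
    finally have "S.eqv (mon ([E i] @ Ws (dref i j l) @ [E i])) (mon ([E i] @ alt (2 * (p + 1) - 1) (W j) (W i) @ [E i]))"
      by (simp only: S.weq_def)
    also have "S.eqv \<dots> (const (\<mu> (simple m (if odd (p + 1) then i else j))) * mon [E i])"
      using k l p by (intro S.eqv_rel simple_rels.link_odd[where k = k]) auto
    also have "\<mu> (simple m (if odd (p + 1) then i else j)) = \<mu> (cls [i])"
      using \<mu>_dref_odd[OF ij, of 1] k by (simp add: dref_1)
    finally show ?thesis .
  qed
  define r where "r = l mod int (m i j)"
  have m0: "int (m i j) > 0" using k by simp
  have "r \<noteq> 0" using l by (simp add: r_def dvd_eq_mod_eq_0)
  moreover have "0 \<le> r" "r < int (m i j)" unfolding r_def using m0 by simp_all
  ultimately have r: "1 \<le> r" "r \<le> 2 * int k" using k by linarith+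
  have lr: "dref i j l = dref i j r" by (simp add: dref_eq_iff[OF ij] r_def mod_eq_dvd_iff[symmetric])
  show ?thesis
  proof (cases "r \<le> int k")
    case True
    then show ?thesis using core[of r] r lr by simp
  next
    case False
    \<comment> \<open>Indices from \<open>k + 1\<close> to \<open>2 * k\<close> are, modulo
      \<open>m i j\<close>, the negatives of those from 1 to \<open>k\<close>.\<close>
    have "dref i j (- (int (m i j) - r)) = dref i j l" unfolding lr by (simp add: dref_eq_iff[OF ij])
    then have "[E i] @ Ws (dref i j l) @ [E i] \<bowtie> [E i] @ Ws (dref i j (int (m i j) - r)) @ [E i]"
      using link_uminus[of i j "int (m i j) - r"] by simp
    then have "S.eqv (mon ([E i] @ Ws (dref i j l) @ [E i])) (mon ([E i] @ Ws (dref i j (int (m i j) - r)) @ [E i]))"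
      by (simp only: S.weq_def)
    also have "S.eqv \<dots> (const (\<mu> (cls [i])) * mon [E i])"
      using False r k by (intro core) auto
    finally show ?thesis .
  qed
qed

lemma link_even_core:
  assumes ij: "i \<noteq> j" and k: "m i j = 2 * k" and l: "1 \<le> l" "l < int k"
  shows "S.eqv (mon ([E i] @ Ws (dref i j l) @ [E i]))
    ((const (\<mu> (dref i j l)) + const (\<mu> (dref i j (l + int k))) * mon (map W (alt (2 * k) i j))) * mon [E i])"
proof -
  define p where "p = nat l - 1"
  have p: "l = int p + 1" using l by (simp add: p_def)
  define c s s' where "c = cls (alt (2 * k) i j)" and "s = cls (alt (2 * (p + 1) - 1) j i)"
    and "s' = inv\<^bsub>G\<^esub> c \<cdot> s"
  have s: "s = dref i j l" using cls_alt_odd[of p j i] by (simp add: s_def p)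
  \<comment> \<open>\<open>c\<close> is \<open>rot i j (- k)\<close>, the longest element of the
    dihedral group; multiplying by its inverse shifts the index by \<open>k\<close>.\<close>
  have "s' = rot i j (int k) \<cdot> dref i j l" by (simp add: s'_def s c_def cls_alt_even' rot_uminus del: inv_cls)
  then have s': "s' = dref i j (l + int k)" by (simp add: rot_mult_dref add.commute)
  have "[E i] @ Ws (dref i j l) @ [E i] \<bowtie> [E i] @ map W (alt (2 * p + 1) j i) @ [E i]"
    using cls_alt_odd[of p j i] p by (intro S_context Ws_word) simp
  also have "\<dots> = [E i] @ alt (2 * (p + 1) - 1) (W j) (W i) @ [E i]" by (simp only: map_alt) simp
  finally have "S.eqv (mon ([E i] @ Ws (dref i j l) @ [E i])) (mon ([E i] @ alt (2 * (p + 1) - 1) (W j) (W i) @ [E i]))"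
    by (simp only: S.weq_def)
  also have "S.eqv \<dots> ((const (\<mu> s) + const (\<mu> s') * mon (alt (2 * k) (W i) (W j))) * mon [E i])"
    using l by (intro S.eqv_rel simple_rels.link_even[where c = c] k c_def s_def s'_def) (auto simp: p)
  finally show ?thesis by (simp add: s s' map_alt)
qed

lemma Es_dref_conj:
  assumes "dref i j n = conj_by G (dref i j l) (cls [z])"
  shows "Es (dref i j n) \<bowtie> Ws (dref i j l) @ [E z] @ Ws (dref i j l)"
proof -
  have "Es (dref i j n) \<bowtie> Ws (dref i j l) @ Es (cls [z]) @ Ws (dref i j l)"
    using Es_conj_by[of "dref i j l" "cls [z]"] by (simp add: assms dref_inv)
  also have "\<dots> \<bowtie> Ws (dref i j l) @ [E z] @ Ws (dref i j l)" by (intro S_context Es_simple)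
  finally show ?thesis .
qed

lemma Es_dref_mult:
  assumes ij: "i \<noteq> j" and l: "int (m i j) dvd 2 * l - n"
  shows "S.eqv (mon (Es (dref i j n) @ [E i])) (mon (Ws (dref i j l)) * mon ([E i] @ Ws (dref i j l) @ [E i]))"
proof -
  have "dref i j n = conj_by G (dref i j l) (cls [i])"
    using conj_by_dref[of i j l 0] l dref_eq_iff[OF ij, of "2 * l" n] by (simp add: dref_0)
  from S_context_right[OF Es_dref_conj[OF this], of "[E i]"]
  show ?thesis by (simp add: S.weq_def mon_mult)
qed

text \<open>In rank two, the relations \<open>linked\<close> and \<open>orthogonal\<close> for \<open>s = dref i j n\<close> and \<open>t = s\<^sub>i\<close> hold
  because \<open>dref i j n = q s\<^sub>i q\<close> for every \<open>q\<close> in \<open>refl_conj\<close>, so that \<open>e\<^sub>s e\<^sub>t\<close> becomes \<open>q e\<^sub>i q e\<^sub>i\<close>.\<close>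

lemma S_linked_dihedral:
  assumes ij: "i \<noteq> j" and m2: "m i j \<noteq> 2" and n: "\<not> int (m i j) dvd n"
    and ne: "refl_conj m (dref i j n) (cls [i]) \<noteq> {}"
  shows "S.eqv (mon (Es (dref i j n) @ [E i]))
    ((\<Sum>r\<in>refl_conj m (dref i j n) (cls [i]). const (\<mu> r) * mon (Ws r)) * mon [E i])"
proof -
  obtain l0 where l0: "int (m i j) dvd 2 * l0 - n" using ne unfolding refl_conj_dref[OF ij n] by auto
  show ?thesis
  proof (cases "even (m i j)")
    case False
    then obtain k where k: "m i j = 2 * k + 1" using oddE by blast
    have single: "refl_conj m (dref i j n) (cls [i]) = {dref i j l0}"
      by (rule refl_conj_dref_odd[OF ij False n l0])
    have l: "\<not> int (m i j) dvd l0"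
    proof
      assume "int (m i j) dvd l0"
      then have "int (m i j) dvd 2 * l0 - (2 * l0 - n)" by (intro dvd_diff dvd_mult l0)
      then show False using n by simp
    qed
    have "S.eqv (mon (Es (dref i j n) @ [E i])) (mon (Ws (dref i j l0)) * mon ([E i] @ Ws (dref i j l0) @ [E i]))"
      by (rule Es_dref_mult[OF ij l0])
    also have "S.eqv \<dots> (mon (Ws (dref i j l0)) * (const (\<mu> (cls [i])) * mon [E i]))"
      by (intro S.eqv_mult S_refl link_odd_core[OF ij k l])
    also have "\<dots> = const (\<mu> (dref i j l0)) * mon (Ws (dref i j l0)) * mon [E i]"
      using False by (simp add: \<mu>_dref_odd[OF ij] const_left_commute mult.assoc)
    finally show ?thesis by (simp add: single)
  next
    case True
    then obtain k where k: "m i j = 2 * k" by blast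
    have k2: "k \<ge> 2" using k m2 m_ge2[OF ij] by simp
    \<comment> \<open>\<open>link_even\<close> is available only for \<open>1 \<le> l < k\<close>.
      Reduction modulo \<open>k\<close> stays among the solutions of \<open>2 * l = n\<close>, and
      \<open>l = 0\<close> would make \<open>m i j\<close> divide \<open>n\<close>.\<close>
    define l where "l = l0 mod int k"
    have "int k dvd l0 - l" by (simp add: l_def)
    then have "2 * int k dvd 2 * (l0 - l)" by (rule mult_dvd_mono[OF dvd_refl])
    moreover have "2 * int k dvd 2 * l0 - n" using l0 k by simp
    ultimately have "2 * int k dvd (2 * l0 - n) - 2 * (l0 - l)" by (rule dvd_diff[rotated])
    then have l: "int (m i j) dvd 2 * l - n" by (simp add: k algebra_simps)
    have "l \<noteq> 0" using l n by auto
    moreover have "0 \<le> l" "l < int k" using k2 by (simp_all add: l_def)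
    ultimately have bounds: "1 \<le> l" "l < int k" by simp_all
    note two = refl_conj_dref_even(1)[OF ij k n l] and distinct = refl_conj_dref_even(2)[OF ij k n l]
    \<comment> \<open>The second term of \<open>link_even\<close> appears as \<open>q c\<close>,
      which is the other member of \<open>refl_conj\<close>.\<close>
    have "dref i j (l + int k) = dref i j l \<cdot> cls (alt (2 * k) i j)"
      by (simp add: cls_alt_even' dref_mult_rot)
    then have c: "Ws (dref i j l) @ map W (alt (2 * k) i j) \<bowtie> Ws (dref i j (l + int k))"
      using S.weq_trans[OF S_context_left[OF S.weq_sym[OF Ws_cls]] Ws_mult[of "dref i j l" "cls (alt (2 * k) i j)"]] by simp
    define q a b where "q = dref i j l" and "a = \<mu> (dref i j l)" and "b = \<mu> (dref i j (l + int k))"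
    have "S.eqv (mon (Es (dref i j n) @ [E i])) (mon (Ws q) * mon ([E i] @ Ws q @ [E i]))"
      unfolding q_def by (rule Es_dref_mult[OF ij l])
    also have "S.eqv \<dots> (mon (Ws q) * ((const a + const b * mon (map W (alt (2 * k) i j))) * mon [E i]))"
      unfolding q_def a_def b_def by (intro S.eqv_mult S_refl link_even_core[OF ij k bounds])
    also have "\<dots> = (const a * mon (Ws q) + const b * mon (Ws q @ map W (alt (2 * k) i j))) * mon [E i]"
      by (simp add: distrib_left distrib_right const_left_commute mult.assoc flip: mon_mult)
    also have "S.eqv \<dots> ((const a * mon (Ws q) + const b * mon (Ws (dref i j (l + int k)))) * mon [E i])"
      using c unfolding q_def S.weq_def by (intro S.eqv_mult S.eqv_add S_refl)
    finally show ?thesis using distinct by (simp add: two q_def a_def b_def)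
  qed
qed

text \<open>Without a solution of \<open>2 * l = n\<close> modulo \<open>m i j\<close>, the index
  \<open>n\<close> is odd and \<open>m i j\<close> even. So \<open>s = q s_j q\<close> for a
  dihedral reflection \<open>q\<close>, and \<open>e_s e_i = q e_j q e_i\<close> contains a word
  killed by \<open>zero\<close>.\<close>

lemma S_orthogonal_dihedral:
  assumes ij: "i \<noteq> j" and m2: "m i j \<noteq> 2" and n: "\<not> int (m i j) dvd n"
    and empty: "refl_conj m (dref i j n) (cls [i]) = {}"
  shows "S.eqv (mon (Es (dref i j n) @ [E i])) 0"
proof -
  have none: "\<not> int (m i j) dvd 2 * l - n" for l using empty unfolding refl_conj_dref[OF ij n] by auto
  have "odd n" using none[of "n div 2"] by auto
  have "even (m i j)"
  proof (rule ccontr)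
    assume "odd (m i j)"
    \<comment> \<open>For odd \<open>m i j\<close> half of the even number \<open>n + m i j\<close>
      would be a solution.\<close>
    then have "2 * ((n + int (m i j)) div 2) - n = int (m i j)" using \<open>odd n\<close> by simp
    then show False using none by (metis dvd_refl)
  qed
  then obtain k where k: "m i j = 2 * k" by blast
  have k2: "k \<ge> 2" using k m2 m_ge2[OF ij] by simp
  obtain l where l: "n = 2 * l + 1" using \<open>odd n\<close> oddE by blast
  have "dref i j n = conj_by G (dref i j (l + 1)) (cls [j])"
    using conj_by_dref[of i j "l + 1" 1] by (simp add: dref_1 l algebra_simps)
  note Es = Es_dref_conj[OF this]
  obtain w where w: "w \<in> lists {i, j}" "dref i j (l + 1) = cls w" using dref_word by blast
  have "Es (dref i j n) @ [E i] \<bowtie> (Ws (dref i j (l + 1)) @ [E j] @ Ws (dref i j (l + 1))) @ [E i]"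
    by (intro S_context_right Es)
  also have "\<dots> = (Ws (dref i j (l + 1)) @ [E j]) @ Ws (dref i j (l + 1)) @ [E i]" by simp
  also have "\<dots> \<bowtie> (Ws (dref i j (l + 1)) @ [E j]) @ map W w @ [E i]"
    by (intro S_context Ws_word w)
  finally have "S.eqv (mon (Es (dref i j n) @ [E i])) (mon (Ws (dref i j (l + 1))) * mon ([E j] @ map W w @ [E i]))"
    by (simp add: S.weq_def mon_mult)
  also have "S.eqv \<dots> (mon (Ws (dref i j (l + 1))) * 0)"
    using k k2 m_sym[of j i] w(1) by (intro S.eqv_mult S_refl S.eqv_rel simple_rels.zero[where k = k]) auto
  finally show ?thesis by simp
qed

lemma S_commute_dihedral:
  assumes ij: "i \<noteq> j" and m2: "m i j = 2" and n: "\<not> int (m i j) dvd n"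
  shows "Es (dref i j n) @ [E i] \<bowtie> [E i] @ Es (dref i j n)"
proof -
  have "dref i j n = cls [j]" using n m2 by (simp add: dref_eq_iff[OF ij] flip: dref_1[of i j])
  then have Es: "Es (dref i j n) \<bowtie> [E j]" using Es_simple by simp
  have "Es (dref i j n) @ [E i] \<bowtie> [E j] @ [E i]" by (intro S_context_right Es)
  also have "\<dots> \<bowtie> [E i] @ [E j]" using m2 m_sym[of j i] S_rel[OF simple_rels.comm_E[of m j i \<mu> \<tau>]] by simp
  also have "\<dots> \<bowtie> [E i] @ Es (dref i j n)" by (intro S_context_left S.weq_sym[OF Es])
  finally show ?thesis .
qed

lemma Es_conjugated:
  assumes g: "g \<in> carrier G" and s: "s \<in> R" "conj_by G g s = s'"
  shows "Es s \<bowtie> Ws (inv\<^bsub>G\<^esub> g) @ Es s' @ Ws g"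
  using Es_conj_by[of "inv\<^bsub>G\<^esub> g" s'] s g conj_by_reflections[OF g] by (auto simp: reflections_carrier)

lemma Es_mult_conjugated:
  assumes g: "g \<in> carrier G" and s: "s \<in> R" "conj_by G g s = s'" and t: "t \<in> R" "conj_by G g t = t'"
  shows "Es s @ Es t \<bowtie> Ws (inv\<^bsub>G\<^esub> g) @ (Es s' @ Es t') @ Ws g"
proof -
  have "Es s @ Es t \<bowtie> (Ws (inv\<^bsub>G\<^esub> g) @ Es s' @ Ws g) @ (Ws (inv\<^bsub>G\<^esub> g) @ Es t' @ Ws g)"
    by (intro S.weq_append Es_conjugated g s t)
  also have "\<dots> = (Ws (inv\<^bsub>G\<^esub> g) @ Es s') @ (Ws g @ Ws (inv\<^bsub>G\<^esub> g)) @ (Es t' @ Ws g)" by simp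
  also have "\<dots> \<bowtie> (Ws (inv\<^bsub>G\<^esub> g) @ Es s') @ [] @ (Es t' @ Ws g)" by (intro S_context Ws_inv g)
  finally show ?thesis by simp
qed

text \<open>This turns the case distinction of \<open>BG_rels\<close> into the one between
  \<open>m i j = 2\<close> and larger entries in the normal form.\<close>

lemma reflections_through_pair_iff:
  assumes g: "g \<in> carrier G" and st: "s \<in> R" "t \<in> R" and ij: "i \<noteq> j"
    and conj: "conj_by G g t = cls [i]" "conj_by G g s = dref i j n" "\<not> int (m i j) dvd n"
  shows "reflections_through m s t = {s, t} \<longleftrightarrow> m i j = 2"
proof -
  have neq: "dref i j n \<noteq> dref i j 0" using conj(3) by (simp add: dref_eq_iff[OF ij])
  have "inj_on (conj_by G g) R" using g by (auto simp: inj_on_def conj_by_eq_iff reflections_carrier)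
  moreover have "reflections_through m s t \<subseteq> R" by (auto simp: reflections_through_def)
  moreover have "{s, t} \<subseteq> R" using st by simp
  ultimately have "reflections_through m s t = {s, t}
      \<longleftrightarrow> conj_by G g ` reflections_through m s t = conj_by G g ` {s, t}"
    by (rule inj_on_image_eq_iff[symmetric])
  also have "\<dots> \<longleftrightarrow> reflections_through m (dref i j n) (dref i j 0) = {dref i j n, dref i j 0}"
    using reflections_through_conj_by[OF g st] conj by (simp add: dref_0)
  also have "\<dots> \<longleftrightarrow> m i j = 2"
    unfolding reflections_through_dref[OF ij neq] by (rule range_dref_eq_pair_iff[OF ij neq])
  finally show ?thesis .
qed

lemma S_commute:
  assumes st: "s \<in> R" "t \<in> R" "s \<noteq> t" and through: "reflections_through m s t = {s, t}"
  shows "Es s @ Es t \<bowtie> Es t @ Es s"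
proof -
  obtain g i j n where g: "g \<in> carrier G" "i \<noteq> j" "conj_by G g t = cls [i]" "conj_by G g s = dref i j n"
    "\<not> int (m i j) dvd n" by (rule exists_dihedral_form[OF st])
  then have m2: "m i j = 2" using reflections_through_pair_iff st through by blast
  have "Es s @ Es t \<bowtie> Ws (inv\<^bsub>G\<^esub> g) @ (Es (dref i j n) @ Es (cls [i])) @ Ws g"
    by (intro Es_mult_conjugated g st)
  also have "\<dots> \<bowtie> Ws (inv\<^bsub>G\<^esub> g) @ (Es (dref i j n) @ [E i]) @ Ws g"
    by (intro S_context S_context_left Es_simple)
  also have "\<dots> \<bowtie> Ws (inv\<^bsub>G\<^esub> g) @ ([E i] @ Es (dref i j n)) @ Ws g"
    by (intro S_context S_commute_dihedral g m2)
  also have "\<dots> \<bowtie> Ws (inv\<^bsub>G\<^esub> g) @ (Es (cls [i]) @ Es (dref i j n)) @ Ws g"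
    by (intro S_context S_context_right S.weq_sym[OF Es_simple])
  also have "\<dots> \<bowtie> Es t @ Es s"
    by (intro S.weq_sym[OF Es_mult_conjugated] g st)
  finally show ?thesis .
qed

lemma Es_mult_dihedral:
  assumes "g \<in> carrier G" "s \<in> R" "t \<in> R" "conj_by G g t = cls [i]" "conj_by G g s = s'"
  shows "S.eqv (mon (Es s @ Es t)) (mon (Ws (inv\<^bsub>G\<^esub> g)) * mon (Es s' @ [E i]) * mon (Ws g))"
proof -
  have "Es s @ Es t \<bowtie> Ws (inv\<^bsub>G\<^esub> g) @ (Es s' @ Es (cls [i])) @ Ws g"
    by (intro Es_mult_conjugated assms)
  also have "\<dots> \<bowtie> Ws (inv\<^bsub>G\<^esub> g) @ (Es s' @ [E i]) @ Ws g"
    by (intro S_context S_context_left Es_simple)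
  finally show ?thesis by (simp add: S.weq_def mon_mult)
qed

lemma S_orthogonal:
  assumes st: "s \<in> R" "t \<in> R" "s \<noteq> t" and through: "reflections_through m s t \<noteq> {s, t}"
    and empty: "refl_conj m s t = {}"
  shows "S.eqv (mon (Es s @ Es t)) 0"
proof -
  obtain g i j n where g: "g \<in> carrier G" "i \<noteq> j" "conj_by G g t = cls [i]" "conj_by G g s = dref i j n"
    "\<not> int (m i j) dvd n" by (rule exists_dihedral_form[OF st])
  then have m2: "m i j \<noteq> 2" using reflections_through_pair_iff st through by blast
  have "refl_conj m (dref i j n) (cls [i]) = {}"
    using refl_conj_conj_by[OF g(1) st(1,2)] g empty by simp
  then have "S.eqv (mon (Ws (inv\<^bsub>G\<^esub> g)) * mon (Es (dref i j n) @ [E i]) * mon (Ws g)) 0"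
    by (intro S.zero_context_eqv S_orthogonal_dihedral g m2) simp_all
  with Es_mult_dihedral[OF g(1) st(1,2) g(3,4)] show ?thesis by (rule S.eqv_trans)
qed

text \<open>Conjugation by \<open>g\<close> maps \<open>refl_conj m s t\<close> bijectively to its
  dihedral counterpart and preserves \<open>\<mu>\<close>. The dihedral relation is therefore pulled
  back summand by summand, by \<open>h (g r h) = r h\<close> with \<open>h\<close> the inverse of
  \<open>g\<close>.\<close>

lemma S_linked:
  assumes st: "s \<in> R" "t \<in> R" "s \<noteq> t" and through: "reflections_through m s t \<noteq> {s, t}"
    and ne: "refl_conj m s t \<noteq> {}"
  shows "S.eqv (mon (Es s @ Es t)) ((\<Sum>r\<in>refl_conj m s t. const (\<mu> r) * mon (Ws r)) * mon (Es t))"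
proof -
  obtain g i j n where g: "g \<in> carrier G" "i \<noteq> j" "conj_by G g t = cls [i]" "conj_by G g s = dref i j n"
    "\<not> int (m i j) dvd n" by (rule exists_dihedral_form[OF st])
  then have m2: "m i j \<noteq> 2" using reflections_through_pair_iff st through by blast
  define h where "h = inv\<^bsub>G\<^esub> g"
  have h: "h \<in> carrier G" "inv\<^bsub>G\<^esub> h = g" using g(1) by (simp_all add: h_def)
  have image: "refl_conj m (dref i j n) (cls [i]) = conj_by G g ` refl_conj m s t"
    using refl_conj_conj_by[OF g(1) st(1,2)] g by simp
  have sub: "r \<in> R" if "r \<in> refl_conj m s t" for r using that refl_conj_subset by blast
  have inj: "inj_on (conj_by G g) (refl_conj m s t)"
    using g(1) sub by (auto simp: inj_on_def conj_by_eq_iff reflections_carrier)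
  have summand: "S.eqv (mon (Ws h) * (const (\<mu> (conj_by G g r)) * mon (Ws (conj_by G g r))) * mon [E i] * mon (Ws g))
      (const (\<mu> r) * mon (Ws r) * mon (Es t))" if "r \<in> refl_conj m s t" for r
  proof -
    have r: "r \<in> R" "r \<in> carrier G" using sub[OF that] reflections_carrier by auto
    have "Ws h @ Ws (conj_by G g r) \<bowtie> Ws (h \<cdot> conj_by G g r)" by (rule Ws_mult) (use h r g in simp_all)
    also have "h \<cdot> conj_by G g r = r \<cdot> h"
      using g(1) r by (simp add: h_def conj_by_def m_assoc[symmetric])
    also have "Ws (r \<cdot> h) \<bowtie> Ws r @ Ws h" by (intro S.weq_sym[OF Ws_mult] h r)
    finally have move: "Ws h @ Ws (conj_by G g r) \<bowtie> Ws r @ Ws h" .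
    have Et: "Ws h @ [E i] @ Ws g \<bowtie> Es t"
    proof -
      have "Ws h @ [E i] @ Ws g \<bowtie> Ws h @ Es (cls [i]) @ Ws g" by (intro S_context S.weq_sym[OF Es_simple])
      also have "\<dots> \<bowtie> Es t" unfolding h_def by (intro S.weq_sym[OF Es_conjugated] g st)
      finally show ?thesis .
    qed
    have "(Ws h @ Ws (conj_by G g r)) @ [E i] @ Ws g \<bowtie> (Ws r @ Ws h) @ [E i] @ Ws g"
      by (intro S_context_right move)
    also have "\<dots> = Ws r @ (Ws h @ [E i] @ Ws g)" by simp
    also have "\<dots> \<bowtie> Ws r @ Es t" by (intro S_context_left Et)
    finally have word: "Ws h @ Ws (conj_by G g r) @ [E i] @ Ws g \<bowtie> Ws r @ Es t" by simp
    have "mon (Ws h) * (const (\<mu> (conj_by G g r)) * mon (Ws (conj_by G g r))) * mon [E i] * mon (Ws g)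
        = mon (Ws h) * (const (\<mu> r) * mon (Ws (conj_by G g r))) * mon ([E i] @ Ws g)"
      using \<mu>_conj_by[OF g(1) r(1)] by (simp add: mult.assoc mon_mult)
    also have "\<dots> = const (\<mu> r) * mon (Ws h @ Ws (conj_by G g r) @ [E i] @ Ws g)"
      by (rule mon_const_mon)
    also have "S.eqv \<dots> (const (\<mu> r) * mon (Ws r @ Es t))"
      using word unfolding S.weq_def by (intro S.eqv_mult S_refl)
    finally show ?thesis by (simp add: mult.assoc mon_mult)
  qed
  have "S.eqv (mon (Es s @ Es t)) (mon (Ws h) * mon (Es (dref i j n) @ [E i]) * mon (Ws g))"
    unfolding h_def by (intro Es_mult_dihedral g st)
  also have "S.eqv \<dots> (mon (Ws h) * ((\<Sum>r\<in>refl_conj m (dref i j n) (cls [i]). const (\<mu> r) * mon (Ws r)) * mon [E i]) * mon (Ws g))"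
    using ne by (intro S.eqv_mult S_refl S_linked_dihedral g m2) (simp add: image)
  also have "\<dots> = (\<Sum>r\<in>refl_conj m s t.
      mon (Ws h) * (const (\<mu> (conj_by G g r)) * mon (Ws (conj_by G g r))) * mon [E i] * mon (Ws g))"
    unfolding image by (simp add: sum.reindex[OF inj] sum_distrib_left sum_distrib_right mult.assoc)
  also have "S.eqv \<dots> (\<Sum>r\<in>refl_conj m s t. const (\<mu> r) * mon (Ws r) * mon (Es t))"
    by (intro S.eqv_sum summand)
  finally show ?thesis by (simp add: sum_distrib_right)
qed

end

section \<open>The simple relations inside B_G and the isomorphism\<close>

lemma lists_map_image: "w \<in> lists (f ` A) \<longleftrightarrow> (\<exists>u\<in>lists A. w = map f u)"
  by (simp add: lists_image image_iff)

context class_functions begin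

lemma B_presentation: "presentation (BG_gens m) (BG_rels m \<mu> \<tau>)"
proof
  fix p q assume "(p, q) \<in> BG_rels m \<mu> \<tau>"
  then show "Poly_Mapping.keys p \<subseteq> lists (BG_gens m) \<and> Poly_Mapping.keys q \<subseteq> lists (BG_gens m)"
  proof cases
    case (linked s t)
    have "Poly_Mapping.keys (const (\<mu> r) * mon [W r]) \<subseteq> lists (BG_gens m)" if "r \<in> refl_conj m s t" for r
      using reflections_carrier[OF subsetD[OF refl_conj_subset that]]
      by (intro keys_mult_lists) (auto simp: BG_gens_def)
    then have "Poly_Mapping.keys (\<Sum>r\<in>refl_conj m s t. const (\<mu> r) * mon [W r]) \<subseteq> lists (BG_gens m)"
      using keys_sum[of "\<lambda>r. const (\<mu> r) * mon [W r]" "refl_conj m s t"] by blast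
    moreover have "Poly_Mapping.keys (mon [E t]) \<subseteq> lists (BG_gens m)"
      using linked(4) by (simp add: BG_gens_def)
    ultimately have "Poly_Mapping.keys q \<subseteq> lists (BG_gens m)"
      unfolding linked(2) by (rule keys_mult_lists)
    moreover have "Poly_Mapping.keys p \<subseteq> lists (BG_gens m)"
      unfolding linked(1) using linked(3,4) by (simp add: BG_gens_def)
    ultimately show ?thesis by simp
  next
    case (square s)
    then have "Poly_Mapping.keys (const (\<tau> s) * mon [E s]) \<subseteq> lists (BG_gens m)"
      by (intro keys_mult_lists) (auto simp: BG_gens_def)
    then show ?thesis using square by (auto simp: BG_gens_def)
  qed (auto simp: BG_gens_def reflections_carrier zero_list_def)
qed

sublocale B: presentation "BG_gens m" "BG_rels m \<mu> \<tau>"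
  by (rule B_presentation)

abbreviation beq :: "'a list set gen list \<Rightarrow> 'a list set gen list \<Rightarrow> bool" (infix "\<bowtie>\<^sub>B" 50) where
  "u \<bowtie>\<^sub>B v \<equiv> B.weq u v"

lemma gens_simps [simp]:
  "W g \<in> BG_gens m \<longleftrightarrow> g \<in> carrier G" "E s \<in> BG_gens m \<longleftrightarrow> s \<in> R"
  by (auto simp: BG_gens_def)

lemma B_rel: "(mon u, mon v) \<in> BG_rels m \<mu> \<tau> \<Longrightarrow> u \<bowtie>\<^sub>B v"
  by (rule B.weq_rel)

lemma B_one: "[W \<one>\<^bsub>G\<^esub>] \<bowtie>\<^sub>B []"
  unfolding B.weq_def mon_Nil by (rule B.eqv_rel) (rule BG_rels.unit)

lemma B_mult: "g \<in> carrier G \<Longrightarrow> h \<in> carrier G \<Longrightarrow> [W g, W h] \<bowtie>\<^sub>B [W (g \<cdot> h)]"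
  by (intro B_rel BG_rels.prod) simp_all

lemma B_slide:
  "g \<in> carrier G \<Longrightarrow> t \<in> R \<Longrightarrow> conj_by G g t = s \<Longrightarrow> [W g, E t] \<bowtie>\<^sub>B [E s, W g]"
  using conj_by_reflections by (intro B_rel BG_rels.conj) auto

definition to_BG :: "'a gen \<Rightarrow> 'a list set gen list" where
  "to_BG x = (case x of W i \<Rightarrow> [W (cls [i])] | E i \<Rightarrow> [E (cls [i])])"

lemma to_BG_simps [simp]: "to_BG (W i) = [W (cls [i])]" "to_BG (E i) = [E (cls [i])]"
  by (simp_all add: to_BG_def)

lemma B_word: "subst to_BG (map W w) \<bowtie>\<^sub>B [W (cls w)]"
proof (induction w)
  case Nil
  show ?case using B.weq_sym[OF B_one] by (simp add: one_G)
next
  case (Cons i w)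
  have "[W (cls [i])] @ subst to_BG (map W w) \<bowtie>\<^sub>B [W (cls [i])] @ [W (cls w)]"
    by (intro B.weq_append Cons B.weq_refl) simp
  also have "\<dots> \<bowtie>\<^sub>B [W (cls (i # w))]" using B_mult[of "cls [i]" "cls w"] by simp
  finally show ?case by simp
qed

lemma B_word_eq: "cls u = cls v \<Longrightarrow> subst to_BG (map W u) \<bowtie>\<^sub>B subst to_BG (map W v)"
proof -
  assume eq: "cls u = cls v"
  have "subst to_BG (map W u) \<bowtie>\<^sub>B [W (cls u)]" by (rule B_word)
  also have "\<dots> \<bowtie>\<^sub>B subst to_BG (map W v)" unfolding eq by (rule B.weq_sym[OF B_word])
  finally show ?thesis .
qed

lemma B_word_slide:
  assumes "conj_by G (cls w) (cls [i]) = cls [j]"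
  shows "subst to_BG (map W w @ [E i]) \<bowtie>\<^sub>B subst to_BG ([E j] @ map W w)"
proof -
  have "subst to_BG (map W w) @ [E (cls [i])] \<bowtie>\<^sub>B [W (cls w)] @ [E (cls [i])]"
    by (intro B.weq_append B_word B.weq_refl) simp
  also have "\<dots> \<bowtie>\<^sub>B [E (cls [j]), W (cls w)]" using B_slide[OF _ _ assms] by simp
  also have "\<dots> = [E (cls [j])] @ [W (cls w)]" by simp
  also have "\<dots> \<bowtie>\<^sub>B [E (cls [j])] @ subst to_BG (map W w)"
    by (intro B.weq_append B.weq_sym[OF B_word] B.weq_refl) simp
  finally show ?thesis by simp
qed

lemma B_sandwich:
  "subst to_BG ([E i] @ map W w @ [E j]) \<bowtie>\<^sub>B [E (cls [i]), W (cls w), E (cls [j])]"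
proof -
  have "[E (cls [i])] @ subst to_BG (map W w) @ [E (cls [j])] \<bowtie>\<^sub>B [E (cls [i])] @ [W (cls w)] @ [E (cls [j])]"
    by (intro B.weq_context B_word) simp_all
  then show ?thesis by simp
qed

text \<open>With \<open>q = dref i j l\<close> and \<open>s = q s_i q\<close>, sliding gives
  \<open>e_i q e_i = q e_s e_i\<close>, to which \<open>linked\<close> applies. Non-divisibility of
  \<open>2 * l\<close> says that \<open>s\<close> differs from \<open>s_i\<close>; for
  \<open>m i j = 2 * k\<close> this fails at \<open>l = k\<close>, the index left out of
  \<open>link_even\<close>.\<close>

lemma B_link_dihedral:
  assumes ij: "i \<noteq> j" and m2: "m i j \<noteq> 2" and l: "\<not> int (m i j) dvd 2 * l"
  shows "B.eqv (mon [E (cls [i]), W (dref i j l), E (cls [i])])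
    (mon [W (dref i j l)] * ((\<Sum>r\<in>refl_conj m (dref i j (2 * l)) (cls [i]). const (\<mu> r) * mon [W r]) * mon [E (cls [i])]))"
proof -
  define q s where "q = dref i j l" and "s = dref i j (2 * l)"
  have qs: "q \<in> carrier G" "s \<in> R" by (simp_all add: q_def s_def)
  have neq: "s \<noteq> dref i j 0" using l by (simp add: s_def dref_eq_iff[OF ij])
  have "refl_conj m s (cls [i]) \<noteq> {}" unfolding s_def refl_conj_dref[OF ij l] by (auto intro: exI[of _ l])
  moreover have "reflections_through m s (cls [i]) \<noteq> {s, cls [i]}"
    using reflections_through_dref[OF ij, of "2 * l" 0] range_dref_eq_pair_iff[OF ij, of "2 * l" 0] m2 neq
    by (simp add: s_def dref_0)
  ultimately have rel: "(mon [E s, E (cls [i])], (\<Sum>r\<in>refl_conj m s (cls [i]). const (\<mu> r) * mon [W r]) * mon [E (cls [i])])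
      \<in> BG_rels m \<mu> \<tau>"
    using neq qs by (intro BG_rels.linked) (simp_all add: dref_0)
  have "conj_by G q s = cls [i]" using conj_by_dref[of i j l "2 * l"] by (simp add: q_def s_def dref_0)
  then have "[E (cls [i]), W q] @ [E (cls [i])] \<bowtie>\<^sub>B [W q, E s] @ [E (cls [i])]"
    using qs by (intro B.weq_append B.weq_sym[OF B_slide] B.weq_refl) simp_all
  then have "B.eqv (mon [E (cls [i]), W q, E (cls [i])]) (mon [W q] * mon [E s, E (cls [i])])"
    by (simp add: B.weq_def mon_mult)
  also have "B.eqv \<dots> (mon [W q] * ((\<Sum>r\<in>refl_conj m s (cls [i]). const (\<mu> r) * mon [W r]) * mon [E (cls [i])]))"
    using qs by (intro B.eqv_mult B.eqv_rel[OF rel] B.eqv_refl) simp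
  finally show ?thesis unfolding q_def s_def .
qed

lemma B_const_eqv: "u \<bowtie>\<^sub>B v \<Longrightarrow> B.eqv (const c * mon u) (const c * mon v)"
  unfolding B.weq_def by (intro B.eqv_mult B.eqv_refl) simp_all

text \<open>Here \<open>refl_conj\<close> consists of \<open>q\<close> alone, and the leading
  \<open>q\<close> cancels it.\<close>

lemma B_link_odd:
  assumes k: "m i j = 2 * k + 1" and p: "Suc p \<le> k"
  shows "B.eqv (mon [E (cls [i]), W (dref i j (int p + 1)), E (cls [i])]) (const (\<mu> (cls [i])) * mon [E (cls [i])])"
proof -
  define l where "l = int p + 1"
  have ij: "i \<noteq> j" using k p m_diag by fastforce
  have l: "\<not> int (m i j) dvd 2 * l" using p k zdvd_not_zless[of "2 * l" "int (m i j)"] by (simp add: l_def)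
  define q where "q = dref i j l"
  have q: "q \<in> carrier G" "q \<in> R" by (simp_all add: q_def)
  have "B.eqv (mon [E (cls [i]), W q, E (cls [i])]) (mon [W q] * (const (\<mu> q) * mon [W q] * mon [E (cls [i])]))"
    using B_link_dihedral[OF ij _ l] k refl_conj_dref_odd[OF ij _ l, of l] by (simp add: q_def)
  also have "\<dots> = const (\<mu> (cls [i])) * mon ([W q, W q] @ [E (cls [i])])"
    using \<mu>_dref_odd[OF ij] k by (simp add: q_def const_left_commute mult.assoc mon_mult)
  also have "B.eqv \<dots> (const (\<mu> (cls [i])) * mon ([] @ [E (cls [i])]))"
  proof (intro B_const_eqv B.weq_append B.weq_refl)
    have "[W q, W q] \<bowtie>\<^sub>B [W (q \<cdot> q)]" using q by (intro B_mult)
    also have "\<dots> \<bowtie>\<^sub>B []" using B_one by (simp add: reflection_square q)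
    finally show "[W q, W q] \<bowtie>\<^sub>B []" .
  qed simp
  finally show ?thesis by (simp add: q_def l_def)
qed

text \<open>\<open>refl_conj\<close> has the members \<open>q\<close> and \<open>q'\<close>; the
  leading \<open>q\<close> turns them into \<open>q q = 1\<close> and \<open>q q' = c\<close>, which
  are the two terms on the right.\<close>

lemma B_link_even:
  assumes k: "m i j = 2 * k" and p: "Suc p < k"
  shows "B.eqv (mon [E (cls [i]), W (dref i j (int p + 1)), E (cls [i])])
    ((const (\<mu> (dref i j (int p + 1))) + const (\<mu> (dref i j (int p + 1 + int k))) * mon [W (cls (alt (2 * k) i j))]) * mon [E (cls [i])])"
proof -
  define l where "l = int p + 1"
  have ij: "i \<noteq> j" using k m_diag by (metis even_mult_iff even_numeral odd_one)
  have l: "\<not> int (m i j) dvd 2 * l" using p k zdvd_not_zless[of "2 * l" "int (m i j)"] by (simp add: l_def)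
  define q q' where "q = dref i j l" and "q' = dref i j (l + int k)"
  define c where "c = cls (alt (2 * k) i j)"
  have q: "q \<in> R" "q' \<in> R" "q \<in> carrier G" "q' \<in> carrier G" "c \<in> carrier G" by (simp_all add: q_def q'_def c_def)
  have c: "q \<cdot> q' = c" by (simp add: q_def q'_def c_def dref_mult cls_alt_even')
  have "m i j \<noteq> 2" using k p by simp
  then have "B.eqv (mon [E (cls [i]), W q, E (cls [i])])
      (mon [W q] * ((const (\<mu> q) * mon [W q] + const (\<mu> q') * mon [W q']) * mon [E (cls [i])]))"
    using B_link_dihedral[OF ij _ l] refl_conj_dref_even[OF ij k l, of l] by (simp add: q_def q'_def)
  also have "\<dots> = const (\<mu> q) * mon ([W q, W q] @ [E (cls [i])]) + const (\<mu> q') * mon ([W q, W q'] @ [E (cls [i])])"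
    by (simp add: distrib_left distrib_right const_left_commute mult.assoc mon_mult)
  also have "B.eqv \<dots> (const (\<mu> q) * mon ([] @ [E (cls [i])]) + const (\<mu> q') * mon ([W c] @ [E (cls [i])]))"
  proof (intro B.eqv_add B_const_eqv B.weq_append B.weq_refl)
    have "[W q, W q] \<bowtie>\<^sub>B [W (q \<cdot> q)]" using q by (intro B_mult)
    also have "\<dots> \<bowtie>\<^sub>B []" using B_one by (simp add: reflection_square q)
    finally show "[W q, W q] \<bowtie>\<^sub>B []" .
    show "[W q, W q'] \<bowtie>\<^sub>B [W c]" using B_mult[of q q'] q c by simp
  qed simp_all
  also have "\<dots> = (const (\<mu> q) + const (\<mu> q') * mon [W c]) * mon [E (cls [i])]"
    by (simp add: distrib_right mult.assoc mon_mult)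
  finally show ?thesis by (simp add: q_def q'_def c_def l_def)
qed

text \<open>Moving \<open>w\<close> past \<open>e_j\<close> leaves \<open>e_i e_t\<close> with
  \<open>t\<close> of odd index. For even \<open>m i j\<close> no reflection conjugates
  \<open>s_i\<close>, of index 0, to such a \<open>t\<close>, so \<open>orthogonal\<close>
  applies.\<close>

lemma B_zero:
  assumes k: "m i j = 2 * k" "k \<ge> 2" and w: "w \<in> lists {i, j}"
  shows "B.eqv (mon [E (cls [i]), W (cls w), E (cls [j])]) 0"
proof -
  have ij: "i \<noteq> j" using k m_diag by (metis even_mult_iff even_numeral odd_one)
  obtain l where "conj_by G (cls w) (dref i j 1) = dref i j (1 + 2 * l)" using conj_by_word_dref[OF w] by blast
  then have conj: "conj_by G (cls w) (cls [j]) = dref i j (1 + 2 * l)" by (simp add: dref_1)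
  define t where "t = dref i j (1 + 2 * l)"
  have t: "t \<in> R" by (simp add: t_def)
  have dvd_even: "even x" if "int (m i j) dvd x" for x
    using that k(1) dvd_trans[of 2 "int (m i j)" x] by simp
  have n: "\<not> int (m i j) dvd 1 + 2 * l" using dvd_even[of "1 + 2 * l"] by auto
  then have neq: "dref i j 0 \<noteq> t" using dref_eq_iff[OF ij, of "1 + 2 * l" 0] by (auto simp: t_def)
  have "refl_conj m t (cls [i]) = {}"
    unfolding t_def refl_conj_dref[OF ij n] using dvd_even by fastforce
  then have "refl_conj m (cls [i]) t = {}" using refl_conj_sym t by simp
  moreover have "reflections_through m (cls [i]) t \<noteq> {cls [i], t}"
    using reflections_through_dref[OF ij, of 0 "1 + 2 * l"] range_dref_eq_pair_iff[OF ij, of 0 "1 + 2 * l"] k neq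
    by (simp add: t_def dref_0)
  ultimately have "(mon [E (cls [i]), E t], 0) \<in> BG_rels m \<mu> \<tau>"
    using neq t by (intro BG_rels.orthogonal) (simp_all add: dref_0)
  then have "B.eqv (mon [] * mon [E (cls [i]), E t] * mon [W (cls w)]) 0"
    by (intro B.zero_context_eqv B.eqv_rel) simp_all
  then have zero: "B.eqv (mon [E (cls [i]), E t, W (cls w)]) 0" by (simp add: mon_mult)
  have "[E (cls [i])] @ [W (cls w), E (cls [j])] \<bowtie>\<^sub>B [E (cls [i])] @ [E t, W (cls w)]"
    using conj by (intro B.weq_append B_slide B.weq_refl) (simp_all add: t_def)
  then have "B.eqv (mon [E (cls [i]), W (cls w), E (cls [j])]) (mon [E (cls [i]), E t, W (cls w)])"
    by (simp add: B.weq_def)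
  then show ?thesis using zero by (rule B.eqv_trans)
qed

lemma push_subst_mult: "push (subst f) (p * q) = push (subst f) p * push (subst f) q"
  by (rule push_mult) simp

lemma push_subst_one: "push (subst f) 1 = 1"
  by (simp flip: mon_Nil)

lemma simple_to_BG: "presentation_map UNIV (simple_rels m \<mu> \<tau>) (BG_gens m) (BG_rels m \<mu> \<tau>) to_BG"
proof
  fix x :: "'a gen"
  show "to_BG x \<in> lists (BG_gens m)" by (auto simp: to_BG_def split: gen.splits)
next
  fix p q assume "(p, q) \<in> simple_rels m \<mu> \<tau>"
  then show "B.eqv (push (subst to_BG) p) (push (subst to_BG) q)"
  proof cases
    case (square_W i)
    have "subst to_BG (map W [i, i]) \<bowtie>\<^sub>B subst to_BG (map W [])"
      by (rule B_word_eq) (simp add: cls_eq_iff cox_eq.square)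
    then show ?thesis by (simp add: square_W B.weq_def push_subst_one mon_Nil)
  next
    case (braid i j)
    have "subst to_BG (map W (alt (m i j) i j)) \<bowtie>\<^sub>B subst to_BG (map W (alt (m i j) j i))"
      by (rule B_word_eq) (cases "i = j"; simp add: cls_eq_iff cox_eq.braid cox_eq.refl)
    then show ?thesis by (simp add: braid B.weq_def map_alt)
  next
    case (absorb_left i)
    then show ?thesis using B_rel[OF BG_rels.absorb_left[of "cls [i]"]] by (simp add: B.weq_def)
  next
    case (absorb_right i)
    then show ?thesis using B_rel[OF BG_rels.absorb_right[of "cls [i]"]] by (simp add: B.weq_def)
  next
    case (square_E i)
    then show ?thesis using B.eqv_rel[OF BG_rels.square[of "cls [i]"]]
      by (simp add: push_subst_mult)
  next
    case (comm_W i j)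
    have ij: "i \<noteq> j" using comm_W m_diag[of i] by auto
    have "conj_by G (dref i j 0) (dref i j 1) = dref i j 1"
      using comm_W by (simp add: conj_by_dref dref_eq_iff[OF ij])
    then have "subst to_BG (map W [i] @ [E j]) \<bowtie>\<^sub>B subst to_BG ([E j] @ map W [i])"
      by (intro B_word_slide) (simp only: dref_0 dref_1)
    then show ?thesis by (simp add: comm_W B.weq_def)
  next
    case (comm_E i j)
    have ij: "i \<noteq> j" using comm_E m_diag[of i] by auto
    have neq: "dref i j 0 \<noteq> dref i j 1" using comm_E by (simp add: dref_eq_iff[OF ij])
    then have "reflections_through m (dref i j 0) (dref i j 1) = {dref i j 0, dref i j 1}"
      using reflections_through_dref[OF ij neq] range_dref_eq_pair_iff[OF ij neq] comm_E by simp
    then have "[E (cls [i]), E (cls [j])] \<bowtie>\<^sub>B [E (cls [j]), E (cls [i])]"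
      using neq by (intro B_rel BG_rels.commute) (simp_all add: dref_0 dref_1)
    then show ?thesis by (simp add: comm_E B.weq_def)
  next
    case (link_odd i j k l)
    then obtain e where e: "l = Suc e" by (cases l) auto
    have ij: "i \<noteq> j" using link_odd m_diag[of i] by auto
    have "[E i] @ alt (2 * l - 1) (W j) (W i) @ [E i] = [E i] @ map W (alt (2 * e + 1) j i) @ [E i]"
      by (simp only: map_alt e) simp
    then have "B.eqv (push (subst to_BG) p') (mon [E (cls [i]), W (dref i j (int e + 1)), E (cls [i])])"
      if "p' = mon ([E i] @ alt (2 * l - 1) (W j) (W i) @ [E i])" for p'
      using B_sandwich[of i "alt (2 * e + 1) j i" i] unfolding that cls_alt_odd B.weq_def push_single by simp
    from this[OF link_odd(1)] have "B.eqv (push (subst to_BG) p) (const (\<mu> (cls [i])) * mon [E (cls [i])])"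
      using B_link_odd[of i j k e] link_odd e B.eqv_trans by blast
    moreover have "\<mu> (cls [j]) = \<mu> (cls [i])" using \<mu>_dref_odd[OF ij, of 1] link_odd by (simp add: dref_1)
    ultimately show ?thesis by (simp add: link_odd(2) push_subst_mult)
  next
    case (slide_odd i j k)
    have "conj_by G (cls (alt (2 * k) i j)) (cls [i]) = cls [j]"
    proof (cases "i = j")
      \<comment> \<open>Since \<open>m i i = 1\<close>, the relation \<open>slide_odd\<close> also
        has the diagonal instance with \<open>k = 0\<close>.\<close>
      case True
      then have "k = 0" using slide_odd m_diag[of i] by simp
      then show ?thesis using True by simp
    next
      case False
      have "rot i j (- int k) \<cdot> dref i j 0 \<cdot> rot i j (int k) = dref i j (- int k - int k)"
        by (simp add: rot_mult_dref dref_mult_rot)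
      also have "\<dots> = dref i j 1"
      proof -
        have "- int k - int k - 1 = - int (m i j)" using slide_odd by simp
        then show ?thesis unfolding dref_eq_iff[OF False] by (metis dvd_minus_iff dvd_refl)
      qed
      finally show ?thesis
        unfolding cls_alt_even' by (simp add: conj_by_def dref_0 dref_1 flip: rot_uminus)
    qed
    from B_word_slide[OF this] show ?thesis by (simp add: slide_odd B.weq_def map_alt)
  next
    case (zero i j k w)
    then obtain u where u: "u \<in> lists {i, j}" "w = map W u" using lists_map_image[of w W "{i, j}"] by auto
    have "B.eqv (mon (subst to_BG ([E i] @ map W u @ [E j]))) 0"
      using B_sandwich[of i u j] B_zero[OF zero(3,4) u(1)] unfolding B.weq_def by (rule B.eqv_trans)
    then show ?thesis by (simp add: zero u)
  next
    case (link_even i j k l c s s')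
    then obtain e where e: "l = Suc e" by (cases l) auto
    have ij: "i \<noteq> j" using link_even m_diag[of i] by (metis even_mult_iff even_numeral odd_one)
    have s: "s = dref i j (int e + 1)" using cls_alt_odd[of e j i] link_even e by simp
    have "s' = rot i j (int k) \<cdot> dref i j (int e + 1)"
      using link_even s by (simp add: cls_alt_even' rot_uminus del: inv_cls)
    then have s': "s' = dref i j (int e + 1 + int k)" by (simp add: rot_mult_dref add.commute add.left_commute)
    have "[E i] @ alt (2 * l - 1) (W j) (W i) @ [E i] = [E i] @ map W (alt (2 * e + 1) j i) @ [E i]"
      by (simp only: map_alt e) simp
    then have "B.eqv (mon (subst to_BG ([E i] @ alt (2 * l - 1) (W j) (W i) @ [E i])))
        (mon [E (cls [i]), W (dref i j (int e + 1)), E (cls [i])])"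
      using B_sandwich[of i "alt (2 * e + 1) j i" i] unfolding cls_alt_odd B.weq_def by simp
    also have "B.eqv \<dots> ((const (\<mu> s) + const (\<mu> s') * mon [W (cls (alt (2 * k) i j))]) * mon [E (cls [i])])"
      unfolding s s' using link_even e by (intro B_link_even) simp_all
    also have "B.eqv \<dots> ((const (\<mu> s) + const (\<mu> s') * mon (subst to_BG (map W (alt (2 * k) i j)))) * mon [E (cls [i])])"
      using B.weq_sym[OF B_word[of "alt (2 * k) i j"]]
      by (intro B.eqv_mult B.eqv_add B_const_eqv B.eqv_refl) simp_all
    finally show ?thesis
      by (simp add: link_even(1,2) push_subst_mult push_add map_alt)
  next
    case (comm_even i j k)
    have ij: "i \<noteq> j" using comm_even m_diag[of i] by (metis even_mult_iff even_numeral odd_one)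
    then obtain e where e: "k = Suc e" using m_ge2[OF ij] comm_even by (cases k) auto
    \<comment> \<open>As \<open>e + 1 = k\<close>, index 0 is sent to \<open>2 * k = m i j\<close>,
      which is index 0 again. The indices refer to the pair \<open>j\<close>, \<open>i\<close>
      because the word starts with \<open>i\<close> and \<open>s_j\<close> has to be index
      0.\<close>
    have "conj_by G (dref j i (int e + 1)) (dref j i 0) = dref j i 0"
      using comm_even e ij m_sym[of j i] by (simp add: conj_by_dref dref_eq_iff algebra_simps)
    then have "conj_by G (cls (alt (2 * e + 1) i j)) (cls [j]) = cls [j]"
      unfolding cls_alt_odd by (simp only: dref_0)
    from B_word_slide[OF this] show ?thesis by (simp add: comm_even B.weq_def e map_alt del: alt.simps)
  qed
qed

definition from_BG :: "'a list set gen \<Rightarrow> 'a gen list" where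
  "from_BG x = (case x of W g \<Rightarrow> Ws g | E s \<Rightarrow> Es s)"

lemma from_BG_simps [simp]: "from_BG (W g) = Ws g" "from_BG (E s) = Es s"
  by (simp_all add: from_BG_def)

lemma BG_to_simple: "presentation_map (BG_gens m) (BG_rels m \<mu> \<tau>) UNIV (simple_rels m \<mu> \<tau>) from_BG"
proof
  fix p q assume "(p, q) \<in> BG_rels m \<mu> \<tau>"
  then show "S.eqv (push (subst from_BG) p) (push (subst from_BG) q)"
  proof cases
    case unit
    then show ?thesis using Ws_one by (simp add: push_subst_one S.weq_def mon_Nil)
  next
    case (prod w1 w2 w3)
    then show ?thesis using Ws_mult[of w1 w2] by (simp add: S.weq_def)
  next
    case (absorb_left s)
    then show ?thesis using S_absorb_reflection(1)[of s] by (simp add: S.weq_def)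
  next
    case (absorb_right s)
    then show ?thesis using S_absorb_reflection(2)[of s] by (simp add: S.weq_def)
  next
    case (square s)
    then show ?thesis using S_square_reflection[of s] by (simp add: push_subst_mult)
  next
    case (conj w s t)
    then show ?thesis using Es_slide[of w t] by (simp add: S.weq_def)
  next
    case (commute s t)
    then show ?thesis using S_commute[of s t] by (simp add: S.weq_def)
  next
    case (linked s t)
    then show ?thesis using S_linked[of s t] by (simp add: push_subst_mult push_sum)
  next
    case (orthogonal s t)
    then show ?thesis using S_orthogonal[of s t] by simp
  qed
qed simp

lemma from_to_BG: "S.eqv (mon (subst from_BG (to_BG x))) (mon [x])"
  using Ws_simple Es_simple by (cases x) (simp_all add: S.weq_def)

text \<open>For \<open>e_s\<close> the decomposition \<open>s = u s_i u^-1\<close> chosen in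
  \<open>Es\<close> is undone by sliding: \<open>u e_i u^-1 = e_s u u^-1 = e_s\<close>.\<close>

lemma to_from_BG: assumes "y \<in> BG_gens m" shows "B.eqv (mon (subst to_BG (from_BG y))) (mon [y])"
proof (cases y)
  case (W g)
  then obtain u where u: "g = cls u" using assms by (auto elim: carrierE)
  show ?thesis using B_word[of "SOME w. w \<in> g"] some_cls[of u] by (simp add: W Ws_def u B.weq_def)
next
  case (E s)
  define P where "P = (\<lambda>(v, j). s = cls (v @ [j] @ rev v))"
  obtain u i where ui: "(SOME x. P x) = (u, i)" by fastforce
  obtain v j where "s = cls (v @ [j] @ rev v)" using assms E by (auto simp: reflections_eq)
  then have "P (v, j)" by (simp add: P_def)
  then have "P (SOME x. P x)" by (rule someI)
  then have s: "s = cls (u @ [i] @ rev u)" unfolding ui by (simp add: P_def)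
  have Es: "Es s = ew u i" unfolding Es_def using ui by (simp add: P_def)
  have sR: "s \<in> R" using assms E by simp
  have "subst to_BG (Es s) = subst to_BG (map W u @ [E i]) @ subst to_BG (map W (rev u))"
    by (simp add: Es ew_def)
  also have "\<dots> \<bowtie>\<^sub>B [W (cls u), E (cls [i])] @ [W (cls (rev u))]"
  proof (intro B.weq_append B_word)
    have "subst to_BG (map W u) @ [E (cls [i])] \<bowtie>\<^sub>B [W (cls u)] @ [E (cls [i])]"
      by (intro B.weq_append B_word B.weq_refl) simp
    then show "subst to_BG (map W u @ [E i]) \<bowtie>\<^sub>B [W (cls u), E (cls [i])]" by simp
  qed
  also have "\<dots> \<bowtie>\<^sub>B [E s, W (cls u)] @ [W (cls (rev u))]"
    by (intro B.weq_append B_slide B.weq_refl) (simp_all add: s)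
  also have "\<dots> = [E s] @ [W (cls u), W (cls (rev u))]" by simp
  also have "\<dots> \<bowtie>\<^sub>B [E s] @ [W (cls (u @ rev u))]"
    using B_mult[of "cls u" "cls (rev u)"] sR by (intro B.weq_append B.weq_refl) simp_all
  also have "cls (u @ rev u) = \<one>\<^bsub>G\<^esub>" by (simp add: one_G cls_eq_iff word_eq_cancel)
  also have "[E s] @ [W \<one>\<^bsub>G\<^esub>] \<bowtie>\<^sub>B [E s] @ []"
    using sR by (intro B.weq_append B_one B.weq_refl) simp
  finally show ?thesis by (simp add: E B.weq_def)
qed

end

theorem theorem5p10:
  fixes m :: "'i::finite \<Rightarrow> 'i \<Rightarrow> nat"
    and \<mu> \<tau> :: "'i list set \<Rightarrow> complex"
  assumes "coxeter_matrix m"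
    and "finite (carrier (coxeter_group m))"
    and "\<And>s s' w. \<lbrakk>s \<in> reflections m; s' \<in> reflections m; w \<in> carrier (coxeter_group m);
            s' = conj_by (coxeter_group m) w s\<rbrakk> \<Longrightarrow> \<mu> s = \<mu> s' \<and> \<tau> s = \<tau> s'"
  shows "\<exists>h \<in> algebra_iso (simple_algebra m \<mu> \<tau>) (BG_algebra m \<mu> \<tau>).
    \<forall>i. h (presented_gen UNIV (simple_rels m \<mu> \<tau>) (W i))
          = presented_gen (BG_gens m) (BG_rels m \<mu> \<tau>) (W (simple m i)) \<and>
        h (presented_gen UNIV (simple_rels m \<mu> \<tau>) (E i))
          = presented_gen (BG_gens m) (BG_rels m \<mu> \<tau>) (E (simple m i))"
proof -
  interpret coxeter m by unfold_locales (rule assms(1))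
  interpret finite_coxeter m by unfold_locales (rule assms(2))
  interpret class_functions m \<mu> \<tau>
    by unfold_locales (use assms(3) conj_by_reflections in metis)+
  obtain h where "h \<in> algebra_iso (simple_algebra m \<mu> \<tau>) (BG_algebra m \<mu> \<tau>)"
    and h: "\<And>x. h (presented_gen UNIV (simple_rels m \<mu> \<tau>) x) = B.cls (mon (to_BG x))"
    using presentation_iso[OF simple_to_BG BG_to_simple from_to_BG to_from_BG] by auto
  then show ?thesis by (intro bexI[of _ h]) (simp_all add: h B.presented_gen_eq)
qed

end
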